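(* Fix a positive integer $k$. Let $g:[0,1]\to[0,\infty)$ be continuous with $g(2^{-k})=k2^{-k}$, and let $f:[0,\infty)\to[0,\infty)$ be increasing and strictly concave with $f(0)=0$ and $f(k)=k$. Suppose that for every $n\ge1$ and every $A\subseteq\{0,1\}^n$, $\int f(h_A)\,d\mu\ge g(\mu(A))$ (with $\mu$ uniform on $\{0,1\}^n$). Then there is a constant $K=K(f,g)>0$ such that for every $n$, every $\varepsilon>0$ and every partition $(A,B,W)$ of $V=\{0,1\}^n$ with $(1-\varepsilon)2^{-k}\le\mu(A)\le(1+\varepsilon)2^{-k}$, $\mu(W)\le \varepsilon/f(n)$ and $|\nabla(A,B)|<(1+\varepsilon)k2^{n-k}$: there is $I\subseteq[n]$ with $|I|=k$ such that $|\nabla_iA|\ge(1-K\varepsilon)2^{n-k}$ for all $i\in I$, and there is a codimension-$k$ subcube $C$ with $\mu(C\,\Delta\,A)\le K\varepsilon$.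
   Context: $V=\{0,1\}^n$ is the vertex set of the Hamming cube $Q_n$ (vertices adjacent iff they differ in exactly one coordinate). $d_T(x)$ is the number of neighbors of $x$ in $T$; $h_S(x)=d_{V\setminus S}(x)$ for $x\in S$ and $h_S(x)=0$ for $x\notin S$. $\int F\,d\mu=2^{-n}\sum_{x\in V}F(x)$. For $x\in V$, $x^i$ is $x$ with coordinate $i$ flipped. $\nabla(A,B)$ is the set of adjacent pairs $(x,y)$ with $x\in A$, $y\in B$; $\nabla_iA=\{(x,x^i):x\in A,\ x^i\notin A\}$. A codimension-$k$ subcube is $\{x: x_i=z_i\ \forall i\in I\}$ for some $|I|=k$, $z\in\{0,1\}^I$.
   Formalization: The conclusion is claimed only for n ≥ k; for n < k no k-subset of [n] or codimension-k subcube exists, while the hypotheses can hold when ε ≥ 1 (e.g. k=2, n=1, ε=1, A a single vertex, W empty). *)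

theory Defs
  imports "HOL-Analysis.Analysis"
begin

text \<open>Vertices of the Hamming cube Q_n are encoded as subsets x of {..<n}
  (x = set of coordinates equal to 1).\<close>

definition cube :: "nat \<Rightarrow> nat set set" where
  "cube n = Pow {..<n}"

definition flip :: "nat \<Rightarrow> nat set \<Rightarrow> nat set" where
  "flip i x = (if i \<in> x then x - {i} else insert i x)"

definition adj :: "nat \<Rightarrow> nat set \<Rightarrow> nat set \<Rightarrow> bool" where
  "adj n x y \<longleftrightarrow> x \<in> cube n \<and> y \<in> cube n \<and> card ((x - y) \<union> (y - x)) = 1"

definition deg :: "nat \<Rightarrow> nat set set \<Rightarrow> nat set \<Rightarrow> nat" where
  "deg n T x = card {y \<in> T. adj n x y}"

definition hS :: "nat \<Rightarrow> nat set set \<Rightarrow> nat set \<Rightarrow> nat" where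
  "hS n S x = (if x \<in> S then deg n (cube n - S) x else 0)"

definition mu :: "nat \<Rightarrow> nat set set \<Rightarrow> real" where
  "mu n A = real (card (A \<inter> cube n)) / 2 ^ n"

definition cube_int :: "nat \<Rightarrow> (nat set \<Rightarrow> real) \<Rightarrow> real" where
  "cube_int n F = (\<Sum>x\<in>cube n. F x) / 2 ^ n"

definition nabla :: "nat \<Rightarrow> nat set set \<Rightarrow> nat set set \<Rightarrow> (nat set \<times> nat set) set" where
  "nabla n A B = {(x, y). x \<in> A \<and> y \<in> B \<and> adj n x y}"

definition nabla_dir :: "nat \<Rightarrow> nat set set \<Rightarrow> (nat set \<times> nat set) set" where
  "nabla_dir i A = {(x, flip i x) | x. x \<in> A \<and> flip i x \<notin> A}"

definition subcube :: "nat \<Rightarrow> nat set \<Rightarrow> (nat \<Rightarrow> bool) \<Rightarrow> nat set set" where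
  "subcube n I z = {x \<in> cube n. \<forall>i\<in>I. (i \<in> x) = z i}"

definition is_subcube_codim :: "nat \<Rightarrow> nat \<Rightarrow> nat set set \<Rightarrow> bool" where
  "is_subcube_codim n k C \<longleftrightarrow>
     (\<exists>I z. I \<subseteq> {..<n} \<and> card I = k \<and> C = subcube n I z)"

definition strictly_concave_on :: "real set \<Rightarrow> (real \<Rightarrow> real) \<Rightarrow> bool" where
  "strictly_concave_on S f \<longleftrightarrow> convex S \<and>
    (\<forall>x\<in>S. \<forall>y\<in>S. \<forall>t. x \<noteq> y \<and> 0 < t \<and> t < 1 \<longrightarrow>
       f ((1 - t) * x + t * y) > (1 - t) * f x + t * f y)"

end

theory Submission
  imports Defs
begin

text \<open>
  Put \<open>S = A \<union> W\<close> and let \<open>m\<close> be its density. A two-point inequality for a profile \<open>U\<close> tensorises to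
  \<open>U(m) \<le> E U(M) + (boundary cost)\<close>, where \<open>M\<close> is the density of a random section of \<open>S\<close> over some
  coordinates \<open>Q\<close>; vertices of \<open>W\<close> pay only \<open>C\<close> times the square root of their number of boundary
  edges, in total at most \<open>C \<surd>n \<mu>(W)\<close>. The hypothesis on \<open>f\<close> and \<open>g\<close>, tested on Hamming balls,
  gives \<open>f(n) \<ge> c \<surd>n\<close>, so this is \<open>O(\<epsilon>)\<close>.

  A profile close to \<open>x log (1/x)\<close> bounds the relative entropy of \<open>M\<close> from below by the boundary in
  the directions \<open>Q\<close>, and a smoothed tent bounds \<open>E\<bar>M - m\<bar>\<close> by it from above; together they force the
  variance of \<open>M\<close> to be at least \<open>m\<close> times this boundary. For a sparse random \<open>Q\<close> this variance is
  essentially level-one Fourier weight, so the squared influences sum up to nearly \<open>k / 4^k\<close>. As the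
  influences are at most about \<open>2^-k\<close> and sum up to about \<open>k / 2^k\<close>, exactly \<open>k\<close> of them are close to
  \<open>2^-k\<close>, and \<open>S\<close> is close to a subcube. Finally the small part of \<open>S\<close> outside this subcube
  has a boundary much larger than its size, which upgrades closeness to \<open>O(\<epsilon>)\<close>.
\<close>

section \<open>Two-point inequalities on the cube\<close>

text \<open>Edges at \<open>W\<close> are absent from the count of edges between \<open>A\<close>
  and \<open>B\<close>, yet a vertex of \<open>W\<close> may have n of them. A cost linear in the
  degree would therefore not be controlled by a bound on the scale \<open>1 / sqrt n\<close> for the
  measure of \<open>W\<close>; this is why \<open>W\<close> pays a square root and why every profile
  must leave room for the loss \<eta>.

  Let \<beta> be the boundary in the directions \<open>Q\<close>. Up to errors the relative entropy
  is at least \<beta> and the mean deviation at most \<beta>; the scalar inequality weights them by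
  \<alpha> and \<alpha> - 1, so that exactly \<beta> remains. For a subcube nothing is lost as long
  as \<open>Q\<close> contains at most one of its fixed coordinates, which is typical for sparse
  \<open>Q\<close>.

  Sparseness also isolates level one: if coordinates are chosen with probability p, level-one weight
  enters the variance with the factor p and all higher levels with at most p^2. After division by p,
  errors of order p^2 vanish with p, but the constant \<open>C\<close> they require depends on p.
  Hence this part yields closeness without a rate, and the linear rate needs the separate argument
  at the end.\<close>

definition avg :: "nat set \<Rightarrow> (nat set \<Rightarrow> real) \<Rightarrow> real" where
  "avg N F = (\<Sum>x\<in>Pow N. F x) / 2 ^ card N"

definition bdirs :: "nat set set \<Rightarrow> nat set \<Rightarrow> nat set \<Rightarrow> nat set" where
  "bdirs S Q x = {i\<in>Q. flip i x \<notin> S}"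

definition cost :: "real \<Rightarrow> nat set set \<Rightarrow> nat set set \<Rightarrow> nat set \<Rightarrow> nat set \<Rightarrow> real" where
  "cost C S W Q x =
     (if x \<in> S then if x \<in> W then C * sqrt (real (card (bdirs S Q x)))
                     else real (card (bdirs S Q x)) else 0)"

text \<open>
  One step of the tensorisation adds a coordinate to a cube whose halves have densities \<open>a \<ge> b\<close>:
  at least \<open>a - b\<close> of the heavier half becomes boundary, and linearising the square root costs with
  slope \<open>\<sigma>\<close> loses the factor \<open>1 - \<eta> \<sigma>\<^sup>2\<close>, where \<open>\<eta> = 1 / C\<^sup>2\<close>.
\<close>

definition two_point :: "real \<Rightarrow> (real \<Rightarrow> real) \<Rightarrow> bool" where
  "two_point \<eta> U \<longleftrightarrow> (\<forall>x. 0 \<le> x \<and> x \<le> 1 \<longrightarrow> 0 \<le> U x) \<and>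
     (\<forall>a b. 0 \<le> b \<and> b \<le> a \<and> a \<le> 1 \<longrightarrow>
        (\<exists>\<sigma>. 0 \<le> \<sigma> \<and> \<sigma> \<le> 1 \<and>
          2 * U ((a + b) / 2) \<le> (1 - \<eta> * \<sigma>\<^sup>2) * U a + U b + \<sigma> * (a - b)))"

abbreviation dens :: "nat set \<Rightarrow> nat set set \<Rightarrow> real" where
  "dens N S \<equiv> avg N (\<lambda>x. of_bool (x \<in> S))"

section \<open>Averages, flips and the tensorisation\<close>

lemma avg_empty [simp]: "avg {} F = F {}"
  by (simp add: avg_def)

lemma avg_cong: "(\<And>x. x \<subseteq> N \<Longrightarrow> F x = G x) \<Longrightarrow> avg N F = avg N G"
  by (simp add: avg_def)

lemma avg_mono: "(\<And>x. x \<subseteq> N \<Longrightarrow> F x \<le> G x) \<Longrightarrow> avg N F \<le> avg N G"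
  unfolding avg_def by (intro divide_right_mono sum_mono) auto

lemma avg_add: "avg N (\<lambda>x. F x + G x) = avg N F + avg N G"
  by (simp add: avg_def sum.distrib add_divide_distrib)

lemma avg_diff: "avg N (\<lambda>x. F x - G x) = avg N F - avg N G"
  by (simp add: avg_def sum_subtractf diff_divide_distrib)

lemma avg_cmult: "avg N (\<lambda>x. c * F x) = c * avg N F"
  by (simp add: avg_def sum_distrib_left)

lemma avg_const [simp]: "finite N \<Longrightarrow> avg N (\<lambda>x. c) = c"
  by (simp add: avg_def card_Pow)

lemma avg_nonneg: "(\<And>x. x \<subseteq> N \<Longrightarrow> 0 \<le> F x) \<Longrightarrow> 0 \<le> avg N F"
  unfolding avg_def by (intro divide_nonneg_nonneg sum_nonneg) auto

lemma avg_sum: "avg N (\<lambda>x. \<Sum>i\<in>I. F i x) = (\<Sum>i\<in>I. avg N (F i))"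
  unfolding avg_def by (subst sum.swap) (simp add: sum_divide_distrib)

lemma avg_insert:
  assumes "finite N" "i \<notin> N"
  shows "avg (insert i N) F = (avg N F + avg N (\<lambda>x. F (insert i x))) / 2"
proof -
  have "inj_on (insert i) (Pow N)" using assms by (auto simp: inj_on_def)
  moreover have "Pow N \<inter> insert i ` Pow N = {}" using assms by auto
  ultimately have "(\<Sum>x\<in>Pow (insert i N). F x) = (\<Sum>x\<in>Pow N. F x) + (\<Sum>x\<in>Pow N. F (insert i x))"
    using assms by (simp add: Pow_insert sum.union_disjoint sum.reindex)
  then show ?thesis
    using assms by (simp add: avg_def field_simps)
qed

lemma avg_Un:
  assumes "finite Q" "finite R" "Q \<inter> R = {}"
  shows "avg (Q \<union> R) F = avg Q (\<lambda>z. avg R (\<lambda>w. F (z \<union> w)))"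
  using assms(1,3)
proof (induction Q arbitrary: F rule: finite_induct)
  case empty
  then show ?case by simp
next
  case (insert i Q)
  then have "avg (insert i Q \<union> R) F =
      (avg (Q \<union> R) F + avg (Q \<union> R) (\<lambda>x. F (insert i x))) / 2"
    using avg_insert[of "Q \<union> R" i F] assms(2) by auto
  also have "\<dots> = avg (insert i Q) (\<lambda>z. avg R (\<lambda>w. F (z \<union> w)))"
    using insert by (simp add: avg_insert)
  finally show ?case .
qed

lemma density_le_1: "finite N \<Longrightarrow> dens N S \<le> 1"
  using avg_mono[of N "\<lambda>x. of_bool (x \<in> S)" "\<lambda>_. 1"] by simp

lemma density_nonneg: "0 \<le> dens N S"
  by (rule avg_nonneg) simp

lemma finite_bdirs [simp]: "finite Q \<Longrightarrow> finite (bdirs S Q x)"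
  by (simp add: bdirs_def)

lemma flip_flip [simp]: "flip i (flip i x) = x"
  by (auto simp: flip_def)

lemma flip_insert: "i \<noteq> j \<Longrightarrow> flip j (insert i x) = insert i (flip j x)"
  by (auto simp: flip_def)

lemma flip_Un: "j \<notin> z \<Longrightarrow> flip j (z \<union> w) = z \<union> flip j w"
  by (auto simp: flip_def)

lemma flip_subset: "x \<subseteq> N \<Longrightarrow> i \<in> N \<Longrightarrow> flip i x \<subseteq> N"
  by (auto simp: flip_def)

lemma card_bdirs_insert:
  assumes "finite Q" "i \<notin> Q"
  shows "card (bdirs S (insert i Q) x) = card (bdirs S Q x) + of_bool (flip i x \<notin> S)"
proof -
  have "bdirs S (insert i Q) x = (if flip i x \<notin> S then insert i (bdirs S Q x) else bdirs S Q x)"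
    by (auto simp: bdirs_def)
  moreover have "i \<notin> bdirs S Q x" using assms by (auto simp: bdirs_def)
  ultimately show ?thesis using assms by simp
qed

lemma cost_nonneg: "0 \<le> C \<Longrightarrow> 0 \<le> cost C S W Q x"
  by (simp add: cost_def)

text \<open>Cauchy-Schwarz for the vectors \<open>(\<surd>q, 1)\<close> and \<open>(1 - \<tau>\<^sup>2, \<tau>)\<close>, the latter of norm at most 1, with \<open>\<tau> = \<sigma> / C\<close>.\<close>

lemma sqrt_Suc_ge:
  fixes q \<sigma> C :: real
  assumes "0 \<le> q" "0 \<le> \<sigma>" "\<sigma> \<le> 1" "1 \<le> C"
  shows "(1 - (1 / C\<^sup>2) * \<sigma>\<^sup>2) * (C * sqrt q) + \<sigma> \<le> C * sqrt (q + 1)"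
proof -
  define t where "t = \<sigma> / C"
  have t: "0 \<le> t" "t \<le> 1" using assms by (auto simp: t_def divide_simps)
  have t2: "t\<^sup>2 \<le> 1" using t by (simp add: power_le_one)
  define s where "s = sqrt q"
  have s: "0 \<le> s" "s\<^sup>2 = q" using assms by (auto simp: s_def)
  have "(1 - t\<^sup>2) * s + t \<le> sqrt (q + 1)"
  proof (rule real_le_rsqrt)
    have "((1 - t\<^sup>2) * s + t)\<^sup>2 \<le> ((1 - t\<^sup>2) * s + t)\<^sup>2 + ((1 - t\<^sup>2) - t * s)\<^sup>2"
      by simp
    also have "\<dots> = (1 - t\<^sup>2 * (1 - t\<^sup>2)) * (s\<^sup>2 + 1)"
      by (simp add: power2_eq_square algebra_simps)
    also have "\<dots> \<le> 1 * (s\<^sup>2 + 1)"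
      using t2 by (intro mult_right_mono) auto
    finally have "((1 - t\<^sup>2) * s + t)\<^sup>2 \<le> s\<^sup>2 + 1" by simp
    then show "((1 - t\<^sup>2) * s + t)\<^sup>2 \<le> q + 1" by (simp add: s)
  qed
  then have "C * ((1 - t\<^sup>2) * s + t) \<le> C * sqrt (q + 1)"
    using assms by (intro mult_left_mono) auto
  moreover have "C * t = \<sigma>" "t\<^sup>2 = (1 / C\<^sup>2) * \<sigma>\<^sup>2"
    using assms by (auto simp: t_def power_divide)
  ultimately show ?thesis by (simp add: s_def algebra_simps)
qed

text \<open>Off \<open>W\<close> a new boundary edge costs one more, hence at least \<sigma>; in
  \<open>W\<close> the increment is that of \<open>sqrt_Suc_ge\<close>. Without a new edge the
  scaling only lowers the left side.\<close>

lemma cost_insert_ge: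
  assumes "finite Q" "i \<notin> Q" "0 \<le> \<sigma>" "\<sigma> \<le> 1" "1 \<le> C"
  shows "(1 - (1 / C\<^sup>2) * \<sigma>\<^sup>2) * cost C S W Q x + \<sigma> * of_bool (x \<in> S \<and> flip i x \<notin> S)
    \<le> cost C S W (insert i Q) x"
proof -
  have le: "(1 - (1 / C\<^sup>2) * \<sigma>\<^sup>2) * y \<le> y" if "0 \<le> y" for y
  proof -
    have "0 \<le> (1 / C\<^sup>2) * \<sigma>\<^sup>2 * y" using that by simp
    then show ?thesis by (simp add: algebra_simps)
  qed
  show ?thesis
    using le[of "real (card (bdirs S Q x))"] le[of "C * sqrt (real (card (bdirs S Q x)))"]
      sqrt_Suc_ge[of "real (card (bdirs S Q x))" \<sigma> C] assms
    by (auto simp: cost_def card_bdirs_insert add.commute)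
qed

text \<open>Splitting at one coordinate replaces \<open>S\<close> and \<open>W\<close> by their
  halves, so the induction keeps both arbitrary. Coordinates in \<open>R\<close> are never split;
  they only define the section densities.\<close>

lemma two_point_induct:
  assumes U: "two_point (1 / C\<^sup>2) U" and C: "1 \<le> C"
    and "finite Q" "finite R" "Q \<inter> R = {}"
  shows "U (dens (Q \<union> R) S)
    \<le> avg Q (\<lambda>z. U (avg R (\<lambda>w. of_bool (z \<union> w \<in> S)))) + avg (Q \<union> R) (cost C S W Q)"
  using assms(3,5)
proof (induction Q arbitrary: S W rule: finite_induct)
  case empty
  have "0 \<le> avg R (cost C S W {})" using C by (intro avg_nonneg cost_nonneg) auto
  then show ?case by simp
next
  case (insert i Q)
  define N where "N = Q \<union> R"
  have N: "finite N" "i \<notin> N" "Q \<inter> R = {}" "finite Q" "i \<notin> Q"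
    using insert assms(4) by (auto simp: N_def)
  define S' where "S' = {x. insert i x \<in> S}"
  define W' where "W' = {x. insert i x \<in> W}"
  define f0 where "f0 = avg Q (\<lambda>z. U (avg R (\<lambda>w. of_bool (z \<union> w \<in> S))))"
  define f1 where "f1 = avg Q (\<lambda>z. U (avg R (\<lambda>w. of_bool (z \<union> w \<in> S'))))"
  define V0 where "V0 = avg N (cost C S W Q)"
  define V1 where "V1 = avg N (cost C S' W' Q)"
  have IH0: "U (dens N S) \<le> f0 + V0"
    using insert.IH[of S W] N by (simp add: N_def f0_def V0_def)
  have IH1: "U (dens N S') \<le> f1 + V1"
    using insert.IH[of S' W'] N by (simp add: N_def f1_def V1_def)
  have Unn: "\<And>x. 0 \<le> x \<Longrightarrow> x \<le> 1 \<Longrightarrow> 0 \<le> U x"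
    using U by (auto simp: two_point_def)
  have avg01: "0 \<le> avg R (\<lambda>w. of_bool (z \<union> w \<in> T))" "avg R (\<lambda>w. of_bool (z \<union> w \<in> T)) \<le> 1"
    for z and T :: "nat set set"
    using avg_mono[of R "\<lambda>w. of_bool (z \<union> w \<in> T)" "\<lambda>_. 1"] assms(4)
    by (auto intro: avg_nonneg)
  have f_nn: "0 \<le> f0" "0 \<le> f1"
    unfolding f0_def f1_def by (auto intro!: avg_nonneg Unn avg01)
  have main: "2 * U ((dens N S + dens N S') / 2)
      \<le> f0 + f1 + avg N (\<lambda>x. cost C S W (insert i Q) x)
         + avg N (\<lambda>x. cost C S W (insert i Q) (insert i x))"
  proof -
    have c1: "cost C S W Q (insert i x) = cost C S' W' Q x" for x
    proof -
      have "bdirs S Q (insert i x) = bdirs S' Q x"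
        using N flip_insert[of i _ x] by (auto simp: bdirs_def S'_def) metis+
      then show ?thesis by (simp add: cost_def S'_def W'_def)
    qed
    have fl: "flip i x = insert i x" "flip i (insert i x) = x" if "x \<subseteq> N" for x
      using that N by (auto simp: flip_def)
    have ge0: "(1 - (1 / C\<^sup>2) * \<sigma>\<^sup>2) * V0 + \<sigma> * avg N (\<lambda>x. of_bool (x \<in> S \<and> x \<notin> S'))
        \<le> avg N (\<lambda>x. cost C S W (insert i Q) x)" if "0 \<le> \<sigma>" "\<sigma> \<le> 1" for \<sigma>
    proof -
      have "avg N (\<lambda>x. (1 - (1 / C\<^sup>2) * \<sigma>\<^sup>2) * cost C S W Q x + \<sigma> * of_bool (x \<in> S \<and> x \<notin> S'))
        \<le> avg N (\<lambda>x. cost C S W (insert i Q) x)"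
      proof (rule avg_mono)
        fix x assume "x \<subseteq> N"
        then show "(1 - (1 / C\<^sup>2) * \<sigma>\<^sup>2) * cost C S W Q x + \<sigma> * of_bool (x \<in> S \<and> x \<notin> S')
          \<le> cost C S W (insert i Q) x"
          using cost_insert_ge[of Q i \<sigma> C S W x] N that C fl(1)[of x]
          by (simp add: S'_def)
      qed
      then show ?thesis unfolding V0_def avg_add avg_cmult .
    qed
    have ge1: "(1 - (1 / C\<^sup>2) * \<sigma>\<^sup>2) * V1 + \<sigma> * avg N (\<lambda>x. of_bool (x \<in> S' \<and> x \<notin> S))
        \<le> avg N (\<lambda>x. cost C S W (insert i Q) (insert i x))" if "0 \<le> \<sigma>" "\<sigma> \<le> 1" for \<sigma>
    proof -
      have "avg N (\<lambda>x. (1 - (1 / C\<^sup>2) * \<sigma>\<^sup>2) * cost C S' W' Q x + \<sigma> * of_bool (x \<in> S' \<and> x \<notin> S))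
        \<le> avg N (\<lambda>x. cost C S W (insert i Q) (insert i x))"
      proof (rule avg_mono)
        fix x assume "x \<subseteq> N"
        then show "(1 - (1 / C\<^sup>2) * \<sigma>\<^sup>2) * cost C S' W' Q x + \<sigma> * of_bool (x \<in> S' \<and> x \<notin> S)
          \<le> cost C S W (insert i Q) (insert i x)"
          using cost_insert_ge[of Q i \<sigma> C S W "insert i x"] N that C fl(2)[of x]
          by (simp add: c1 S'_def)
      qed
      then show ?thesis unfolding V1_def avg_add avg_cmult .
    qed
    have d0: "dens N S - dens N S' \<le> avg N (\<lambda>x. of_bool (x \<in> S \<and> x \<notin> S'))"
      unfolding avg_diff[symmetric] by (rule avg_mono) auto
    have d1: "dens N S' - dens N S \<le> avg N (\<lambda>x. of_bool (x \<in> S' \<and> x \<notin> S))"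
      unfolding avg_diff[symmetric] by (rule avg_mono) auto
    have nn0: "0 \<le> avg N (\<lambda>x. of_bool (x \<in> S \<and> x \<notin> S'))"
      and nn1: "0 \<le> avg N (\<lambda>x. of_bool (x \<in> S' \<and> x \<notin> S))"
      by (auto intro: avg_nonneg)
    have b: "0 \<le> dens N S" "dens N S \<le> 1" "0 \<le> dens N S'" "dens N S' \<le> 1"
      using N by (auto intro: density_le_1 density_nonneg)
    have scale: "0 \<le> 1 - (1 / C\<^sup>2) * \<sigma>\<^sup>2" "(1 - (1 / C\<^sup>2) * \<sigma>\<^sup>2) * y \<le> y"
      if "0 \<le> \<sigma>" "\<sigma> \<le> 1" "0 \<le> y" for \<sigma> y
    proof -
      have "1 / C\<^sup>2 \<le> 1" "\<sigma>\<^sup>2 \<le> 1"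
        using C that by (auto simp: power_le_one)
      then have "(1 / C\<^sup>2) * \<sigma>\<^sup>2 \<le> 1 * 1" by (intro mult_mono) auto
      then show "0 \<le> 1 - (1 / C\<^sup>2) * \<sigma>\<^sup>2" by simp
      have "0 \<le> (1 / C\<^sup>2) * \<sigma>\<^sup>2 * y" using that by simp
      then show "(1 - (1 / C\<^sup>2) * \<sigma>\<^sup>2) * y \<le> y" by (simp add: algebra_simps)
    qed
    show ?thesis
    proof (cases "dens N S' \<le> dens N S")
      case True
      then obtain \<sigma> where s: "0 \<le> \<sigma>" "\<sigma> \<le> 1" and
        le: "2 * U ((dens N S + dens N S') / 2) \<le>
          (1 - (1 / C\<^sup>2) * \<sigma>\<^sup>2) * U (dens N S) + U (dens N S') + \<sigma> * (dens N S - dens N S')"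
        using U b unfolding two_point_def by meson
      have "(1 - (1 / C\<^sup>2) * \<sigma>\<^sup>2) * U (dens N S) \<le> (1 - (1 / C\<^sup>2) * \<sigma>\<^sup>2) * (f0 + V0)"
        using IH0 scale(1)[OF s order_refl] by (rule mult_left_mono)
      moreover have "(1 - (1 / C\<^sup>2) * \<sigma>\<^sup>2) * f0 \<le> f0" using scale(2)[OF s f_nn(1)] .
      moreover have "\<sigma> * (dens N S - dens N S') \<le> \<sigma> * avg N (\<lambda>x. of_bool (x \<in> S \<and> x \<notin> S'))"
        using s d0 by (intro mult_left_mono) auto
      \<comment> \<open>The lighter half needs no gain in direction \<open>i\<close>: slope 0 leaves
        its cost unscaled.\<close>
      moreover have "V1 \<le> avg N (\<lambda>x. cost C S W (insert i Q) (insert i x))"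
        using ge1[of 0] by simp
      ultimately show ?thesis using le ge0[OF s] IH1 by (simp add: distrib_left)
    next
      case False
      then obtain \<sigma> where s: "0 \<le> \<sigma>" "\<sigma> \<le> 1" and
        le: "2 * U ((dens N S' + dens N S) / 2) \<le>
          (1 - (1 / C\<^sup>2) * \<sigma>\<^sup>2) * U (dens N S') + U (dens N S) + \<sigma> * (dens N S' - dens N S)"
        using U b unfolding two_point_def by (meson less_eq_real_def not_less)
      have "(1 - (1 / C\<^sup>2) * \<sigma>\<^sup>2) * U (dens N S') \<le> (1 - (1 / C\<^sup>2) * \<sigma>\<^sup>2) * (f1 + V1)"
        using IH1 scale(1)[OF s order_refl] by (rule mult_left_mono)
      moreover have "(1 - (1 / C\<^sup>2) * \<sigma>\<^sup>2) * f1 \<le> f1" using scale(2)[OF s f_nn(2)] .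
      moreover have "\<sigma> * (dens N S' - dens N S) \<le> \<sigma> * avg N (\<lambda>x. of_bool (x \<in> S' \<and> x \<notin> S))"
        using s d1 by (intro mult_left_mono) auto
      moreover have "V0 \<le> avg N (\<lambda>x. cost C S W (insert i Q) x)"
        using ge0[of 0] by simp
      ultimately show ?thesis using le ge1[OF s] IH0 by (simp add: distrib_left add.commute)
    qed
  qed
  define u where "u = U ((dens N S + dens N S') / 2)"
  define c0 where "c0 = avg N (\<lambda>x. cost C S W (insert i Q) x)"
  define c1 where "c1 = avg N (\<lambda>x. cost C S W (insert i Q) (insert i x))"
  have "U (dens (insert i N) S) = u"
    using N by (simp add: avg_insert S'_def u_def)
  moreover have "avg (insert i Q) (\<lambda>z. U (avg R (\<lambda>w. of_bool (z \<union> w \<in> S)))) = (f0 + f1) / 2"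
    using N by (simp add: avg_insert f0_def f1_def S'_def)
  moreover have "avg (insert i N) (cost C S W (insert i Q)) = (c0 + c1) / 2"
    using N by (simp add: avg_insert c0_def c1_def)
  moreover have "insert i Q \<union> R = insert i N" by (auto simp: N_def)
  moreover have "2 * u \<le> f0 + f1 + c0 + c1"
    using main by (simp only: u_def c0_def c1_def)
  ultimately show ?case by simp
qed

section \<open>The smoothed tent profile\<close>

lemma sqrt_second_difference:
  fixes x y \<kappa> :: real
  assumes "\<kappa> > 0"
  defines "r \<equiv> (\<lambda>x. sqrt (x\<^sup>2 + \<kappa>\<^sup>2))"
  shows "r x + r y - 2 * r ((x + y) / 2) \<le> \<bar>x - y\<bar>"
    and "r x + r y - 2 * r ((x + y) / 2) \<le> (x - y)\<^sup>2 / (4 * \<kappa>)"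
proof -
  have lip: "r u \<le> r v + \<bar>u - v\<bar>" for u v
  proof -
    have "r u = sqrt ((v + (u - v))\<^sup>2 + (\<kappa> + 0)\<^sup>2)" by (simp add: r_def)
    also have "\<dots> \<le> sqrt (v\<^sup>2 + \<kappa>\<^sup>2) + sqrt ((u - v)\<^sup>2 + 0\<^sup>2)"
      by (rule real_sqrt_sum_squares_triangle_ineq)
    finally show ?thesis by (simp add: r_def)
  qed
  have a1: "\<bar>x - (x + y) / 2\<bar> = \<bar>x - y\<bar> / 2" and a2: "\<bar>y - (x + y) / 2\<bar> = \<bar>x - y\<bar> / 2"
    by (simp_all add: abs_if field_simps)
  show "r x + r y - 2 * r ((x + y) / 2) \<le> \<bar>x - y\<bar>"
    using lip[of x "(x + y) / 2"] lip[of y "(x + y) / 2"] unfolding a1 a2 by simp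
  define p where "p = (x + y) / 2"
  define h where "h = (x - y) / 2"
  have rp: "\<kappa> \<le> r p" using assms by (simp add: r_def real_le_rsqrt)
  have rsq: "(r u)\<^sup>2 = u\<^sup>2 + \<kappa>\<^sup>2" for u by (simp add: r_def)
  \<comment> \<open>Curvature without derivatives: the square of the left side is at most
    \<open>4 * ((r p)\<^sup>2 + h\<^sup>2)\<close>, and the right side completes this to a
    square.\<close>
  have "r x + r y \<le> 2 * r p + h\<^sup>2 / r p"
  proof (rule power2_le_imp_le)
    have "(r x + r y)\<^sup>2 \<le> 2 * ((r x)\<^sup>2 + (r y)\<^sup>2)"
      using zero_le_power2[of "r x - r y"] by (simp add: power2_eq_square algebra_simps)
    also have "\<dots> = 4 * ((r p)\<^sup>2 + h\<^sup>2)"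
      unfolding rsq p_def h_def by (simp add: power2_eq_square field_simps)
    also have "\<dots> \<le> (2 * r p + h\<^sup>2 / r p)\<^sup>2"
    proof -
      have "(2 * r p + h\<^sup>2 / r p)\<^sup>2 = 4 * ((r p)\<^sup>2 + h\<^sup>2) + (h\<^sup>2 / r p)\<^sup>2"
        using rp assms(1) by (simp add: power2_eq_square field_simps)
      then show ?thesis by simp
    qed
    finally show "(r x + r y)\<^sup>2 \<le> (2 * r p + h\<^sup>2 / r p)\<^sup>2" .
    show "0 \<le> 2 * r p + h\<^sup>2 / r p" using rp assms(1) by auto
  qed
  moreover have "h\<^sup>2 / r p \<le> h\<^sup>2 / \<kappa>"
    using rp assms(1) by (intro divide_left_mono) auto
  ultimately show "r x + r y - 2 * r ((x + y) / 2) \<le> (x - y)\<^sup>2 / (4 * \<kappa>)"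
    by (simp add: p_def h_def power_divide)
qed

text \<open>The constant 2 keeps the profile between 0 and 2, so the loss is at most
  \<open>2 * \<eta> * \<sigma>\<^sup>2\<close>. For distant points slope 1 works, the slack from
  \<open>1 - l\<close> paying the loss. Otherwise the bound on \<eta> forces
  \<open>d \<le> \<kappa>\<close>, and the slope \<open>d / (2 * \<kappa>)\<close>, which maximises
  \<open>\<sigma> * d - \<kappa> * \<sigma>\<^sup>2\<close>, meets the quadratic bound.\<close>

lemma two_point_tent:
  fixes m \<kappa> l \<eta> :: real
  assumes "0 < \<kappa>" "\<kappa> \<le> 1" "0 < l" "l \<le> 1" "0 \<le> m" "m \<le> 1" "0 \<le> \<eta>" "\<eta> \<le> l * \<kappa> / 2"
  shows "two_point \<eta> (\<lambda>x. 2 - (1 - l) * sqrt ((x - m)\<^sup>2 + \<kappa>\<^sup>2))"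
proof -
  define r where "r = (\<lambda>x. sqrt (x\<^sup>2 + \<kappa>\<^sup>2))"
  have r0: "0 \<le> r x" for x by (simp add: r_def)
  have r2: "r (x - m) \<le> 2" if "0 \<le> x" "x \<le> 1" for x
  proof -
    have "\<bar>x - m\<bar> \<le> 1" using that assms by auto
    then have "(x - m)\<^sup>2 \<le> 1" by (simp add: abs_square_le_1)
    moreover have "\<kappa>\<^sup>2 \<le> 1" using assms by (simp add: power_le_one)
    ultimately have "(x - m)\<^sup>2 + \<kappa>\<^sup>2 \<le> 2\<^sup>2" by simp
    then show ?thesis unfolding r_def by (simp add: real_le_lsqrt)
  qed
  define U where "U = (\<lambda>x. 2 - (1 - l) * r (x - m))"
  have U0: "0 \<le> U x" "U x \<le> 2" if "0 \<le> x" "x \<le> 1" for x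
  proof -
    have "(1 - l) * r (x - m) \<le> 1 * 2"
      using r2[OF that] r0 assms by (intro mult_mono) auto
    then show "0 \<le> U x" by (simp add: U_def)
    show "U x \<le> 2" using r0 assms by (simp add: U_def)
  qed
  have "\<exists>\<sigma>. 0 \<le> \<sigma> \<and> \<sigma> \<le> 1 \<and> 2 * U ((a + b) / 2) \<le> (1 - \<eta> * \<sigma>\<^sup>2) * U a + U b + \<sigma> * (a - b)"
    if ab: "0 \<le> b" "b \<le> a" "a \<le> 1" for a b
  proof -
    define d where "d = a - b"
    define \<Delta> where "\<Delta> = r (a - m) + r (b - m) - 2 * r ((a + b) / 2 - m)"
    have d: "0 \<le> d" using ab by (simp add: d_def)
    have mid: "((a - m) + (b - m)) / 2 = (a + b) / 2 - m" by (simp add: field_simps)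
    have D1: "\<Delta> \<le> d" and D2: "\<Delta> \<le> d\<^sup>2 / (4 * \<kappa>)"
      using sqrt_second_difference[OF assms(1), of "a - m" "b - m"] ab
      unfolding mid by (auto simp: \<Delta>_def r_def d_def)
    have "d\<^sup>2 / (4 * \<kappa>) \<ge> 0" using assms by simp
    have eq: "2 * U ((a + b) / 2) = U a + U b + (1 - l) * \<Delta>"
      by (simp add: U_def \<Delta>_def algebra_simps)
    have suff: "2 * U ((a + b) / 2) \<le> (1 - \<eta> * \<sigma>\<^sup>2) * U a + U b + \<sigma> * (a - b)"
      if "(1 - l) * \<Delta> \<le> \<sigma> * d - 2 * (\<eta> * \<sigma>\<^sup>2)" for \<sigma>
    proof -
      have "\<eta> * \<sigma>\<^sup>2 * U a \<le> \<eta> * \<sigma>\<^sup>2 * 2"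
        using U0[of a] ab assms by (intro mult_left_mono) auto
      then show ?thesis using that unfolding eq d_def by (simp add: algebra_simps)
    qed
    show ?thesis
    proof (cases "2 * \<eta> \<le> l * d")
      case True
      have "(1 - l) * \<Delta> \<le> (1 - l) * d" using D1 assms by (intro mult_left_mono) auto
      then have "(1 - l) * \<Delta> \<le> 1 * d - 2 * (\<eta> * 1\<^sup>2)" using True by (simp add: algebra_simps)
      from suff[OF this] show ?thesis by (intro exI[of _ 1]) simp
    next
      case False
      have "l * d \<le> l * \<kappa>" using False assms by linarith
      then have dk: "d \<le> \<kappa>" using assms by simp
      define \<sigma> where "\<sigma> = d / (2 * \<kappa>)"
      have s: "0 \<le> \<sigma>" "\<sigma> \<le> 1" using dk d assms by (auto simp: \<sigma>_def field_simps)
      have "l * \<kappa> \<le> 1 * \<kappa>" using assms by (intro mult_right_mono) auto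
      then have e2: "\<eta> \<le> \<kappa> / 2" using assms(8) by linarith
      have "(1 - l) * \<Delta> \<le> (1 - l) * (d\<^sup>2 / (4 * \<kappa>))" using D2 assms by (intro mult_left_mono) auto
      also have "\<dots> \<le> 1 * (d\<^sup>2 / (4 * \<kappa>))" using assms by (intro mult_right_mono) auto
      also have "\<dots> = \<sigma> * d - 2 * (\<kappa> / 2 * \<sigma>\<^sup>2)"
        using assms by (simp add: \<sigma>_def power2_eq_square field_simps)
      also have "\<dots> \<le> \<sigma> * d - 2 * (\<eta> * \<sigma>\<^sup>2)"
        using mult_right_mono[OF e2, of "\<sigma>\<^sup>2"] by simp
      finally show ?thesis using suff s by blast
    qed
  qed
  then have "two_point \<eta> U" using U0 by (auto simp: two_point_def)
  then show ?thesis by (simp add: U_def r_def)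
qed

section \<open>The power profile; \<open>pgap\<close> is the two-point defect of
  \<open>x powr (1 + \<kappa>)\<close> at the points 1 and \<open>r\<close>\<close>

definition pgap :: "real \<Rightarrow> real \<Rightarrow> real" where
  "pgap \<kappa> r = 1 + r powr (1 + \<kappa>) - 2 * ((1 + r) / 2) powr (1 + \<kappa>)"

lemma pgap_deriv:
  assumes "0 < r" "0 < \<kappa>"
  shows "(pgap \<kappa> has_real_derivative (1 + \<kappa>) * (r powr \<kappa> - ((1 + r) / 2) powr \<kappa>)) (at r)"
  unfolding pgap_def using assms
  by (auto intro!: derivative_eq_intros simp: field_simps)

lemma pgap_continuous: "0 < \<kappa> \<Longrightarrow> continuous_on {0..} (pgap \<kappa>)"
  unfolding pgap_def by (intro continuous_intros continuous_on_powr') auto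

lemma pgap_0: "pgap \<kappa> 0 = 1 - 2 powr (- \<kappa>)"
proof -
  have "(1 / 2 :: real) powr (1 + \<kappa>) = 2 powr (- \<kappa>) / 2"
    by (simp add: powr_add powr_divide powr_minus_divide)
  then show ?thesis by (simp add: pgap_def)
qed

lemma pgap_1: "pgap \<kappa> 1 = 0"
  by (simp add: pgap_def)

text \<open>Up to the factor \<open>1 + \<kappa>\<close> this difference is the derivative of
  \<open>pgap\<close>, so its monotonicity is convexity of \<open>pgap\<close>.\<close>

lemma powr_gap_mono:
  fixes \<kappa> :: real
  assumes "0 < \<kappa>" "\<kappa> \<le> 1" "0 < r" "r \<le> s"  "s \<le> 1"
  shows "r powr \<kappa> - ((1 + r) / 2) powr \<kappa> \<le> s powr \<kappa> - ((1 + s) / 2) powr \<kappa>"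
proof (rule DERIV_nonneg_imp_nondecreasing[OF assms(4)])
  fix x assume x: "r \<le> x" "x \<le> s"
  have "((\<lambda>r. r powr \<kappa> - ((1 + r) / 2) powr \<kappa>) has_real_derivative
      \<kappa> * (x powr (\<kappa> - 1) - ((1 + x) / 2) powr (\<kappa> - 1) / 2)) (at x)"
    using assms x by (auto intro!: derivative_eq_intros simp: field_simps)
  moreover have "((1 + x) / 2) powr (\<kappa> - 1) \<le> x powr (\<kappa> - 1)"
    using assms x by (intro powr_mono2') auto
  then have "((1 + x) / 2) powr (\<kappa> - 1) / 2 \<le> x powr (\<kappa> - 1)"
    using powr_ge_zero[of "(1 + x) / 2" "\<kappa> - 1"] by linarith
  then have "0 \<le> \<kappa> * (x powr (\<kappa> - 1) - ((1 + x) / 2) powr (\<kappa> - 1) / 2)"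
    using assms by (intro mult_nonneg_nonneg) auto
  ultimately show "\<exists>y. ((\<lambda>r. r powr \<kappa> - ((1 + r) / 2) powr \<kappa>) has_real_derivative y) (at x) \<and> 0 \<le> y"
    by blast
qed

text \<open>A convex function lies below the chord between its values at 0 and 1. As the derivative
  is available only for positive arguments, a violating point is refuted by mean values on its two
  sides.\<close>

lemma pgap_le_chord:
  assumes "0 < \<kappa>" "\<kappa> \<le> 1" "0 \<le> r" "r \<le> 1"
  shows "pgap \<kappa> r \<le> (1 - 2 powr (- \<kappa>)) * (1 - r)"
proof (rule ccontr)
  assume neg: "\<not> ?thesis"
  define p where "p = 1 - 2 powr (- \<kappa>)"
  have p: "pgap \<kappa> 0 = p" by (simp add: p_def pgap_0)
  have r: "0 < r" "r < 1"
    using neg assms pgap_0[of \<kappa>] pgap_1[of \<kappa>] by (cases "r = 0"; cases "r = 1"; simp)+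
  define D where "D = (\<lambda>r. (1 + \<kappa>) * (r powr \<kappa> - ((1 + r) / 2) powr \<kappa>))"
  have cont: "continuous_on {a..b} (pgap \<kappa>)" if "0 \<le> a" for a b
    using pgap_continuous[OF assms(1)] by (rule continuous_on_subset) (use that in auto)
  have der: "(pgap \<kappa> has_real_derivative D x) (at x)" if "0 < x" for x
    using pgap_deriv[OF that assms(1)] by (simp add: D_def)
  obtain x where x: "0 < x" "x < r" "pgap \<kappa> r - pgap \<kappa> 0 = (r - 0) * D x"
  proof -
    obtain d x where x: "0 < x" "x < r" "(pgap \<kappa> has_real_derivative d) (at x)"
        "pgap \<kappa> r - pgap \<kappa> 0 = (r - 0) * d"
      using MVT[of 0 r "pgap \<kappa>"] cont[of 0 r] r der
      by (metis order_refl real_differentiable_def)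
    moreover have "d = D x" using DERIV_unique[OF x(3) der[OF x(1)]] .
    ultimately show ?thesis using that by blast
  qed
  obtain y where y: "r < y" "y < 1" "pgap \<kappa> 1 - pgap \<kappa> r = (1 - r) * D y"
    using MVT2[of r 1 "pgap \<kappa>" D] der r by auto
  have "D x \<le> D y"
    unfolding D_def using powr_gap_mono[of \<kappa> x y] assms x y r by (intro mult_left_mono) auto
  have "pgap \<kappa> r > p * (1 - r)" using neg by (simp add: p_def)
  then have "r * D x > r * (- p)" using x(3) p by (simp add: algebra_simps)
  then have "D x > - p" using r by (simp only: mult_less_cancel_left_pos)
  moreover have "(1 - r) * D y < (1 - r) * (- p)"
    using y(3) pgap_1[of \<kappa>] \<open>pgap \<kappa> r > p * (1 - r)\<close> by (simp add: mult.commute)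
  then have "D y < - p" using r by (simp only: mult_less_cancel_left_pos diff_gt_0_iff_gt)
  ultimately show False using \<open>D x \<le> D y\<close> by simp
qed

text \<open>Both \<open>pgap\<close> and its derivative vanish at 1, and the mean value theorem is
  applied twice. Staying above 1/2 keeps \<open>z powr (\<kappa> - 1)\<close> bounded.\<close>

lemma pgap_le_square:
  assumes "0 < \<kappa>" "\<kappa> \<le> 1" "1 / 2 \<le> r" "r \<le> 1"
  shows "pgap \<kappa> r \<le> 2 * (1 - r)\<^sup>2"
proof (cases "r = 1")
  case True
  then show ?thesis by (simp add: pgap_1)
next
  case False
  then have r: "1 / 2 \<le> r" "r < 1" using assms by auto
  define D where "D = (\<lambda>r. (1 + \<kappa>) * (r powr \<kappa> - ((1 + r) / 2) powr \<kappa>))"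
  obtain y where y: "r < y" "y < 1" "pgap \<kappa> 1 - pgap \<kappa> r = (1 - r) * D y"
    using MVT2[of r 1 "pgap \<kappa>" D] pgap_deriv[OF _ assms(1)] r by (auto simp: D_def)
  obtain z where z: "y < z" "z < (1 + y) / 2"
      "((1 + y) / 2) powr \<kappa> - y powr \<kappa> = ((1 + y) / 2 - y) * (\<kappa> * z powr (\<kappa> - 1))"
  proof -
    have "\<exists>z>y. z < (1 + y) / 2 \<and>
        ((1 + y) / 2) powr \<kappa> - y powr \<kappa> = ((1 + y) / 2 - y) * (\<kappa> * z powr (\<kappa> - 1))"
    proof (rule MVT2)
      show "y < (1 + y) / 2" using y by simp
    next
      fix x assume "y \<le> x"
      then show "((\<lambda>x. x powr \<kappa>) has_real_derivative \<kappa> * x powr (\<kappa> - 1)) (at x)"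
        using y r by (intro has_real_derivative_powr) auto
    qed
    then show ?thesis using that by blast
  qed
  have "z powr (\<kappa> - 1) \<le> (1 / 2) powr (\<kappa> - 1)"
    using assms z y r by (intro powr_mono2') auto
  also have "\<dots> \<le> (1 / 2) powr (- 1)"
    using assms by (intro powr_mono') auto
  also have "\<dots> = 2" by (simp add: powr_minus_divide)
  finally have "\<kappa> * z powr (\<kappa> - 1) \<le> 1 * 2" using assms by (intro mult_mono) auto
  then have "((1 + y) / 2 - y) * (\<kappa> * z powr (\<kappa> - 1)) \<le> ((1 + y) / 2 - y) * 2"
    using y by (intro mult_left_mono) auto
  then have g: "((1 + y) / 2) powr \<kappa> - y powr \<kappa> \<le> 1 - y"
    unfolding z(3)[symmetric] by (simp add: field_simps)
  have "- D y = (1 + \<kappa>) * (((1 + y) / 2) powr \<kappa> - y powr \<kappa>)" by (simp add: D_def algebra_simps)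
  also have "\<dots> \<le> (1 + \<kappa>) * (1 - y)" using g assms by (intro mult_left_mono) auto
  also have "\<dots> \<le> 2 * (1 - r)" using assms y by (intro mult_mono) auto
  finally have "(1 - r) * (- D y) \<le> (1 - r) * (2 * (1 - r))" using r by (intro mult_left_mono) auto
  then show ?thesis using y(3) pgap_1[of \<kappa>] by (simp add: power2_eq_square algebra_simps)
qed

text \<open>
  With \<open>K\<close> slightly below \<open>1 / (1 - 2 powr -\<kappa>)\<close> and \<open>\<kappa> \<longrightarrow> 0\<close> this profile approaches \<open>x log (1/x)\<close>,
  but unlike the latter it leaves room for the loss \<open>\<eta>\<close> in the two-point inequality.
\<close>

definition pent :: "real \<Rightarrow> real \<Rightarrow> real \<Rightarrow> real" where
  "pent K \<kappa> x = K * (x - x powr (1 + \<kappa>))"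

lemma pent_0 [simp]: "pent K \<kappa> 0 = 0" and pent_1 [simp]: "pent K \<kappa> 1 = 0"
  by (simp_all add: pent_def)

text \<open>By homogeneity the defect at \<open>a\<close>, \<open>b\<close> is
  \<open>a powr (1 + \<kappa>) * pgap \<kappa> r\<close> with \<open>r = b / a\<close>; bounding
  this power by \<open>a\<close>, and \<open>pent K \<kappa> a\<close> by \<open>K * a\<close>,
  leaves an inequality in \<open>r\<close> alone. If \<open>r\<close> is far from 1, the chord bound
  with slope 1 leaves the slack \<open>l\<close>; if it is close, the square bound applies.\<close>

lemma two_point_pent:
  fixes K \<kappa> l \<eta> :: real
  assumes \<kappa>: "0 < \<kappa>" "\<kappa> \<le> 1" and l: "0 < l" "l \<le> 1"
    and K: "0 < K" "K * (1 - 2 powr (- \<kappa>)) \<le> 1 - l"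
    and \<eta>: "0 \<le> \<eta>" "2 * \<eta> * K \<le> l" "8 * \<eta> * K\<^sup>2 \<le> l"
  shows "two_point \<eta> (pent K \<kappa>)"
proof -
  have powle: "x powr (1 + \<kappa>) \<le> x" if "0 \<le> x" "x \<le> 1" for x
    using powr_mono'[of 1 "1 + \<kappa>" x] that \<kappa> by (cases "x = 0") auto
  have nn: "0 \<le> pent K \<kappa> x" "pent K \<kappa> x \<le> K * x" if "0 \<le> x" "x \<le> 1" for x
    using powle[OF that] K powr_ge_zero[of x "1 + \<kappa>"] unfolding pent_def by auto
  have "\<exists>\<sigma>. 0 \<le> \<sigma> \<and> \<sigma> \<le> 1 \<and> 2 * pent K \<kappa> ((a + b) / 2)
      \<le> (1 - \<eta> * \<sigma>\<^sup>2) * pent K \<kappa> a + pent K \<kappa> b + \<sigma> * (a - b)"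
    if ab: "0 \<le> b" "b \<le> a" "a \<le> 1" for a b
  proof (cases "a = 0")
    case True
    then show ?thesis using ab by (intro exI[of _ 0]) auto
  next
    case False
    then have a: "0 < a" using ab by simp
    define r where "r = b / a"
    have r: "0 \<le> r" "r \<le> 1" "b = a * r" using ab a by (auto simp: r_def)
    have eq: "2 * pent K \<kappa> ((a + b) / 2) = pent K \<kappa> a + pent K \<kappa> b + K * (a powr (1 + \<kappa>) * pgap \<kappa> r)"
    proof -
      have "(a + b) / 2 = a * ((1 + r) / 2)" using r by (simp add: field_simps)
      then have "((a + b) / 2) powr (1 + \<kappa>) = a powr (1 + \<kappa>) * ((1 + r) / 2) powr (1 + \<kappa>)"
        using a r by (simp only: powr_mult)
      moreover have "b powr (1 + \<kappa>) = a powr (1 + \<kappa>) * r powr (1 + \<kappa>)"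
        using a r by (simp add: powr_mult)
      ultimately show ?thesis
        unfolding pent_def pgap_def by (simp add: algebra_simps)
    qed
    have suff: "2 * pent K \<kappa> ((a + b) / 2)
      \<le> (1 - \<eta> * \<sigma>\<^sup>2) * pent K \<kappa> a + pent K \<kappa> b + \<sigma> * (a - b)"
      if X: "pgap \<kappa> r \<le> X" "0 \<le> X" "K * X \<le> \<sigma> * (1 - r) - \<eta> * K * \<sigma>\<^sup>2" for \<sigma> X
    proof -
      have "a powr (1 + \<kappa>) * pgap \<kappa> r \<le> a powr (1 + \<kappa>) * X"
        using X by (intro mult_left_mono) auto
      also have "\<dots> \<le> a * X" using X powle[of a] ab a by (intro mult_right_mono) auto
      finally have "K * (a powr (1 + \<kappa>) * pgap \<kappa> r) \<le> a * (K * X)"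
        using K by simp
      also have "\<dots> \<le> a * (\<sigma> * (1 - r) - \<eta> * K * \<sigma>\<^sup>2)"
        using X a by (intro mult_left_mono) auto
      also have "\<dots> = \<sigma> * (a - b) - \<eta> * \<sigma>\<^sup>2 * (K * a)"
        using r by (simp add: algebra_simps)
      also have "\<dots> \<le> \<sigma> * (a - b) - \<eta> * \<sigma>\<^sup>2 * pent K \<kappa> a"
        using nn[of a] ab a \<eta> by (intro diff_left_mono mult_left_mono) auto
      finally show ?thesis unfolding eq by (simp add: algebra_simps)
    qed
    show ?thesis
    proof (cases "\<eta> * K \<le> l * (1 - r)")
      case True
      have p: "0 \<le> 1 - 2 powr (- \<kappa>)" using \<kappa> by (simp add: powr_minus_divide ge_one_powr_ge_zero)
      have "K * ((1 - 2 powr (- \<kappa>)) * (1 - r)) \<le> (1 - l) * (1 - r)"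
        using mult_right_mono[OF K(2), of "1 - r"] r by (simp add: mult.assoc)
      also have "\<dots> \<le> 1 * (1 - r) - \<eta> * K * 1\<^sup>2" using True by (simp add: algebra_simps)
      finally show ?thesis
        using suff[OF pgap_le_chord[OF \<kappa> r(1,2)], of 1] p r
        by (intro exI[of _ 1]) (auto intro: mult_nonneg_nonneg)
    next
      case False
      have "l * (1 - r) < l * (1 / 2)" using False \<eta>(2) by simp
      then have r2: "1 / 2 \<le> r" using l by simp
      \<comment> \<open>The gain is \<open>4 * K * (1 - r)\<^sup>2\<close>: one half covers the
        defect, the other half the loss.\<close>
      define \<sigma> where "\<sigma> = 4 * K * (1 - r)"
      have "l * \<sigma> = 4 * K * (l * (1 - r))" by (simp add: \<sigma>_def)
      also have "\<dots> \<le> 4 * K * (\<eta> * K)" using False K by (intro mult_left_mono) auto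
      also have "\<dots> \<le> l * 1" using \<eta> l by (simp add: power2_eq_square algebra_simps)
      finally have s: "0 \<le> \<sigma>" "\<sigma> \<le> 1" using l K r by (auto simp: \<sigma>_def)
      have e: "8 * \<eta> * K\<^sup>2 \<le> 1" using \<eta> l by linarith
      have "\<eta> * K * \<sigma>\<^sup>2 = (8 * \<eta> * K\<^sup>2) * (2 * K * (1 - r)\<^sup>2)"
        by (simp add: \<sigma>_def power2_eq_square)
      also have "\<dots> \<le> 1 * (2 * K * (1 - r)\<^sup>2)"
        using e K by (intro mult_right_mono) auto
      finally have "K * (2 * (1 - r)\<^sup>2) \<le> \<sigma> * (1 - r) - \<eta> * K * \<sigma>\<^sup>2"
        by (simp add: \<sigma>_def power2_eq_square)
      then show ?thesis using suff[OF pgap_le_square[OF \<kappa> r2 r(2)]] s by auto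
    qed
  qed
  then show ?thesis using nn by (auto simp: two_point_def)
qed

lemma exp_minus_le_quadratic:
  fixes t :: real
  assumes "0 \<le> t"
  shows "exp (- t) \<le> 1 - t + t\<^sup>2 / 2"
proof -
  have p: "0 < 1 + t + t\<^sup>2 / 2" using assms by (simp add: add_pos_nonneg)
  have "exp (- t) \<le> 1 / (1 + t + t\<^sup>2 / 2)"
    using exp_lower_Taylor_quadratic[OF assms] p by (simp add: exp_minus divide_simps)
  also have "\<dots> \<le> 1 - t + t\<^sup>2 / 2"
  proof -
    have "(1 - t + t\<^sup>2 / 2) * (1 + t + t\<^sup>2 / 2) = 1 + (t\<^sup>2)\<^sup>2 / 4"
      by (simp add: power2_eq_square field_simps)
    then have "1 \<le> (1 - t + t\<^sup>2 / 2) * (1 + t + t\<^sup>2 / 2)" by simp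
    then show ?thesis using p by (simp add: divide_simps)
  qed
  finally show ?thesis .
qed

lemma one_minus_two_powr:
  fixes \<kappa> :: real
  assumes "0 < \<kappa>"
  shows "0 < 1 - 2 powr (- \<kappa>)" "1 - 2 powr (- \<kappa>) \<le> \<kappa> * ln 2"
proof -
  have e: "2 powr (- \<kappa>) = exp (- (\<kappa> * ln 2))" by (simp add: powr_def)
  show "0 < 1 - 2 powr (- \<kappa>)" unfolding e using assms by simp
  show "1 - 2 powr (- \<kappa>) \<le> \<kappa> * ln 2"
    using exp_ge_add_one_self[of "- (\<kappa> * ln 2)"] unfolding e by simp
qed

text \<open>With \<open>x = exp (- y)\<close> the profile is
  \<open>K * x * (1 - exp (- (\<kappa> * y)))\<close>, which to first order in \<kappa> is
  \<open>K * \<kappa> * x * y\<close>. The errors stay bounded because \<open>x * y \<le> 1\<close>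
  and \<open>x * y\<^sup>2 \<le> 2\<close>.\<close>

lemma entropy_le_pent:
  fixes \<kappa> l x :: real
  assumes \<kappa>: "0 < \<kappa>" and l: "0 \<le> l" "l \<le> 1" and x: "0 \<le> x" "x \<le> 1"
  shows "- (x * log 2 x) \<le> pent ((1 - l) / (1 - 2 powr (- \<kappa>))) \<kappa> x + 2 * (l + \<kappa>)"
proof (cases "x = 0")
  case True
  then show ?thesis using assms by simp
next
  case False
  then have x0: "0 < x" using x by simp
  define y where "y = - ln x"
  have y: "0 \<le> y" "x = exp (- y)" using x0 x by (auto simp: y_def)
  have xp: "x powr (1 + \<kappa>) = x * exp (- (\<kappa> * y))"
  proof -
    have "x powr (1 + \<kappa>) = x powr 1 * x powr \<kappa>" by (rule powr_add)
    then show ?thesis using x0 by (simp add: powr_def[of x \<kappa>] y_def)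
  qed
  have ln2: "1 / 2 \<le> ln (2::real)" using ln2_ge_two_thirds by simp
  have ey: "1 + y + y\<^sup>2 / 2 \<le> exp y" using exp_lower_Taylor_quadratic[OF y(1)] .
  have xy: "x * y \<le> 1" "x * y\<^sup>2 \<le> 2"
  proof -
    have "y \<le> exp y" "y\<^sup>2 \<le> 2 * exp y" using ey y zero_le_power2[of y] by linarith+
    then show "x * y \<le> 1" "x * y\<^sup>2 \<le> 2" unfolding y(2) by (simp_all add: exp_minus divide_simps)
  qed
  have K: "(1 - l) / (\<kappa> * ln 2) \<le> (1 - l) / (1 - 2 powr (- \<kappa>))"
    using one_minus_two_powr[OF \<kappa>] l \<kappa> by (intro divide_left_mono) auto
  have "(1 - l) * (x * y - \<kappa> * (x * y\<^sup>2) / 2) / ln 2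
      = (1 - l) / (\<kappa> * ln 2) * (x * (\<kappa> * y - (\<kappa> * y)\<^sup>2 / 2))"
    using \<kappa> by (simp add: power2_eq_square field_simps)
  also have "\<dots> \<le> (1 - l) / (\<kappa> * ln 2) * (x * (1 - exp (- (\<kappa> * y))))"
    using exp_minus_le_quadratic[of "\<kappa> * y"] \<kappa> y l x0 by (intro mult_left_mono) auto
  also have "\<dots> \<le> (1 - l) / (1 - 2 powr (- \<kappa>)) * (x * (1 - exp (- (\<kappa> * y))))"
    using K x0 \<kappa> y by (intro mult_right_mono) auto
  also have "\<dots> = pent ((1 - l) / (1 - 2 powr (- \<kappa>))) \<kappa> x"
    by (simp add: pent_def xp algebra_simps)
  finally have lower: "(1 - l) * (x * y - \<kappa> * (x * y\<^sup>2) / 2) / ln 2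
      \<le> pent ((1 - l) / (1 - 2 powr (- \<kappa>))) \<kappa> x" .
  have "x * y - (l + \<kappa>) \<le> (1 - l) * (x * y - \<kappa> * (x * y\<^sup>2) / 2)"
  proof -
    have "l * (x * y) \<le> l * 1" using xy l by (intro mult_left_mono) auto
    moreover have "(1 - l) * (\<kappa> * (x * y\<^sup>2) / 2) \<le> 1 * (\<kappa> * 2 / 2)"
      using xy l \<kappa> x0 by (intro mult_mono divide_right_mono mult_left_mono) auto
    moreover have "(1 - l) * (x * y - \<kappa> * (x * y\<^sup>2) / 2)
        = x * y - l * (x * y) - (1 - l) * (\<kappa> * (x * y\<^sup>2) / 2)"
      by (simp add: algebra_simps)
    ultimately show ?thesis by linarith
  qed
  then have "(x * y - (l + \<kappa>)) / ln 2 \<le> (1 - l) * (x * y - \<kappa> * (x * y\<^sup>2) / 2) / ln 2"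
    using ln2 by (intro divide_right_mono) auto
  moreover have "(l + \<kappa>) / ln 2 \<le> 2 * (l + \<kappa>)"
    using ln2 l \<kappa> mult_left_mono[OF ln2, of "l + \<kappa>"] by (simp add: divide_simps algebra_simps)
  moreover have "- (x * log 2 x) = x * y / ln 2" by (simp add: log_def y_def)
  ultimately show ?thesis using lower by (simp add: diff_divide_distrib)
qed

section \<open>Entropy, variance and level-one Fourier weight\<close>

text \<open>This is the difference of the two sides of \<open>square_ge_entropy\<close> divided by
  \<open>v\<close>, for \<open>v\<close> at least 1. The choice of \<alpha> gives
  \<open>\<alpha> / ln 2 = \<alpha> + 1\<close>, so the derivative factors as
  \<open>(v - 2) * (v - (\<alpha> - 1)) / v\<^sup>2\<close>. Since \<alpha> - 1 lies between 1 and
  2, the function rises from its zero at 1, falls to its zero at 2 and rises again.\<close>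

lemma convex_tangent_ge:
  fixes v :: real
  defines "\<alpha> \<equiv> ln 2 / (1 - ln (2::real))"
  assumes "1 \<le> v"
  shows "0 \<le> v + (2 * \<alpha> - 3) - (2 * \<alpha> - 2) / v - \<alpha> * log 2 v"
proof -
  define H where "H = (\<lambda>v::real. v + (2 * \<alpha> - 3) - (2 * \<alpha> - 2) / v - \<alpha> * log 2 v)"
  have l1: "2 / 3 \<le> ln (2::real)" by (rule ln2_ge_two_thirds)
  have l2: "ln (2::real) \<le> 25 / 36" by (rule ln2_le_25_over_36)
  have al: "\<alpha> / ln 2 = \<alpha> + 1" using l1 l2 by (simp add: \<alpha>_def field_simps)
  have a2: "2 \<le> \<alpha>" "\<alpha> \<le> 3" using l1 l2 by (simp_all add: \<alpha>_def field_simps)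
  have der: "(H has_real_derivative (v - 2) * (v - (\<alpha> - 1)) / v\<^sup>2) (at v)" if "0 < v" for v
  proof -
    have "(H has_real_derivative 1 + (2 * \<alpha> - 2) / v\<^sup>2 - \<alpha> / ln 2 / v) (at v)"
      unfolding H_def using that
      by (auto intro!: derivative_eq_intros simp: power2_eq_square field_simps)
    moreover have "1 + (2 * \<alpha> - 2) / v\<^sup>2 - \<alpha> / ln 2 / v = (v - 2) * (v - (\<alpha> - 1)) / v\<^sup>2"
      unfolding al using that by (simp add: power2_eq_square field_simps)
    ultimately show ?thesis by simp
  qed
  have H1: "H 1 = 0" and H2: "H 2 = 0" by (simp_all add: H_def field_simps)
  consider "v \<le> \<alpha> - 1" | "\<alpha> - 1 \<le> v" "v \<le> 2" | "2 \<le> v" by linarith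
  then have "0 \<le> H v"
  proof cases
    case 1
    have "H 1 \<le> H v"
    proof (rule DERIV_nonneg_imp_nondecreasing[OF assms(2)])
      fix x assume x: "1 \<le> x" "x \<le> v"
      have "0 \<le> (x - 2) * (x - (\<alpha> - 1))" using x 1 a2 by (intro mult_nonpos_nonpos) auto
      then show "\<exists>y. (H has_real_derivative y) (at x) \<and> 0 \<le> y"
        using der[of x] x by (intro exI[of _ "(x - 2) * (x - (\<alpha> - 1)) / x\<^sup>2"]) auto
    qed
    then show ?thesis using H1 by simp
  next
    case 2
    have "H 2 \<le> H v"
    proof (rule DERIV_nonpos_imp_nonincreasing[OF 2(2)])
      fix x assume x: "v \<le> x" "x \<le> 2"
      have "(x - 2) * (x - (\<alpha> - 1)) \<le> 0" using x 2 a2 by (intro mult_nonpos_nonneg) auto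
      then show "\<exists>y. (H has_real_derivative y) (at x) \<and> y \<le> 0"
        using der[of x] x assms(2)
        by (intro exI[of _ "(x - 2) * (x - (\<alpha> - 1)) / x\<^sup>2"]) (auto intro: divide_nonpos_nonneg)
    qed
    then show ?thesis using H2 by simp
  next
    case 3
    have "H 2 \<le> H v"
    proof (rule DERIV_nonneg_imp_nondecreasing[OF 3])
      fix x assume x: "2 \<le> x" "x \<le> v"
      have "0 \<le> (x - 2) * (x - (\<alpha> - 1))" using x a2 by (intro mult_nonneg_nonneg) auto
      then show "\<exists>y. (H has_real_derivative y) (at x) \<and> 0 \<le> y"
        using der[of x] x by (intro exI[of _ "(x - 2) * (x - (\<alpha> - 1)) / x\<^sup>2"]) auto
    qed
    then show ?thesis using H2 by simp
  qed
  then show ?thesis by (simp add: H_def)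
qed

text \<open>
  Equality holds at \<open>v = 0, 1, 2\<close>, the relative densities of the sections of a subcube over one
  coordinate; \<open>\<alpha>\<close> is determined by tangency at \<open>v = 2\<close>.
\<close>

lemma square_ge_entropy:
  fixes v :: real
  defines "\<alpha> \<equiv> ln 2 / (1 - ln (2::real))"
  assumes "0 \<le> v"
  shows "\<alpha> * (v * log 2 v - (v - 1)) - (\<alpha> - 1) * \<bar>v - 1\<bar> \<le> (v - 1)\<^sup>2"
proof (cases "1 \<le> v")
  case True
  have "0 \<le> v * (v + (2 * \<alpha> - 3) - (2 * \<alpha> - 2) / v - \<alpha> * log 2 v)"
    using convex_tangent_ge[OF True] True by (intro mult_nonneg_nonneg) (auto simp: \<alpha>_def)
  also have "\<dots> = (v - 1)\<^sup>2 - (\<alpha> * (v * log 2 v - (v - 1)) - (\<alpha> - 1) * (v - 1))"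
    using True by (simp add: power2_eq_square field_simps)
  finally show ?thesis using True by simp
next
  case False
  have l1: "2 / 3 \<le> ln (2::real)" by (rule ln2_ge_two_thirds)
  have l2: "ln (2::real) \<le> 25 / 36" by (rule ln2_le_25_over_36)
  have a: "1 \<le> \<alpha>" using l1 l2 by (simp add: \<alpha>_def field_simps)
  \<comment> \<open>Below 1 the claim is equivalent to
    \<open>\<alpha> * (v * log 2 v) \<le> v * (v - 1)\<close>, where the right side is not positive
    and \<alpha> is at least 1.\<close>
  have "v * log 2 v \<le> v * (v - 1)"
  proof (cases "v = 0")
    case F: False
    then have "ln v \<le> v - 1" using assms(2) by (intro ln_le_minus_one) auto
    moreover have "v - 1 \<ge> (v - 1) / ln 2" using mult_nonpos_nonneg[of "v - 1" "1 - ln 2"] False l1 l2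
      by (simp add: field_simps)
    ultimately have "log 2 v \<le> v - 1"
      unfolding log_def using l1 by (intro order_trans[OF divide_right_mono[of "ln v" "v - 1" "ln 2"]]) auto
    then show ?thesis using assms(2) by (intro mult_left_mono) auto
  qed simp
  then have "\<alpha> * (v * log 2 v) \<le> \<alpha> * (v * (v - 1))" using a
    by (rule mult_left_mono[OF _ order_trans[OF zero_le_one]])
  moreover have "\<alpha> * (v * (v - 1)) \<le> 1 * (v * (v - 1))"
    using a assms(2) False by (intro mult_right_mono_neg mult_nonneg_nonpos) auto
  moreover have "(v - 1)\<^sup>2 - (\<alpha> * (v * log 2 v - (v - 1)) - (\<alpha> - 1) * (1 - v))
     = v * (v - 1) - \<alpha> * (v * log 2 v)"
    by (simp add: power2_eq_square algebra_simps)
  ultimately show ?thesis using False by simp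
qed

section \<open>Walsh-Fourier coefficients and random sections\<close>

definition fourier :: "nat set \<Rightarrow> (nat set \<Rightarrow> real) \<Rightarrow> nat set \<Rightarrow> real" where
  "fourier N F T = avg N (\<lambda>x. (- 1) ^ card (T \<inter> x) * F x)"

lemma fourier_empty [simp]: "fourier N F {} = avg N F"
  by (simp add: fourier_def)

lemma sum_Pow_insert:
  fixes G :: "'a set \<Rightarrow> real"
  assumes "finite N" "i \<notin> N"
  shows "(\<Sum>T\<in>Pow (insert i N). G T) = (\<Sum>T\<in>Pow N. G T + G (insert i T))"
proof -
  have "inj_on (insert i) (Pow N)" using assms by (auto simp: inj_on_def)
  moreover have "Pow N \<inter> insert i ` Pow N = {}" using assms by auto
  ultimately show ?thesis
    using assms by (simp add: Pow_insert sum.union_disjoint sum.reindex sum.distrib)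
qed

text \<open>The coefficients at \<open>T\<close> and \<open>insert i T\<close> are half the sum and
  half the difference of those of the two halves of \<open>F\<close>, so the induction step is the
  parallelogram law.\<close>

lemma parseval:
  assumes "finite N"
  shows "avg N (\<lambda>x. (F x)\<^sup>2) = (\<Sum>T\<in>Pow N. (fourier N F T)\<^sup>2)"
  using assms
proof (induction N arbitrary: F rule: finite_induct)
  case empty
  then show ?case by (simp add: fourier_def)
next
  case (insert i N)
  let ?G = "\<lambda>x. F (insert i x)"
  have f0: "fourier (insert i N) F T = (fourier N F T + fourier N ?G T) / 2" if "T \<in> Pow N" for T
  proof -
    have "T \<inter> insert i x = T \<inter> x" for x using that insert by auto
    then show ?thesis using insert by (simp add: fourier_def avg_insert)
  qed
  have f1: "fourier (insert i N) F (insert i T) = (fourier N F T - fourier N ?G T) / 2"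
    if T: "T \<in> Pow N" for T
  proof -
    have "avg N (\<lambda>x. (- 1) ^ card (insert i T \<inter> x) * F x) = fourier N F T"
      unfolding fourier_def
    proof (rule avg_cong)
      fix x assume "x \<subseteq> N"
      then have "insert i T \<inter> x = T \<inter> x" using insert by auto
      then show "(- 1) ^ card (insert i T \<inter> x) * F x = (- 1) ^ card (T \<inter> x) * F x" by simp
    qed
    moreover have "avg N (\<lambda>x. (- 1) ^ card (insert i T \<inter> insert i x) * ?G x)
      = avg N (\<lambda>x. (- 1) * ((- 1) ^ card (T \<inter> x) * ?G x))"
    proof (rule avg_cong)
      fix x assume "x \<subseteq> N"
      then have "insert i T \<inter> insert i x = insert i (T \<inter> x)" "i \<notin> T \<inter> x" "finite (T \<inter> x)"
        using insert T finite_subset[of x N] by auto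
      then show "(- 1) ^ card (insert i T \<inter> insert i x) * ?G x = (- 1) * ((- 1) ^ card (T \<inter> x) * ?G x)"
        by simp
    qed
    moreover have "\<dots> = - fourier N ?G T" unfolding avg_cmult fourier_def by simp
    ultimately show ?thesis
      using insert by (simp add: fourier_def[of "insert i N"] avg_insert)
  qed
  have "avg (insert i N) (\<lambda>x. (F x)\<^sup>2) =
      (\<Sum>T\<in>Pow N. ((fourier N F T)\<^sup>2 + (fourier N ?G T)\<^sup>2) / 2)"
    using insert by (simp add: avg_insert insert.IH sum.distrib sum_divide_distrib add_divide_distrib)
  also have "\<dots> = (\<Sum>T\<in>Pow N. (fourier (insert i N) F T)\<^sup>2 + (fourier (insert i N) F (insert i T))\<^sup>2)"
    by (intro sum.cong refl) (simp add: f0 f1 power2_eq_square field_simps)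
  also have "\<dots> = (\<Sum>T\<in>Pow (insert i N). (fourier (insert i N) F T)\<^sup>2)"
    using insert by (simp add: sum_Pow_insert)
  finally show ?case .
qed

text \<open>The character of a set \<open>T\<close> inside \<open>Q\<close> does not see the
  coordinates in \<open>R\<close>.\<close>

lemma fourier_section:
  assumes "finite Q" "finite R" "Q \<inter> R = {}" "T \<subseteq> Q"
  shows "fourier Q (\<lambda>z. avg R (\<lambda>w. F (z \<union> w))) T = fourier (Q \<union> R) F T"
proof -
  have "fourier (Q \<union> R) F T = avg Q (\<lambda>z. avg R (\<lambda>w. (- 1) ^ card (T \<inter> (z \<union> w)) * F (z \<union> w)))"
    unfolding fourier_def by (rule avg_Un) (use assms in auto)
  also have "\<dots> = avg Q (\<lambda>z. avg R (\<lambda>w. (- 1) ^ card (T \<inter> z) * F (z \<union> w)))"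
  proof (intro avg_cong)
    fix z w assume "w \<subseteq> R"
    then have "T \<inter> (z \<union> w) = T \<inter> z" using assms by auto
    then show "(- 1) ^ card (T \<inter> (z \<union> w)) * F (z \<union> w) = (- 1) ^ card (T \<inter> z) * F (z \<union> w)" by simp
  qed
  finally show ?thesis by (simp add: fourier_def avg_cmult)
qed

text \<open>Expectation over a random \<open>Q \<subseteq> N\<close> that contains each coordinate independently with probability \<open>p\<close>.\<close>

definition ravg :: "real \<Rightarrow> nat set \<Rightarrow> (nat set \<Rightarrow> real) \<Rightarrow> real" where
  "ravg p N G = (\<Sum>Q\<in>Pow N. p ^ card Q * (1 - p) ^ card (N - Q) * G Q)"

lemma ravg_insert:
  assumes "finite N" "i \<notin> N"
  shows "ravg p (insert i N) G = (1 - p) * ravg p N G + p * ravg p N (\<lambda>Q. G (insert i Q))"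
proof -
  have "ravg p (insert i N) G = (\<Sum>Q\<in>Pow N. p ^ card Q * (1 - p) ^ card (insert i N - Q) * G Q
      + p ^ card (insert i Q) * (1 - p) ^ card (insert i N - insert i Q) * G (insert i Q))"
    unfolding ravg_def using assms by (subst sum_Pow_insert) auto
  also have "\<dots> = (\<Sum>Q\<in>Pow N. (1 - p) * (p ^ card Q * (1 - p) ^ card (N - Q) * G Q)
      + p * (p ^ card Q * (1 - p) ^ card (N - Q) * G (insert i Q)))"
  proof (rule sum.cong)
    fix Q assume Q: "Q \<in> Pow N"
    then have "insert i N - Q = insert i (N - Q)" "insert i N - insert i Q = N - Q" "i \<notin> Q" "finite Q"
      using assms finite_subset by auto
    then show "p ^ card Q * (1 - p) ^ card (insert i N - Q) * G Q
      + p ^ card (insert i Q) * (1 - p) ^ card (insert i N - insert i Q) * G (insert i Q)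
      = (1 - p) * (p ^ card Q * (1 - p) ^ card (N - Q) * G Q)
      + p * (p ^ card Q * (1 - p) ^ card (N - Q) * G (insert i Q))"
      using assms by simp
  qed simp
  finally show ?thesis by (simp add: ravg_def sum.distrib sum_distrib_left)
qed

lemma ravg_superset:
  assumes "finite N" "T \<subseteq> N"
  shows "ravg p N (\<lambda>Q. of_bool (T \<subseteq> Q)) = p ^ card T"
  using assms
proof (induction N arbitrary: T rule: finite_induct)
  case empty
  then show ?case by (simp add: ravg_def)
next
  case (insert i N)
  show ?case
  proof (cases "i \<in> T")
    case True
    have "ravg p N (\<lambda>Q. of_bool (T \<subseteq> Q)) = 0"
      unfolding ravg_def using True insert by (intro sum.neutral) auto
    moreover have "T \<subseteq> insert i Q \<longleftrightarrow> T - {i} \<subseteq> Q" for Q by auto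
    moreover have "card T = Suc (card (T - {i}))"
      using True insert by (meson card.remove finite.insertI finite_subset)
    ultimately show ?thesis
      using insert.IH[of "T - {i}"] insert by (simp add: ravg_insert subset_insert_iff)
  next
    case False
    then have "T \<subseteq> insert i Q \<longleftrightarrow> T \<subseteq> Q" for Q by auto
    then show ?thesis
      using insert False by (simp add: ravg_insert subset_insert algebra_simps)
  qed
qed

lemma ravg_const [simp]: "finite N \<Longrightarrow> ravg p N (\<lambda>Q. c) = c"
  using ravg_superset[of N "{}" p] by (simp add: ravg_def flip: sum_distrib_right)

lemma ravg_add: "ravg p N (\<lambda>Q. F Q + G Q) = ravg p N F + ravg p N G"
  by (simp add: ravg_def sum.distrib distrib_left)

lemma ravg_cmult: "ravg p N (\<lambda>Q. c * F Q) = c * ravg p N F"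
  by (simp add: ravg_def sum_distrib_left algebra_simps)

lemma ravg_sum: "ravg p N (\<lambda>Q. \<Sum>i\<in>I. F i Q) = (\<Sum>i\<in>I. ravg p N (F i))"
  unfolding ravg_def by (subst sum.swap) (simp add: sum_distrib_left)

lemma ravg_mono:
  assumes "0 \<le> p" "p \<le> 1" "\<And>Q. Q \<subseteq> N \<Longrightarrow> F Q \<le> G Q"
  shows "ravg p N F \<le> ravg p N G"
  unfolding ravg_def using assms by (intro sum_mono mult_left_mono) auto

text \<open>Parseval over \<open>Q\<close>, where only the coefficients inside \<open>Q\<close>
  survive; subtracting the mean removes the one of the empty set.\<close>

lemma section_variance:
  assumes "finite N" "Q \<subseteq> N"
  shows "avg Q (\<lambda>z. (avg (N - Q) (\<lambda>w. F (z \<union> w)) - avg N F)\<^sup>2)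
    = (\<Sum>T\<in>Pow N - {{}}. (fourier N F T)\<^sup>2 * of_bool (T \<subseteq> Q))"
proof -
  have fin: "finite Q" "finite (N - Q)" using assms finite_subset by auto
  have un: "Q \<union> (N - Q) = N" using assms by auto
  define M where "M = (\<lambda>z. avg (N - Q) (\<lambda>w. F (z \<union> w)))"
  define m where "m = avg N F"
  have avM: "avg Q M = m"
    using avg_Un[OF fin, of F] un by (simp add: M_def m_def)
  have "avg Q (\<lambda>z. (M z - m)\<^sup>2) = avg Q (\<lambda>z. (M z)\<^sup>2 - 2 * m * M z + m\<^sup>2)"
    by (simp add: power2_eq_square algebra_simps)
  also have "\<dots> = avg Q (\<lambda>z. (M z)\<^sup>2) - m\<^sup>2"
    unfolding avg_add avg_diff avg_cmult avM using fin by (simp add: power2_eq_square)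
  also have "avg Q (\<lambda>z. (M z)\<^sup>2) = (\<Sum>T\<in>Pow Q. (fourier N F T)\<^sup>2)"
    using fourier_section[OF fin, of _ F] un fin by (simp add: parseval M_def)
  also have "\<dots> = (\<Sum>T\<in>Pow N. (fourier N F T)\<^sup>2 * of_bool (T \<subseteq> Q))"
    using assms by (intro sum.mono_neutral_cong_left) auto
  also have "\<dots> = (fourier N F {})\<^sup>2 * of_bool ({} \<subseteq> Q)
      + (\<Sum>T\<in>Pow N - {{}}. (fourier N F T)\<^sup>2 * of_bool (T \<subseteq> Q))"
    using assms(1) by (intro sum.remove) auto
  finally show ?thesis by (simp add: M_def m_def)
qed

text \<open>The coefficient at \<open>T\<close> survives with probability \<open>p ^ card T\<close>:
  this is p on level one and at most \<open>p\<^sup>2\<close> above, where the total weight is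
  bounded by Parseval.\<close>

lemma random_section_variance:
  assumes "finite N" "0 \<le> p" "p \<le> 1"
  shows "ravg p N (\<lambda>Q. avg Q (\<lambda>z. (avg (N - Q) (\<lambda>w. F (z \<union> w)) - avg N F)\<^sup>2))
    \<le> p * (\<Sum>i\<in>N. (fourier N F {i})\<^sup>2) + p\<^sup>2 * avg N (\<lambda>x. (F x)\<^sup>2)"
proof -
  define c where "c = (\<lambda>T. (fourier N F T)\<^sup>2)"
  have "ravg p N (\<lambda>Q. avg Q (\<lambda>z. (avg (N - Q) (\<lambda>w. F (z \<union> w)) - avg N F)\<^sup>2))
    = ravg p N (\<lambda>Q. \<Sum>T\<in>Pow N - {{}}. c T * of_bool (T \<subseteq> Q))"
    unfolding ravg_def c_def using assms(1) by (intro sum.cong refl) (simp add: section_variance)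
  also have "\<dots> = (\<Sum>T\<in>Pow N - {{}}. c T * p ^ card T)"
    unfolding ravg_sum ravg_cmult using assms by (intro sum.cong refl) (simp add: ravg_superset)
  also have "\<dots> \<le> (\<Sum>T\<in>Pow N - {{}}. p * (c T * of_bool (card T = 1)) + p\<^sup>2 * c T)"
  proof (rule sum_mono)
    fix T assume T: "T \<in> Pow N - {{}}"
    then have "card T \<noteq> 0" using assms finite_subset[of T N] by auto
    then consider "card T = 1" | "2 \<le> card T" by linarith
    then show "c T * p ^ card T \<le> p * (c T * of_bool (card T = 1)) + p\<^sup>2 * c T"
    proof cases
      case 1
      then show ?thesis by (simp add: c_def)
    next
      case 2
      then have "p ^ card T \<le> p\<^sup>2" using assms by (intro power_decreasing) auto
      then have "c T * p ^ card T \<le> c T * p\<^sup>2" by (intro mult_left_mono) (auto simp: c_def)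
      then show ?thesis using 2 by (simp add: mult.commute)
    qed
  qed
  also have "\<dots> = p * (\<Sum>T\<in>Pow N - {{}}. c T * of_bool (card T = 1)) + p\<^sup>2 * (\<Sum>T\<in>Pow N - {{}}. c T)"
    by (simp add: sum.distrib sum_distrib_left)
  also have "(\<Sum>T\<in>Pow N - {{}}. c T * of_bool (card T = 1)) = (\<Sum>T\<in>(\<lambda>i. {i}) ` N. c T)"
    using assms(1) by (intro sum.mono_neutral_cong_right) (auto simp: card_1_singleton_iff)
  also have "\<dots> = (\<Sum>i\<in>N. c {i})" by (subst sum.reindex) auto
  also have "(\<Sum>T\<in>Pow N - {{}}. c T) \<le> (\<Sum>T\<in>Pow N. c T)"
    using assms(1) by (intro sum_mono2) (auto simp: c_def)
  then have "p\<^sup>2 * (\<Sum>T\<in>Pow N - {{}}. c T) \<le> p\<^sup>2 * avg N (\<lambda>x. (F x)\<^sup>2)"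
    using assms(1) by (intro mult_left_mono) (auto simp: parseval c_def)
  finally show ?thesis by (simp add: c_def)
qed

text \<open>A one-sided influence: edges leaving \<open>S\<close> are counted only at endpoints
  outside \<open>W\<close>. For \<open>S = A \<union> W\<close> these are the edges from
  \<open>A\<close> to \<open>B\<close> in direction \<open>i\<close>.\<close>

definition infl :: "nat set \<Rightarrow> nat set set \<Rightarrow> nat set set \<Rightarrow> nat \<Rightarrow> real" where
  "infl N S W i = avg N (\<lambda>x. of_bool (x \<in> S \<and> x \<notin> W \<and> flip i x \<notin> S))"

lemma infl_nonneg: "0 \<le> infl N S W i"
  unfolding infl_def by (rule avg_nonneg) simp

lemma card_bdirs:
  assumes "finite Q"
  shows "real (card (bdirs S Q x)) = (\<Sum>i\<in>Q. of_bool (flip i x \<notin> S))"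
  using assms by (simp add: bdirs_def Int_def flip: sum.inter_filter)

lemma avg_cost_le:
  assumes "finite N" "Q \<subseteq> N" "0 \<le> C"
  shows "avg N (cost C S W Q) \<le> (\<Sum>i\<in>Q. infl N S W i) + C * (sqrt (card N) * dens N W)"
proof -
  have fQ: "finite Q" using assms finite_subset by auto
  have "avg N (cost C S W Q) \<le>
      avg N (\<lambda>x. (\<Sum>i\<in>Q. of_bool (x \<in> S \<and> x \<notin> W \<and> flip i x \<notin> S))
        + (C * sqrt (card N)) * of_bool (x \<in> W))"
  proof (rule avg_mono)
    fix x
    have "card (bdirs S Q x) \<le> card N" using assms by (intro card_mono) (auto simp: bdirs_def)
    then have "C * sqrt (card (bdirs S Q x)) \<le> C * sqrt (card N)"
      using assms by (intro mult_left_mono) auto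
    then show "cost C S W Q x \<le> (\<Sum>i\<in>Q. of_bool (x \<in> S \<and> x \<notin> W \<and> flip i x \<notin> S))
        + (C * sqrt (card N)) * of_bool (x \<in> W)"
      using fQ assms(3) by (auto simp: cost_def card_bdirs)
  qed
  then show ?thesis unfolding avg_add avg_cmult avg_sum infl_def by (simp add: mult.assoc)
qed

section \<open>Isoperimetric inequalities for a set and its sections\<close>

lemma cost_section:
  assumes "z \<subseteq> Q" "Q \<inter> R = {}"
  shows "cost C {w. z \<union> w \<in> S} {w. z \<union> w \<in> W} R w = cost C S W R (z \<union> w)"
proof -
  have "bdirs {w. z \<union> w \<in> S} R w = bdirs S R (z \<union> w)"
  proof -
    have "flip j (z \<union> w) = z \<union> flip j w" if "j \<in> R" for j
      using that assms by (intro flip_Un) auto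
    then show ?thesis by (auto simp: bdirs_def)
  qed
  then show ?thesis by (simp add: cost_def)
qed

text \<open>When all coordinates are split, the section densities are 0 or 1, where \<open>U\<close>
  vanishes.\<close>

lemma isoperimetric:
  assumes "two_point (1 / C\<^sup>2) U" "1 \<le> C" "U 0 = 0" "U 1 = 0" "finite N"
  shows "U (dens N S) \<le> avg N (cost C S W N)"
proof -
  have "avg N (\<lambda>z. U (of_bool (z \<in> S))) = 0"
    unfolding avg_def using assms(3,4) by (auto intro!: sum.neutral)
  then show ?thesis using two_point_induct[OF assms(1,2,5), of "{}" S W] by simp
qed

text \<open>The inequality is applied in each fibre over \<open>Q\<close>; boundary directions in
  \<open>N - Q\<close> stay within the fibre.\<close>

lemma isoperimetric_sections:
  assumes U: "two_point (1 / C\<^sup>2) U" "1 \<le> C" "U 0 = 0" "U 1 = 0" and N: "finite N" "Q \<subseteq> N"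
  shows "avg Q (\<lambda>z. U (avg (N - Q) (\<lambda>w. of_bool (z \<union> w \<in> S)))) \<le> avg N (cost C S W (N - Q))"
proof -
  have fin: "finite Q" "finite (N - Q)" "Q \<inter> (N - Q) = {}" using N finite_subset by auto
  have un: "Q \<union> (N - Q) = N" using N by auto
  have "avg Q (\<lambda>z. U (avg (N - Q) (\<lambda>w. of_bool (z \<union> w \<in> S))))
      \<le> avg Q (\<lambda>z. avg (N - Q) (\<lambda>w. cost C S W (N - Q) (z \<union> w)))"
  proof (rule avg_mono)
    fix z assume z: "z \<subseteq> Q"
    have "avg (N - Q) (cost C {w. z \<union> w \<in> S} {w. z \<union> w \<in> W} (N - Q))
        = avg (N - Q) (\<lambda>w. cost C S W (N - Q) (z \<union> w))"
      by (rule avg_cong) (rule cost_section[OF z fin(3)])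
    then show "U (avg (N - Q) (\<lambda>w. of_bool (z \<union> w \<in> S)))
        \<le> avg (N - Q) (\<lambda>w. cost C S W (N - Q) (z \<union> w))"
      using isoperimetric[OF U fin(2), of "{w. z \<union> w \<in> S}" "{w. z \<union> w \<in> W}"] by simp
  qed
  also have "\<dots> = avg N (cost C S W (N - Q))" using avg_Un[OF fin, of "cost C S W (N - Q)"] un by simp
  finally show ?thesis .
qed

lemma recip_square_le:
  fixes x :: real
  assumes "0 < x"
  shows "\<exists>C0\<ge>1. \<forall>C\<ge>C0. 1 / C\<^sup>2 \<le> x"
proof (intro exI[of _ "max 1 (1 / x)"] conjI allI impI)
  fix C assume C: "max 1 (1 / x) \<le> C"
  then have "1 / x \<le> C * 1" by simp
  also have "\<dots> \<le> C\<^sup>2" unfolding power2_eq_square using C by (intro mult_left_mono) auto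
  finally show "1 / C\<^sup>2 \<le> x" using assms C by (simp add: field_simps)
qed simp

lemma entropy_sections:
  fixes e :: real
  assumes "0 < e"
  shows "\<exists>C0\<ge>1. \<forall>C\<ge>C0. \<forall>N Q S W. finite N \<longrightarrow> Q \<subseteq> N \<longrightarrow>
    avg Q (\<lambda>z. - (avg (N - Q) (\<lambda>w. of_bool (z \<union> w \<in> S)) * log 2 (avg (N - Q) (\<lambda>w. of_bool (z \<union> w \<in> S)))))
    \<le> (\<Sum>i\<in>N - Q. infl N S W i) + e + C * (sqrt (card N) * dens N W)"
proof -
  \<comment> \<open>\<kappa> is also used as the slack \<open>l\<close>, so the error
    \<open>2 * (l + \<kappa>)\<close> of \<open>entropy_le_pent\<close> is at most
    \<open>e\<close>.\<close>
  define \<kappa> where "\<kappa> = min (1 / 2) (e / 4)"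
  have \<kappa>: "0 < \<kappa>" "\<kappa> \<le> 1 / 2" "4 * \<kappa> \<le> e" using assms by (auto simp: \<kappa>_def)
  define K where "K = (1 - \<kappa>) / (1 - 2 powr (- \<kappa>))"
  have K0: "0 < K" and K1: "K * (1 - 2 powr (- \<kappa>)) \<le> 1 - \<kappa>"
    using one_minus_two_powr[of \<kappa>] \<kappa> by (auto simp: K_def)
  obtain C0 where C0: "1 \<le> C0" "\<And>C. C0 \<le> C \<Longrightarrow> 1 / C\<^sup>2 \<le> min (\<kappa> / (2 * K)) (\<kappa> / (8 * K\<^sup>2))"
    using recip_square_le[of "min (\<kappa> / (2 * K)) (\<kappa> / (8 * K\<^sup>2))"] \<kappa> K0 by auto
  have "avg Q (\<lambda>z. - (avg (N - Q) (\<lambda>w. of_bool (z \<union> w \<in> S)) * log 2 (avg (N - Q) (\<lambda>w. of_bool (z \<union> w \<in> S)))))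
    \<le> (\<Sum>i\<in>N - Q. infl N S W i) + e + C * (sqrt (card N) * dens N W)"
    if C: "C0 \<le> C" and N: "finite N" "Q \<subseteq> N" for C N Q S W
  proof -
    have fin: "finite Q" "finite (N - Q)" using N finite_subset by auto
    have C1: "1 \<le> C" using C C0 by simp
    have "1 / C\<^sup>2 \<le> \<kappa> / (2 * K)" "1 / C\<^sup>2 \<le> \<kappa> / (8 * K\<^sup>2)" using C0(2)[OF C] by auto
    then have "2 * (1 / C\<^sup>2) * K \<le> \<kappa>" "8 * (1 / C\<^sup>2) * K\<^sup>2 \<le> \<kappa>"
      using K0 by (simp_all add: pos_le_divide_eq mult.commute mult.left_commute)
    then have U: "two_point (1 / C\<^sup>2) (pent K \<kappa>)"
      using two_point_pent[of \<kappa> \<kappa> K "1 / C\<^sup>2"] \<kappa> K0 K1 C1 by auto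
    define M where "M = (\<lambda>z. avg (N - Q) (\<lambda>w. of_bool (z \<union> w \<in> S)))"
    have M: "0 \<le> M z" "M z \<le> 1" for z
      using avg_mono[of "N - Q" "\<lambda>w. of_bool (z \<union> w \<in> S)" "\<lambda>_. 1"] fin
      by (auto simp: M_def intro: avg_nonneg)
    have "avg Q (\<lambda>z. - (M z * log 2 (M z))) \<le> avg Q (\<lambda>z. pent K \<kappa> (M z) + 2 * (\<kappa> + \<kappa>))"
      using entropy_le_pent[of \<kappa> \<kappa> "M _"] \<kappa> M by (intro avg_mono) (auto simp: K_def)
    also have "\<dots> \<le> avg Q (\<lambda>z. pent K \<kappa> (M z)) + e" unfolding avg_add using \<kappa> fin by simp
    also have "avg Q (\<lambda>z. pent K \<kappa> (M z)) \<le> avg N (cost C S W (N - Q))"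
      using isoperimetric_sections[OF U C1 _ _ N, of S W] by (simp add: M_def)
    also have "\<dots> \<le> (\<Sum>i\<in>N - Q. infl N S W i) + C * (sqrt (card N) * dens N W)"
      using avg_cost_le[OF N(1)] C1 by auto
    finally show ?thesis by (simp add: M_def)
  qed
  then show ?thesis using C0(1) by blast
qed

text \<open>The tent is centred at the density of \<open>S\<close> itself, so its peak is compared
  with its average over the sections; \<open>e\<close> is both the smoothing scale and the
  slack.\<close>

lemma deviation_sections:
  fixes e :: real
  assumes "0 < e" "e \<le> 1"
  shows "\<exists>C0\<ge>1. \<forall>C\<ge>C0. \<forall>N Q S W. finite N \<longrightarrow> Q \<subseteq> N \<longrightarrow>
    (1 - e) * avg Q (\<lambda>z. \<bar>avg (N - Q) (\<lambda>w. of_bool (z \<union> w \<in> S)) - dens N S\<bar>)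
    \<le> (\<Sum>i\<in>Q. infl N S W i) + e + C * (sqrt (card N) * dens N W)"
proof -
  obtain C0 where C0: "1 \<le> C0" "\<And>C. C0 \<le> C \<Longrightarrow> 1 / C\<^sup>2 \<le> e * e / 2"
    using recip_square_le[of "e * e / 2"] assms by auto
  have "(1 - e) * avg Q (\<lambda>z. \<bar>avg (N - Q) (\<lambda>w. of_bool (z \<union> w \<in> S)) - dens N S\<bar>)
    \<le> (\<Sum>i\<in>Q. infl N S W i) + e + C * (sqrt (card N) * dens N W)"
    if C: "C0 \<le> C" and N: "finite N" "Q \<subseteq> N" for C N Q S W
  proof -
    have fin: "finite Q" "finite (N - Q)" "Q \<inter> (N - Q) = {}" using N finite_subset by auto
    have un: "Q \<union> (N - Q) = N" using N by auto
    have C1: "1 \<le> C" using C C0 by simp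
    define m where "m = dens N S"
    have m: "0 \<le> m" "m \<le> 1" using N by (auto simp: m_def intro: density_le_1 density_nonneg)
    define M where "M = (\<lambda>z. avg (N - Q) (\<lambda>w. of_bool (z \<union> w \<in> S)))"
    have U: "two_point (1 / C\<^sup>2) (\<lambda>x. 2 - (1 - e) * sqrt ((x - m)\<^sup>2 + e\<^sup>2))"
      using C0(2)[OF C] assms m C1 by (intro two_point_tent) auto
    have "2 - (1 - e) * e \<le> avg Q (\<lambda>z. 2 - (1 - e) * sqrt ((M z - m)\<^sup>2 + e\<^sup>2)) + avg N (cost C S W Q)"
      using two_point_induct[OF U C1 fin, of S W] assms unfolding un m_def[symmetric] M_def by simp
    also have "avg Q (\<lambda>z. 2 - (1 - e) * sqrt ((M z - m)\<^sup>2 + e\<^sup>2))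
        = 2 - (1 - e) * avg Q (\<lambda>z. sqrt ((M z - m)\<^sup>2 + e\<^sup>2))"
      unfolding avg_diff avg_cmult using fin by simp
    finally have "(1 - e) * avg Q (\<lambda>z. sqrt ((M z - m)\<^sup>2 + e\<^sup>2)) \<le> (1 - e) * e + avg N (cost C S W Q)"
      by simp
    moreover have "(1 - e) * avg Q (\<lambda>z. \<bar>M z - m\<bar>) \<le> (1 - e) * avg Q (\<lambda>z. sqrt ((M z - m)\<^sup>2 + e\<^sup>2))"
      using assms by (intro mult_left_mono avg_mono real_le_rsqrt) auto
    moreover have "avg N (cost C S W Q) \<le> (\<Sum>i\<in>Q. infl N S W i) + C * (sqrt (card N) * dens N W)"
      using avg_cost_le[OF N] C1 by auto
    moreover have "(1 - e) * e \<le> 1 * e" using assms by (intro mult_right_mono) auto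
    ultimately show ?thesis by (simp add: M_def m_def)
  qed
  then show ?thesis using C0(1) by blast
qed

text \<open>The slope of \<open>pent K \<kappa>\<close> at 0 is \<open>K\<close>, which becomes
  arbitrarily large as \<kappa> tends to 0. Thus small sets have a boundary much larger than their
  size.\<close>

lemma small_set_isoperimetric:
  fixes L :: real
  assumes "0 < L"
  shows "\<exists>\<delta>>0. \<exists>C\<ge>1. \<forall>N S W. finite N \<longrightarrow> dens N S \<le> \<delta> \<longrightarrow>
    L * dens N S \<le> avg N (cost C S W N)"
proof -
  \<comment> \<open>This forces \<open>K\<close> to be at least \<open>2 * L\<close>; the spare
    factor 2 is lost at densities up to \<delta>, where
    \<open>s powr \<kappa> \<le> 1 / 2\<close>.\<close>
  define \<kappa> where "\<kappa> = min 1 (1 / (4 * L))"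
  have \<kappa>: "0 < \<kappa>" "\<kappa> \<le> 1" "\<kappa> \<le> 1 / (4 * L)" using assms by (auto simp: \<kappa>_def)
  define K where "K = (1 - 1 / 2) / (1 - 2 powr (- \<kappa>))"
  have o: "0 < 1 - 2 powr (- \<kappa>)" using one_minus_two_powr \<kappa> by auto
  have K0: "0 < K" and K1: "K * (1 - 2 powr (- \<kappa>)) \<le> 1 - 1 / 2"
    using o by (auto simp: K_def)
  have "1 - 2 powr (- \<kappa>) \<le> \<kappa> * ln 2" using one_minus_two_powr \<kappa> by auto
  also have "\<dots> \<le> \<kappa> * 1" using \<kappa> ln2_le_25_over_36 by (intro mult_left_mono) auto
  finally have "1 - 2 powr (- \<kappa>) \<le> 1 / (4 * L)" using \<kappa> by simp
  then have "(1 - 1 / 2) / (1 / (4 * L)) \<le> K" unfolding K_def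
    using o assms by (intro divide_left_mono) auto
  then have K2: "2 * L \<le> K" by simp
  obtain C where C: "1 \<le> C" "1 / C\<^sup>2 \<le> min (1 / 2 / (2 * K)) (1 / 2 / (8 * K\<^sup>2))"
    using recip_square_le[of "min (1 / 2 / (2 * K)) (1 / 2 / (8 * K\<^sup>2))"] K0 by auto
  have "1 / C\<^sup>2 \<le> 1 / 2 / (2 * K)" "1 / C\<^sup>2 \<le> 1 / 2 / (8 * K\<^sup>2)" using C(2) by auto
  then have "2 * (1 / C\<^sup>2) * K \<le> 1 / 2" "8 * (1 / C\<^sup>2) * K\<^sup>2 \<le> 1 / 2"
    using K0 C(1) by (simp_all add: field_simps)
  then have U: "two_point (1 / C\<^sup>2) (pent K \<kappa>)"
    using two_point_pent[of \<kappa> "1 / 2" K "1 / C\<^sup>2"] \<kappa> K0 K1 by auto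
  define \<delta> where "\<delta> = (1 / 2) powr (1 / \<kappa>)"
  have "L * dens N S \<le> avg N (cost C S W N)" if N: "finite N" "dens N S \<le> \<delta>" for N S W
  proof -
    define s where "s = dens N S"
    have s: "0 \<le> s" "s \<le> \<delta>" using N by (auto simp: s_def density_nonneg)
    have "s powr \<kappa> \<le> \<delta> powr \<kappa>" using s \<kappa> by (intro powr_mono2) auto
    also have "\<dots> = 1 / 2" using \<kappa> by (simp add: \<delta>_def powr_powr)
    finally have sk: "s powr \<kappa> \<le> 1 / 2" .
    have "L * s \<le> K / 2 * s" using K2 s by (intro mult_right_mono) auto
    also have "\<dots> = K * (s * (1 - 1 / 2))" by simp
    also have "\<dots> \<le> K * (s * (1 - s powr \<kappa>))" using sk s K0 by (intro mult_left_mono) auto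
    also have "\<dots> = pent K \<kappa> s"
      using s by (cases "s = 0") (simp_all add: pent_def powr_add algebra_simps)
    also have "\<dots> \<le> avg N (cost C S W N)"
      unfolding s_def by (rule isoperimetric[OF U C(1) _ _ N(1)]) auto
    finally show ?thesis by (simp add: s_def)
  qed
  moreover have "0 < \<delta>" by (simp add: \<delta>_def)
  ultimately show ?thesis using C(1) by blast
qed

text \<open>Subtracting \<open>ent\<close> from the bound \<open>D\<close> on the whole boundary
  leaves a lower bound \<beta> for the relative entropy of the section densities, and
  \<open>dev\<close> bounds their mean deviation by \<beta>. Now average
  \<open>square_ge_entropy\<close> at the relative densities \<open>M z / m\<close>.\<close>

lemma section_variance_ge:
  fixes e d \<omega> :: real
  assumes N: "finite N" "Q \<subseteq> N" and e: "0 < e" "0 \<le> \<omega>" "0 \<le> d"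
    and m: "0 < dens N S"
    and ent: "avg Q (\<lambda>z. - (avg (N - Q) (\<lambda>w. of_bool (z \<union> w \<in> S)) * log 2 (avg (N - Q) (\<lambda>w. of_bool (z \<union> w \<in> S)))))
        \<le> (\<Sum>i\<in>N - Q. infl N S W i) + e + \<omega>"
    and dev: "(1 - e) * avg Q (\<lambda>z. \<bar>avg (N - Q) (\<lambda>w. of_bool (z \<union> w \<in> S)) - dens N S\<bar>)
        \<le> (\<Sum>i\<in>Q. infl N S W i) + e + \<omega>"
    and D: "(\<Sum>i\<in>N. infl N S W i) \<le> - (dens N S * log 2 (dens N S)) + d"
  shows "dens N S * ((\<Sum>i\<in>Q. infl N S W i) - 3 * d - 7 * e - 5 * \<omega>)
    \<le> avg Q (\<lambda>z. (avg (N - Q) (\<lambda>w. of_bool (z \<union> w \<in> S)) - dens N S)\<^sup>2)"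
proof -
  have fin: "finite Q" "finite (N - Q)" "Q \<inter> (N - Q) = {}" using N finite_subset by auto
  have un: "Q \<union> (N - Q) = N" using N by auto
  define m where "m = dens N S"
  define M where "M = (\<lambda>z. avg (N - Q) (\<lambda>w. of_bool (z \<union> w \<in> S)))"
  define \<beta> where "\<beta> = (\<Sum>i\<in>Q. infl N S W i)"
  define a where "a = ln 2 / (1 - ln (2::real))"
  define X where "X = avg Q (\<lambda>z. \<bar>M z - m\<bar>)"
  define Y where "Y = avg Q (\<lambda>z. - (M z * log 2 (M z)))"
  have a: "2 \<le> a" "a \<le> 3"
    using ln2_ge_two_thirds ln2_le_25_over_36 by (simp_all add: a_def field_simps)
  have m0: "0 < m" "m \<le> 1" using assms(6) N by (auto simp: m_def density_le_1)
  have M: "0 \<le> M z" "M z \<le> 1" for z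
    using avg_mono[of "N - Q" "\<lambda>w. of_bool (z \<union> w \<in> S)" "\<lambda>_. 1"] fin
    by (auto simp: M_def intro: avg_nonneg)
  have avM: "avg Q M = m" using avg_Un[OF fin, of "\<lambda>x. of_bool (x \<in> S)"] un by (simp add: M_def m_def)
  have split: "(\<Sum>i\<in>N. infl N S W i) = \<beta> + (\<Sum>i\<in>N - Q. infl N S W i)"
    unfolding \<beta>_def using N by (simp add: sum.subset_diff)
  have Y: "Y \<le> - (m * log 2 m) + d - \<beta> + e + \<omega>"
    using ent D unfolding split by (simp add: Y_def M_def m_def)
  have "\<bar>M z - m\<bar> \<le> 1" for z using M[of z] m0 by linarith
  then have "X \<le> avg Q (\<lambda>z. 1)" unfolding X_def by (intro avg_mono)
  then have "X \<le> 1" using fin by simp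
  then have "e * X \<le> e * 1" using e by (intro mult_left_mono) auto
  then have X: "X \<le> \<beta> + 2 * e + \<omega>"
    using dev by (simp add: X_def M_def m_def \<beta>_def algebra_simps)
  have pointwise: "m * (a * (- (- (M z * log 2 (M z))) - log 2 m * M z - (M z - m)) - (a - 1) * \<bar>M z - m\<bar>)
      \<le> (M z - m)\<^sup>2" for z
  proof -
    define v where "v = M z / m"
    have v: "0 \<le> v" "M z = m * v" using M[of z] m0 by (auto simp: v_def)
    have "v * log 2 (m * v) = v * (log 2 m + log 2 v)"
      using v m0 by (cases "v = 0") (simp_all add: log_mult)
    then have "m * (a * (- (- (M z * log 2 (M z))) - log 2 m * M z - (M z - m)) - (a - 1) * \<bar>M z - m\<bar>)
        = m\<^sup>2 * (a * (v * log 2 v - (v - 1)) - (a - 1) * \<bar>v - 1\<bar>)"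
    proof -
      have "\<bar>M z - m\<bar> = m * \<bar>v - 1\<bar>"
      proof -
        have "M z - m = m * (v - 1)" unfolding v(2) by (simp add: algebra_simps)
        then show ?thesis using m0 by (simp add: abs_mult)
      qed
      moreover have "M z * log 2 (M z) = m * (v * log 2 m + v * log 2 v)"
        using \<open>v * log 2 (m * v) = _\<close> unfolding v(2) by (simp add: algebra_simps)
      ultimately show ?thesis unfolding v(2) by (simp add: power2_eq_square algebra_simps)
    qed
    also have "\<dots> \<le> m\<^sup>2 * (v - 1)\<^sup>2"
      using square_ge_entropy[OF v(1)] by (intro mult_left_mono) (auto simp: a_def)
    also have "\<dots> = (M z - m)\<^sup>2" unfolding v(2) by (simp add: power2_eq_square algebra_simps)
    finally show ?thesis .
  qed
  \<comment> \<open>With \<open>a \<le> 3\<close> the error coefficients \<open>a\<close>,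
    \<open>3 * a - 2\<close> and \<open>2 * a - 1\<close> of \<open>d\<close>, \<open>e\<close> and
    \<omega> are at most 3, 7 and 5.\<close>
  have "a * (Y + m * log 2 m) \<le> a * (d - \<beta> + e + \<omega>)" using Y a by (intro mult_left_mono) auto
  moreover have "(a - 1) * X \<le> (a - 1) * (\<beta> + 2 * e + \<omega>)" using X a by (intro mult_left_mono) auto
  moreover have "a * d \<le> 3 * d" "a * e \<le> 3 * e" "a * \<omega> \<le> 3 * \<omega>"
    using a e by (auto intro: mult_right_mono)
  ultimately have "\<beta> - 3 * d - 7 * e - 5 * \<omega> \<le> a * (- Y - m * log 2 m) - (a - 1) * X"
    by (simp add: algebra_simps)
  then have "m * (\<beta> - 3 * d - 7 * e - 5 * \<omega>) \<le> m * (a * (- Y - m * log 2 m) - (a - 1) * X)"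
    using m0 by (intro mult_left_mono) auto
  also have "\<dots> = avg Q (\<lambda>z. m * (a * (- (- (M z * log 2 (M z))) - log 2 m * M z - (M z - m)) - (a - 1) * \<bar>M z - m\<bar>))"
  proof -
    have "avg Q (\<lambda>z. - (- (M z * log 2 (M z)))) = - Y"
      using avg_cmult[of Q "- 1" "\<lambda>z. - (M z * log 2 (M z))"] by (simp add: Y_def)
    then show ?thesis
      unfolding avg_diff avg_cmult avM X_def[symmetric] using fin by (simp add: algebra_simps)
  qed
  also have "\<dots> \<le> avg Q (\<lambda>z. (M z - m)\<^sup>2)" by (rule avg_mono) (rule pointwise)
  finally show ?thesis by (simp add: \<beta>_def M_def m_def)
qed

text \<open>Averaging \<open>section_variance_ge\<close> over a p-random \<open>Q\<close> turns the
  boundary in \<open>Q\<close> into p times the whole boundary. Comparison with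
  \<open>random_section_variance\<close> and division by p leave an error of at most
  \<open>4 * p\<close>.\<close>

lemma level_one_weight:
  fixes \<gamma> :: real
  assumes "0 < \<gamma>"
  shows "\<exists>\<zeta>>0. \<forall>N S W. finite N \<longrightarrow> 0 < dens N S \<longrightarrow> sqrt (card N) * dens N W \<le> \<zeta> \<longrightarrow>
    (\<Sum>i\<in>N. infl N S W i) \<le> - (dens N S * log 2 (dens N S)) + \<zeta> \<longrightarrow>
    dens N S * (\<Sum>i\<in>N. infl N S W i) - \<gamma>
      \<le> (\<Sum>i\<in>N. (fourier N (\<lambda>x. of_bool (x \<in> S)) {i})\<^sup>2)
    \<and> - (dens N S * log 2 (dens N S)) - \<gamma> \<le> (\<Sum>i\<in>N. infl N S W i)"
proof -
  define p where "p = min 1 (\<gamma> / 4)"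
  have p: "0 < p" "p \<le> 1" "4 * p \<le> \<gamma>" using assms by (auto simp: p_def)
  \<comment> \<open>All errors must be of order \<open>p * p\<close> to survive the division by p;
    \<open>7 * e\<close>, \<open>5 * \<omega>\<close> and \<open>3 * \<zeta>\<close> will each be at
    most \<open>p * p\<close>.\<close>
  define e where "e = p * p / 7"
  have pp: "p * p \<le> p * 1" using p by (intro mult_left_mono) auto
  have e7: "7 * e = p * p" by (simp add: e_def)
  have e: "0 < e" using p by (simp add: e_def)
  have e1: "e \<le> 1" using e7 pp p e by linarith
  from entropy_sections[OF e] obtain C1 where C1: "1 \<le> C1"
    and ent': "\<forall>C\<ge>C1. \<forall>N Q S W. finite N \<longrightarrow> Q \<subseteq> N \<longrightarrow>
    avg Q (\<lambda>z. - (avg (N - Q) (\<lambda>w. of_bool (z \<union> w \<in> S)) * log 2 (avg (N - Q) (\<lambda>w. of_bool (z \<union> w \<in> S)))))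
    \<le> (\<Sum>i\<in>N - Q. infl N S W i) + e + C * (sqrt (card N) * dens N W)"
    by (elim exE conjE) (rule that)
  note ent = ent'[rule_format]
  from deviation_sections[OF e e1] obtain C2 where C2: "1 \<le> C2"
    and dev': "\<forall>C\<ge>C2. \<forall>N Q S W. finite N \<longrightarrow> Q \<subseteq> N \<longrightarrow>
    (1 - e) * avg Q (\<lambda>z. \<bar>avg (N - Q) (\<lambda>w. of_bool (z \<union> w \<in> S)) - dens N S\<bar>)
    \<le> (\<Sum>i\<in>Q. infl N S W i) + e + C * (sqrt (card N) * dens N W)"
    by (elim exE conjE) (rule that)
  note dev = dev'[rule_format]
  define C where "C = max C1 C2"
  have C: "1 \<le> C" "C1 \<le> C" "C2 \<le> C" using C1 by (auto simp: C_def)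
  define \<zeta> where "\<zeta> = p * p / (5 * C)"
  have \<zeta>: "0 < \<zeta>" "5 * (C * \<zeta>) = p * p" using p C by (auto simp: \<zeta>_def)
  have "1 * \<zeta> \<le> C * \<zeta>" using C \<zeta> by (intro mult_right_mono) auto
  then have \<zeta>2: "5 * \<zeta> \<le> p * p" using \<zeta> by linarith
  have "dens N S * (\<Sum>i\<in>N. infl N S W i) - \<gamma>
      \<le> (\<Sum>i\<in>N. (fourier N (\<lambda>x. of_bool (x \<in> S)) {i})\<^sup>2)
    \<and> - (dens N S * log 2 (dens N S)) - \<gamma> \<le> (\<Sum>i\<in>N. infl N S W i)"
    if N: "finite N" "0 < dens N S" and w: "sqrt (card N) * dens N W \<le> \<zeta>"
      and D: "(\<Sum>i\<in>N. infl N S W i) \<le> - (dens N S * log 2 (dens N S)) + \<zeta>" for N S W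
  proof
    define m where "m = dens N S"
    define D where "D = (\<Sum>i\<in>N. infl N S W i)"
    define \<omega> where "\<omega> = C * (sqrt (card N) * dens N W)"
    define F where "F = (\<lambda>x. of_bool (x \<in> S) :: real)"
    have m0: "0 < m" "m \<le> 1" using N by (auto simp: m_def density_le_1)
    have om0: "\<omega> \<le> C * \<zeta>" unfolding \<omega>_def using w C by (intro mult_left_mono) auto
    have om: "0 \<le> \<omega>" "5 * \<omega> \<le> p * p"
      using C density_nonneg[of N W] om0 \<zeta>(2) by (simp add: \<omega>_def, linarith)
    have var: "m * ((\<Sum>i\<in>Q. infl N S W i) - 3 * (p * p))
      \<le> avg Q (\<lambda>z. (avg (N - Q) (\<lambda>w. F (z \<union> w)) - avg N F)\<^sup>2)" if Q: "Q \<subseteq> N" for Q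
    proof -
      have "m * ((\<Sum>i\<in>Q. infl N S W i) - 3 * (p * p)) \<le> m * ((\<Sum>i\<in>Q. infl N S W i) - 3 * \<zeta> - 7 * e - 5 * \<omega>)"
        using \<zeta>2 om \<zeta>(1) m0 e7 by (intro mult_left_mono) linarith+
      also have "\<dots> \<le> avg Q (\<lambda>z. (avg (N - Q) (\<lambda>w. F (z \<union> w)) - avg N F)\<^sup>2)"
        unfolding m_def F_def
        by (rule section_variance_ge[OF N(1) Q e om(1) less_imp_le[OF \<zeta>(1)] N(2) _ _ D])
          (use ent[OF C(2) N(1) Q] dev[OF C(3) N(1) Q] in \<open>simp_all only: \<omega>_def\<close>)
      finally show ?thesis .
    qed
    have "m * (p * D - 3 * (p * p)) = ravg p N (\<lambda>Q. m * ((\<Sum>i\<in>Q. infl N S W i) - 3 * (p * p)))"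
    proof -
      have "ravg p N (\<lambda>Q. m * ((\<Sum>i\<in>Q. infl N S W i) - 3 * (p * p)))
        = ravg p N (\<lambda>Q. (\<Sum>i\<in>N. (m * infl N S W i) * of_bool ({i} \<subseteq> Q)) + (- 3 * m * (p * p)))"
        unfolding ravg_def
      proof (intro sum.cong refl arg_cong2[of _ _ _ _ "(*)"])
        fix Q assume "Q \<in> Pow N"
        then have "(\<Sum>i\<in>Q. infl N S W i) = (\<Sum>i\<in>N. infl N S W i * of_bool ({i} \<subseteq> Q))"
          using N by (intro sum.mono_neutral_cong_left) auto
        then show "m * ((\<Sum>i\<in>Q. infl N S W i) - 3 * (p * p))
          = (\<Sum>i\<in>N. (m * infl N S W i) * of_bool ({i} \<subseteq> Q)) + (- 3 * m * (p * p))"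
          by (simp add: algebra_simps sum_distrib_left)
      qed
      also have "\<dots> = (\<Sum>i\<in>N. m * infl N S W i * p) + (- 3 * m * (p * p))"
      proof -
        have "ravg p N (\<lambda>Q. of_bool ({i} \<subseteq> Q)) = p" if "i \<in> N" for i
          using ravg_superset[of N "{i}" p] that N by simp
        then show ?thesis
          unfolding ravg_add ravg_sum ravg_cmult using N by (simp del: insert_subset cong: sum.cong)
      qed
      finally show ?thesis by (simp add: D_def algebra_simps sum_distrib_left)
    qed
    also have "\<dots> \<le> ravg p N (\<lambda>Q. avg Q (\<lambda>z. (avg (N - Q) (\<lambda>w. F (z \<union> w)) - avg N F)\<^sup>2))"
      using p var by (intro ravg_mono) auto
    also have "\<dots> \<le> p * (\<Sum>i\<in>N. (fourier N F {i})\<^sup>2) + p\<^sup>2 * avg N (\<lambda>x. (F x)\<^sup>2)"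
      using p by (intro random_section_variance N) auto
    also have "avg N (\<lambda>x. (F x)\<^sup>2) = m" unfolding F_def m_def by (rule avg_cong) simp
    finally have "p * (m * D - 4 * (m * p)) \<le> p * (\<Sum>i\<in>N. (fourier N F {i})\<^sup>2)"
      by (simp add: power2_eq_square algebra_simps)
    then have "m * D - 4 * (m * p) \<le> (\<Sum>i\<in>N. (fourier N F {i})\<^sup>2)" using p by simp
    moreover have "m * p \<le> 1 * p" using m0 p by (intro mult_right_mono) auto
    ultimately show "dens N S * (\<Sum>i\<in>N. infl N S W i) - \<gamma>
        \<le> (\<Sum>i\<in>N. (fourier N (\<lambda>x. of_bool (x \<in> S)) {i})\<^sup>2)"
      using p unfolding F_def m_def D_def by linarith
    \<comment> \<open>For empty \<open>Q\<close> the only section is the whole cube, and the entropy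
      bound becomes the isoperimetric inequality.\<close>
    have "- (m * log 2 m) \<le> D + e + \<omega>"
      using ent[OF C(2) N(1), of "{}" S W] by (simp add: m_def D_def \<omega>_def)
    moreover have "e + \<omega> \<le> p * p" using om e7 e by linarith
    ultimately show "- (dens N S * log 2 (dens N S)) - \<gamma> \<le> (\<Sum>i\<in>N. infl N S W i)"
      using pp p unfolding m_def D_def by linarith
  qed
  then show ?thesis using \<zeta>(1) by blast
qed

section \<open>Rough and linear stability\<close>

lemma avg_flip:
  assumes "finite N" "i \<in> N"
  shows "avg N (\<lambda>x. F (flip i x)) = avg N F"
proof -
  have "bij_betw (flip i) (Pow N) (Pow N)"
    using assms by (intro bij_betwI[of _ _ _ "flip i"]) (auto simp: flip_subset)
  then show ?thesis unfolding avg_def by (simp add: sum.reindex_bij_betw)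
qed

lemma fourier_singleton: "fourier N F {i} = avg N (\<lambda>x. (if i \<in> x then - 1 else 1) * F x)"
  unfolding fourier_def by (rule avg_cong) auto

lemma avg_abs_le: "\<bar>avg N F\<bar> \<le> avg N (\<lambda>x. \<bar>F x\<bar>)"
  by (simp add: avg_def divide_right_mono)

lemma fourier_singleton_le_density: "\<bar>fourier N (\<lambda>x. of_bool (x \<in> S)) {i}\<bar> \<le> dens N S"
  unfolding fourier_singleton by (rule order_trans[OF avg_abs_le]) (auto intro!: avg_mono)

text \<open>Pairs \<open>x\<close>, \<open>flip i x\<close> that both lie in \<open>S\<close>
  cancel, so only boundary vertices contribute; those in \<open>W\<close> are paid for by its
  density.\<close>

lemma fourier_singleton_le_infl:
  assumes "finite N" "i \<in> N"
  shows "\<bar>fourier N (\<lambda>x. of_bool (x \<in> S)) {i}\<bar> \<le> infl N S W i + dens N W"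
proof -
  define s where "s = (\<lambda>x. if i \<in> x then - 1 else 1 :: real)"
  define G where "G = (\<lambda>x. s x * of_bool (x \<in> S \<and> flip i x \<in> S))"
  define H where "H = (\<lambda>x. s x * of_bool (x \<in> S \<and> flip i x \<notin> S))"
  have "s (flip i x) = - s x" for x by (auto simp: s_def flip_def)
  then have "G (flip i x) = - G x" for x by (auto simp: G_def)
  then have "avg N (\<lambda>x. - G x) = avg N G" using avg_flip[OF assms, of G] by simp
  moreover have "avg N (\<lambda>x. - G x) = - avg N G" using avg_cmult[of N "- 1" G] by simp
  ultimately have G0: "avg N G = 0" by simp
  have "fourier N (\<lambda>x. of_bool (x \<in> S)) {i} = avg N (\<lambda>x. G x + H x)"
    unfolding fourier_singleton by (rule avg_cong) (auto simp: G_def H_def s_def)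
  then have "\<bar>fourier N (\<lambda>x. of_bool (x \<in> S)) {i}\<bar> = \<bar>avg N H\<bar>" by (simp add: avg_add G0)
  also have "\<dots> \<le> avg N (\<lambda>x. of_bool (x \<in> S \<and> x \<notin> W \<and> flip i x \<notin> S) + of_bool (x \<in> W))"
    by (rule order_trans[OF avg_abs_le]) (auto intro!: avg_mono simp: H_def s_def)
  finally show ?thesis by (simp add: avg_add infl_def)
qed

text \<open>The sign of the coefficient tells the majority side: it is negative if most of
  \<open>S\<close> contains \<open>i\<close>. The rest is the minority.\<close>

lemma density_wrong_side:
  defines "c \<equiv> \<lambda>N S i. fourier N (\<lambda>x. of_bool (x \<in> S)) {i}"
  shows "avg N (\<lambda>x. of_bool (x \<in> S \<and> (i \<in> x) \<noteq> (c N S i < 0))) = (dens N S - \<bar>c N S i\<bar>) / 2"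
proof -
  define s where "s = (if c N S i < 0 then - 1 else 1 :: real)"
  have "avg N (\<lambda>x. of_bool (x \<in> S \<and> (i \<in> x) \<noteq> (c N S i < 0)))
     = avg N (\<lambda>x. (1 / 2) * (of_bool (x \<in> S) - s * ((if i \<in> x then - 1 else 1) * of_bool (x \<in> S))))"
    by (rule avg_cong) (auto simp: s_def)
  also have "\<dots> = (1 / 2) * (dens N S - s * c N S i)"
    unfolding avg_cmult avg_diff c_def fourier_singleton ..
  also have "s * c N S i = \<bar>c N S i\<bar>" by (simp add: s_def)
  finally show ?thesis by simp
qed

lemma infl_le_density: "infl N S W i \<le> dens N S"
  unfolding infl_def by (rule avg_mono) auto

text \<open>Here \<theta> stands for the influences and \<phi> for the absolute coefficients.
  Replacing \<phi> by \<theta> + w in the squares turns \<open>E\<close> into \<open>E'\<close> and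
  leaves \<open>(\<Sum>i\<in>N. \<theta> i * (m - \<theta> i)) \<le> E'\<close> with nonnegative
  terms. So each \<theta> is close to 0 or to \<open>m\<close>, and their sum determines how many
  are close to \<open>m\<close>.\<close>

lemma concentrated_coordinates:
  fixes \<theta> \<phi> :: "'a \<Rightarrow> real" and m w E :: real
  assumes N: "finite N" and m: "0 < m" and w: "0 \<le> w"
    and \<theta>: "\<And>i. i \<in> N \<Longrightarrow> 0 \<le> \<theta> i" "\<And>i. i \<in> N \<Longrightarrow> \<theta> i \<le> m"
    and \<phi>: "\<And>i. i \<in> N \<Longrightarrow> 0 \<le> \<phi> i" "\<And>i. i \<in> N \<Longrightarrow> \<phi> i \<le> m" "\<And>i. i \<in> N \<Longrightarrow> \<phi> i \<le> \<theta> i + w"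
    and sq: "m * (\<Sum>i\<in>N. \<theta> i) - E \<le> (\<Sum>i\<in>N. (\<phi> i)\<^sup>2)"
    and k: "\<bar>(\<Sum>i\<in>N. \<theta> i) - real k * m\<bar> \<le> m / 4"
  defines "E' \<equiv> E + 2 * w * (\<Sum>i\<in>N. \<theta> i) + card N * w\<^sup>2"
  assumes E: "8 * E' \<le> m\<^sup>2" "0 \<le> E"
  shows "\<exists>I\<subseteq>N. card I = k \<and> (\<forall>i\<in>I. m - \<phi> i \<le> 3 * E' / m)"
proof -
  define D where "D = (\<Sum>i\<in>N. \<theta> i)"
  have up: "(\<phi> i)\<^sup>2 \<le> (\<theta> i)\<^sup>2 + 2 * w * \<theta> i + w\<^sup>2" if "i \<in> N" for i
  proof -
    have "(\<phi> i)\<^sup>2 \<le> (\<theta> i + w)\<^sup>2" using \<phi> that by (intro power_mono) auto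
    then show ?thesis by (simp add: power2_eq_square algebra_simps)
  qed
  have up': "(\<Sum>i\<in>A. (\<phi> i)\<^sup>2) \<le> (\<Sum>i\<in>A. (\<theta> i)\<^sup>2) + (E' - E)" if A: "A \<subseteq> N" for A
  proof -
    have fA: "finite A" using A N finite_subset by auto
    have "(\<Sum>i\<in>A. (\<phi> i)\<^sup>2) \<le> (\<Sum>i\<in>A. (\<theta> i)\<^sup>2 + 2 * w * \<theta> i + w\<^sup>2)"
      using A up by (intro sum_mono) auto
    also have "\<dots> = (\<Sum>i\<in>A. (\<theta> i)\<^sup>2) + 2 * w * (\<Sum>i\<in>A. \<theta> i) + card A * w\<^sup>2"
      by (simp add: sum.distrib sum_distrib_left)
    also have "\<dots> \<le> (\<Sum>i\<in>A. (\<theta> i)\<^sup>2) + (2 * w * (\<Sum>i\<in>N. \<theta> i) + card N * w\<^sup>2)"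
      using A N \<theta> w sum_mono2[of N A \<theta>] card_mono[of N A]
      by (simp add: add_mono mult_left_mono mult_right_mono)
    finally show ?thesis by (simp add: E'_def)
  qed
  have mix: "(\<Sum>i\<in>N. \<theta> i * (m - \<theta> i)) \<le> E'"
    using up'[OF order_refl] sq
    by (simp add: algebra_simps sum_subtractf sum_distrib_left power2_eq_square)
  define I where "I = {i \<in> N. m / 2 < \<theta> i}"
  have I: "I \<subseteq> N" "finite I" using N by (auto simp: I_def)
  have mixnn: "0 \<le> \<theta> i * (m - \<theta> i)" if "i \<in> N" for i using \<theta> that by auto
  have close: "\<bar>\<theta> i - m * of_bool (i \<in> I)\<bar> \<le> (2 / m) * (\<theta> i * (m - \<theta> i))" if i: "i \<in> N" for i
  proof (cases "i \<in> I")
    case True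
    then have "m / 2 * (m - \<theta> i) \<le> \<theta> i * (m - \<theta> i)"
      using \<theta>[OF i] by (intro mult_right_mono) (auto simp: I_def)
    then show ?thesis using True \<theta>[OF i] m by (simp add: field_simps)
  next
    case False
    then have "\<theta> i * (m / 2) \<le> \<theta> i * (m - \<theta> i)"
      using \<theta>[OF i] i by (intro mult_left_mono) (auto simp: I_def)
    then show ?thesis using False \<theta>[OF i] m by (simp add: field_simps)
  qed
  have E'm: "E' / m \<le> m / 8" using E m by (simp add: pos_divide_le_eq power2_eq_square)
  have "\<bar>D - m * card I\<bar> = \<bar>\<Sum>i\<in>N. \<theta> i - m * of_bool (i \<in> I)\<bar>"
    using N I by (simp add: D_def sum_subtractf Int_absorb1 flip: sum_distrib_left)
  also have "\<dots> \<le> (\<Sum>i\<in>N. (2 / m) * (\<theta> i * (m - \<theta> i)))"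
    using close by (intro order_trans[OF sum_abs] sum_mono) auto
  also have "\<dots> = (2 / m) * (\<Sum>i\<in>N. \<theta> i * (m - \<theta> i))" by (simp add: sum_distrib_left)
  also have "\<dots> \<le> (2 / m) * E'" using mix m by (intro mult_left_mono) auto
  also have "\<dots> = 2 * (E' / m)" by simp
  also have "\<dots> \<le> m / 4" using E'm by linarith
  finally have "\<bar>real k * m - m * card I\<bar> \<le> m / 2" using k unfolding D_def by linarith
  moreover have "real k * m - m * card I = m * (real k - card I)" by (simp add: algebra_simps)
  ultimately have "m * \<bar>real k - card I\<bar> \<le> m * (1 / 2)"
    using m by (simp add: abs_mult)
  then have "\<bar>real k - card I\<bar> \<le> 1 / 2" using m by (simp only: mult_le_cancel_left_pos)
  then have "card I = k" by linarith
  moreover have "m - \<phi> i \<le> 3 * E' / m" if i: "i \<in> I" for i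
  proof -
    have iN: "i \<in> N" using i I by auto
    \<comment> \<open>To pass from \<theta> to \<phi> at one index, the squares at all other indices
      are bounded by \<open>m * \<theta> j\<close>; what remains must come from
      \<open>i\<close>.\<close>
    have "(\<Sum>j\<in>N - {i}. (\<phi> j)\<^sup>2) \<le> (\<Sum>j\<in>N - {i}. (\<theta> j)\<^sup>2) + (E' - E)" by (rule up') auto
    also have "(\<Sum>j\<in>N - {i}. (\<theta> j)\<^sup>2) \<le> (\<Sum>j\<in>N - {i}. m * \<theta> j)"
      using \<theta> by (intro sum_mono) (auto simp: power2_eq_square intro: mult_right_mono)
    also have "\<dots> = m * (D - \<theta> i)" using N iN by (simp add: D_def sum_diff1 flip: sum_distrib_left)
    finally have 1: "(\<Sum>j\<in>N - {i}. (\<phi> j)\<^sup>2) \<le> m * (D - \<theta> i) + (E' - E)" by simp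
    have "(\<Sum>j\<in>N. (\<phi> j)\<^sup>2) = (\<phi> i)\<^sup>2 + (\<Sum>j\<in>N - {i}. (\<phi> j)\<^sup>2)"
      using N iN by (intro sum.remove) auto
    then have 2: "m * \<theta> i - E' \<le> (\<phi> i)\<^sup>2" using 1 sq by (simp add: D_def algebra_simps)
    have "\<theta> i * (m - \<theta> i) \<le> E'"
      using mix member_le_sum[OF iN, of "\<lambda>i. \<theta> i * (m - \<theta> i)"] mixnn N by fastforce
    moreover have "m / 2 * (m - \<theta> i) \<le> \<theta> i * (m - \<theta> i)"
      using \<theta>[OF iN] i by (intro mult_right_mono) (auto simp: I_def)
    ultimately have "m / 2 * (m - \<theta> i) \<le> E'" by linarith
    then have 3: "m * m - 2 * E' \<le> m * \<theta> i" by (simp add: algebra_simps)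
    have "(\<phi> i)\<^sup>2 \<le> m * \<phi> i" unfolding power2_eq_square using \<phi>[OF iN] by (intro mult_right_mono) auto
    then have "m * (m - \<phi> i) \<le> 3 * E'" using 2 3 by (simp add: algebra_simps)
    then show ?thesis using m by (simp add: field_simps)
  qed
  ultimately show ?thesis using I by blast
qed

lemma avg_bex_le:
  assumes "finite I"
  shows "avg N (\<lambda>x. of_bool (\<exists>i\<in>I. P i x)) \<le> (\<Sum>i\<in>I. avg N (\<lambda>x. of_bool (P i x)))"
  unfolding avg_sum[symmetric]
proof (rule avg_mono)
  fix x
  show "of_bool (\<exists>i\<in>I. P i x) \<le> (\<Sum>i\<in>I. of_bool (P i x) :: real)"
  proof (cases "\<exists>i\<in>I. P i x")
    case True
    then obtain i where "i \<in> I" "P i x" by blast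
    then show ?thesis
      using member_le_sum[of i I "\<lambda>i. of_bool (P i x) :: real"] assms True by simp
  qed (simp add: sum_nonneg)
qed

text \<open>At density \<open>q = 1 / 2 ^ k\<close> the entropy term equals \<open>k * q\<close>,
  the permitted total influence. By continuity both hypotheses of \<open>level_one_weight\<close>
  hold nearby, and the signs of the coefficients at the k large coordinates select the
  subcube.\<close>

lemma rough_stability:
  fixes \<delta> :: real and k :: nat
  assumes "0 < \<delta>"
  shows "\<exists>\<zeta>>0. \<forall>N S W. finite N \<longrightarrow> \<bar>dens N S - 1 / 2 ^ k\<bar> \<le> \<zeta> \<longrightarrow>
    sqrt (card N) * dens N W \<le> \<zeta> \<longrightarrow> (\<Sum>i\<in>N. infl N S W i) \<le> k / 2 ^ k + \<zeta> \<longrightarrow>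
    (\<exists>I z. I \<subseteq> N \<and> card I = k \<and> dens N {x \<in> S. \<exists>i\<in>I. (i \<in> x) \<noteq> z i} \<le> \<delta>)"
proof -
  define q where "q = 1 / (2::real) ^ k"
  have q: "0 < q" "q \<le> 1" by (auto simp: q_def)
  define L where "L = (\<lambda>m::real. - (m * log 2 m))"
  have Lq: "L q = k * q" by (simp add: L_def q_def log_divide log_nat_power)
  \<comment> \<open>The first bound gives \<open>8 * E' \<le> m\<^sup>2\<close>, as \<open>m\<close>
    is at least \<open>q / 2\<close>; the second makes k minority parts sum to at most
    \<delta>.\<close>
  define E0 where "E0 = min (q\<^sup>2 / 32) (\<delta> * q / (3 * (real k + 1)))"
  have E0: "0 < E0" "32 * E0 \<le> q\<^sup>2" "3 * (real k + 1) * E0 \<le> \<delta> * q"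
  proof -
    show "0 < E0" using q assms by (simp add: E0_def)
    have "E0 \<le> q\<^sup>2 / 32" "E0 \<le> \<delta> * q / (3 * (real k + 1))" unfolding E0_def by (rule min.cobounded1 min.cobounded2)+
    then show "32 * E0 \<le> q\<^sup>2" "3 * (real k + 1) * E0 \<le> \<delta> * q"
      by (simp_all add: pos_le_divide_eq mult.commute)
  qed
  define \<gamma> where "\<gamma> = min (E0 / 2) (q / 32)"
  have g: "0 < \<gamma>" "2 * \<gamma> \<le> E0" "32 * \<gamma> \<le> q" using E0 q by (auto simp: \<gamma>_def)
  from level_one_weight[OF g(1)] obtain \<zeta>1 where z1: "0 < \<zeta>1"
    and lev': "\<forall>N S W. finite N \<longrightarrow> 0 < dens N S \<longrightarrow> sqrt (card N) * dens N W \<le> \<zeta>1 \<longrightarrow>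
    (\<Sum>i\<in>N. infl N S W i) \<le> - (dens N S * log 2 (dens N S)) + \<zeta>1 \<longrightarrow>
    dens N S * (\<Sum>i\<in>N. infl N S W i) - \<gamma>
      \<le> (\<Sum>i\<in>N. (fourier N (\<lambda>x. of_bool (x \<in> S)) {i})\<^sup>2)
    \<and> - (dens N S * log 2 (dens N S)) - \<gamma> \<le> (\<Sum>i\<in>N. infl N S W i)"
    by (elim exE conjE) (rule that)
  note lev = lev'[rule_format]
  have "isCont L q" unfolding L_def using q by (intro continuous_intros) auto
  then obtain r where r: "0 < r" "\<And>m. \<bar>m - q\<bar> < r \<Longrightarrow> \<bar>L m - L q\<bar> < min \<gamma> (\<zeta>1 / 2)"
    unfolding continuous_at_eps_delta dist_real_def using g z1
    by (metis half_gt_zero min_less_iff_conj)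
  \<comment> \<open>The entries serve, in order: \<open>\<zeta>\<^sup>2 \<le> \<zeta>\<close>, the
    error \<open>2 * w * D + card N * w\<^sup>2\<close> (with \<open>2 * k + 2\<close> and 1 as its
    two shares), the distance of \<open>D\<close> from \<open>k * m\<close>,
    \<open>m \<ge> q / 2\<close>, the hypotheses of \<open>level_one_weight\<close>, and
    continuity.\<close>
  define \<zeta> where "\<zeta> = Min {1 :: real, E0 / (2 * (2 * real k + 3)), q / (16 * (real k + 1)), q / 2, \<zeta>1 / 2, r / 2}"
  have z0: "0 < \<zeta>" using E0 q z1 r by (auto simp: \<zeta>_def)
  have "\<zeta> \<le> 1" "\<zeta> \<le> E0 / (2 * (2 * real k + 3))" "\<zeta> \<le> q / (16 * (real k + 1))"
      "\<zeta> \<le> q / 2" "\<zeta> \<le> \<zeta>1 / 2" "\<zeta> \<le> r / 2"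
    unfolding \<zeta>_def by (rule Min_le; blast)+
  then have z: "\<zeta> \<le> 1" "2 * (\<zeta> * (2 * real k + 3)) \<le> E0" "16 * ((real k + 1) * \<zeta>) \<le> q"
      "2 * \<zeta> \<le> q" "2 * \<zeta> \<le> \<zeta>1" "\<zeta> < r"
    using r by (auto simp: pos_le_divide_eq algebra_simps)
  have "\<exists>I z. I \<subseteq> N \<and> card I = k \<and> dens N {x \<in> S. \<exists>i\<in>I. (i \<in> x) \<noteq> z i} \<le> \<delta>"
    if N: "finite N" and S: "\<bar>dens N S - 1 / 2 ^ k\<bar> \<le> \<zeta>"
      and W: "sqrt (card N) * dens N W \<le> \<zeta>" and D: "(\<Sum>i\<in>N. infl N S W i) \<le> k / 2 ^ k + \<zeta>"
    for N S W
  proof -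
    define m where "m = dens N S"
    define w where "w = dens N W"
    define D where "D = (\<Sum>i\<in>N. infl N S W i)"
    define \<phi> where "\<phi> = (\<lambda>i. \<bar>fourier N (\<lambda>x. of_bool (x \<in> S)) {i}\<bar>)"
    have mq: "\<bar>m - q\<bar> \<le> \<zeta>" using S by (simp add: m_def q_def)
    then have m: "q \<le> 2 * m" "0 < m" using z q by linarith+
    have w0: "0 \<le> w" by (simp add: w_def density_nonneg)
    have W': "sqrt (card N) * w \<le> \<zeta>" using W by (simp add: w_def)
    have D': "0 \<le> D" "D \<le> k * q + \<zeta>" using that(4) by (auto simp: D_def q_def infl_nonneg sum_nonneg)
    have Lm: "k * q - \<gamma> \<le> L m" "k * q - \<zeta>1 / 2 \<le> L m"
    proof -
      have "\<bar>L m - L q\<bar> < min \<gamma> (\<zeta>1 / 2)" using r(2)[of m] mq z by simp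
      then have "\<bar>L m - k * q\<bar> < \<gamma>" "\<bar>L m - k * q\<bar> < \<zeta>1 / 2" using Lq by simp_all
      then show "k * q - \<gamma> \<le> L m" "k * q - \<zeta>1 / 2 \<le> L m" by linarith+
    qed
    have lev1: "m * D - \<gamma> \<le> (\<Sum>i\<in>N. (\<phi> i)\<^sup>2)" "L m - \<gamma> \<le> D"
      using lev[of N S W] N m W z0 z D' Lm
      by (auto simp: m_def D_def L_def w_def \<phi>_def)
    \<comment> \<open>For empty \<open>N\<close> the hypothesis on \<open>sqrt (card N) * w\<close>
      says nothing about \<open>w\<close>, but then \<open>D\<close> is 0.\<close>
    have "w * D \<le> \<zeta> * D"
    proof (cases "N = {}")
      case False
      then have "1 \<le> card N" using N by (simp add: Suc_leI card_gt_0_iff)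
      then have "1 * w \<le> sqrt (card N) * w" using w0 by (intro mult_right_mono) auto
      then show ?thesis using W' D'(1) by (intro mult_right_mono) auto
    qed (simp add: D_def)
    also have "\<dots> \<le> \<zeta> * (real k + 1)"
    proof -
      have "real k * q \<le> real k * 1" using q by (intro mult_left_mono) auto
      then show ?thesis using D' z z0 by (intro mult_left_mono) auto
    qed
    finally have wD: "2 * w * D \<le> \<zeta> * (2 * real k + 2)" by (simp add: algebra_simps)
    have "card N * w\<^sup>2 = (sqrt (card N) * w)\<^sup>2" by (simp add: power_mult_distrib)
    also have "\<dots> \<le> \<zeta>\<^sup>2" using W' w0 by (intro power_mono) auto
    also have "\<dots> \<le> \<zeta> * 1" unfolding power2_eq_square using z z0 by (intro mult_left_mono) auto
    finally have E': "\<gamma> + 2 * w * D + card N * w\<^sup>2 \<le> E0"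
      using wD g z(2) by (simp add: algebra_simps)
    define E' where "E' = \<gamma> + 2 * w * D + card N * w\<^sup>2"
    have E'0: "0 \<le> E'" using g w0 D' by (simp add: E'_def)
    have "q\<^sup>2 \<le> (2 * m)\<^sup>2" using m q by (intro power_mono) auto
    then have E8: "8 * E' \<le> m\<^sup>2" using E' E0 by (simp add: E'_def power2_eq_square)
    have km: "\<bar>k * q - k * m\<bar> \<le> k * \<zeta>"
    proof -
      have "\<bar>real k * q - real k * m\<bar> = real k * \<bar>m - q\<bar>"
        by (simp add: abs_mult abs_minus_commute flip: right_diff_distrib)
      also have "\<dots> \<le> real k * \<zeta>" using mq by (intro mult_left_mono) auto
      finally show ?thesis .
    qed
    have k: "\<bar>D - k * m\<bar> \<le> m / 4"
    proof -
      have "16 * (real k * \<zeta>) + 16 * \<zeta> \<le> q" using z(3) by (simp add: algebra_simps)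
      then have "D - real k * m \<le> m / 4" "real k * m - D \<le> m / 4"
        using km lev1(2) Lm(1) D' g m z0 unfolding abs_le_iff by linarith+
      then show ?thesis by linarith
    qed
    have "\<exists>I\<subseteq>N. card I = k \<and> (\<forall>i\<in>I. m - \<phi> i \<le> 3 * E' / m)"
      unfolding E'_def D_def
    proof (rule concentrated_coordinates[OF N m(2) w0])
      show "\<And>i. i \<in> N \<Longrightarrow> \<phi> i \<le> infl N S W i + w"
        using fourier_singleton_le_infl[OF N] by (auto simp: \<phi>_def w_def)
    qed (use lev1 k E8 g in \<open>auto simp: \<phi>_def m_def w_def D_def E'_def infl_nonneg infl_le_density
        fourier_singleton_le_density\<close>)
    then obtain I where I: "I \<subseteq> N" "card I = k" "\<And>i. i \<in> I \<Longrightarrow> m - \<phi> i \<le> 3 * E' / m" by blast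
    define z where "z = (\<lambda>i. fourier N (\<lambda>x. of_bool (x \<in> S)) {i} < 0)"
    have fI: "finite I" using I N finite_subset by auto
    have "dens N {x \<in> S. \<exists>i\<in>I. (i \<in> x) \<noteq> z i}
        = avg N (\<lambda>x. of_bool (\<exists>i\<in>I. x \<in> S \<and> (i \<in> x) \<noteq> z i))"
      by (rule avg_cong) auto
    also have "\<dots> \<le> (\<Sum>i\<in>I. avg N (\<lambda>x. of_bool (x \<in> S \<and> (i \<in> x) \<noteq> z i)))"
      by (rule avg_bex_le[OF fI])
    also have "\<dots> = (\<Sum>i\<in>I. (m - \<phi> i) / 2)"
      unfolding z_def density_wrong_side by (simp add: m_def \<phi>_def)
    also have "\<dots> \<le> (\<Sum>i\<in>I. 3 * E' / m / 2)" using I by (intro sum_mono divide_right_mono) auto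
    also have "\<dots> = 3 * real k * E' / (2 * m)" using I by simp
    also have "\<dots> \<le> 3 * real k * E' / q"
      using m q E'0 by (intro divide_left_mono) auto
    also have "\<dots> \<le> \<delta>"
    proof -
      have "3 * real k * E' \<le> 3 * (real k + 1) * E0"
        using E' E'0 by (intro mult_mono) (auto simp: E'_def)
      also have "\<dots> \<le> \<delta> * q" by (rule E0(3))
      finally show ?thesis using q by (simp add: field_simps)
    qed
    finally show ?thesis using I by blast
  qed
  then show ?thesis using z0 by blast
qed

section \<open>From rough to linear stability\<close>

lemma sum_infl:
  assumes "finite N" "Q \<subseteq> N"
  shows "(\<Sum>i\<in>Q. infl N S W i) = avg N (\<lambda>x. of_bool (x \<in> S \<and> x \<notin> W) * real (card (bdirs S Q x)))"
proof -
  have "finite Q" using assms finite_subset by auto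
  then show ?thesis
    unfolding infl_def avg_sum[symmetric] by (intro avg_cong) (auto simp: card_bdirs intro!: sum.cong sum.neutral)
qed

text \<open>Let \<open>T\<close> be the part of \<open>S\<close> outside the rough subcube and t its
  density. The factor \<open>k + 3\<close> in the small-set inequality is spent as follows: k on the
  edges that the missing vertices would have had, one on edges from \<open>T\<close> to the rest of
  \<open>S\<close>, one on edges from the rest into \<open>T\<close>. What remains is t itself,
  bounded by the O(\<epsilon>) excess of the total influence.\<close>

lemma linear_stability:
  fixes k :: nat
  shows "\<exists>\<zeta>>0. \<exists>K>0. \<forall>N S W \<epsilon>. finite N \<longrightarrow> \<epsilon> \<le> \<zeta> \<longrightarrow> \<bar>dens N S - 1 / 2 ^ k\<bar> \<le> \<epsilon> \<longrightarrow>
    dens N W \<le> \<epsilon> \<longrightarrow> sqrt (card N) * dens N W \<le> \<epsilon> \<longrightarrow>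
    (\<Sum>i\<in>N. infl N S W i) \<le> k / 2 ^ k + \<epsilon> \<longrightarrow>
    (\<exists>I z. I \<subseteq> N \<and> card I = k \<and> dens N {x \<in> S. \<exists>i\<in>I. (i \<in> x) \<noteq> z i} \<le> K * \<epsilon>)"
proof -
  obtain \<delta> C where \<delta>: "0 < \<delta>" and C: "1 \<le> C"
    and small: "\<forall>N S W. finite N \<longrightarrow> dens N S \<le> \<delta> \<longrightarrow>
      (real k + 3) * dens N S \<le> avg N (cost C S W N)"
    using small_set_isoperimetric[of "real k + 3"] by auto
  from rough_stability[OF \<delta>, of k] obtain \<zeta> where \<zeta>: "0 < \<zeta>"
    and rough: "\<forall>N S W. finite N \<longrightarrow> \<bar>dens N S - 1 / 2 ^ k\<bar> \<le> \<zeta> \<longrightarrow>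
    sqrt (card N) * dens N W \<le> \<zeta> \<longrightarrow> (\<Sum>i\<in>N. infl N S W i) \<le> k / 2 ^ k + \<zeta> \<longrightarrow>
    (\<exists>I z. I \<subseteq> N \<and> card I = k \<and> dens N {x \<in> S. \<exists>i\<in>I. (i \<in> x) \<noteq> z i} \<le> \<delta>)"
    by (elim exE conjE) (rule that)
  have main: "\<exists>I z. I \<subseteq> N \<and> card I = k \<and> dens N {x \<in> S. \<exists>i\<in>I. (i \<in> x) \<noteq> z i} \<le> (1 + 2 * real k + C) * \<epsilon>"
    if N: "finite N" and \<epsilon>: "\<epsilon> \<le> \<zeta>" and S: "\<bar>dens N S - 1 / 2 ^ k\<bar> \<le> \<epsilon>"
      and W: "dens N W \<le> \<epsilon>" "sqrt (card N) * dens N W \<le> \<epsilon>"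
      and D: "(\<Sum>i\<in>N. infl N S W i) \<le> k / 2 ^ k + \<epsilon>" for N S W \<epsilon>
  proof -
    have "\<exists>I z. I \<subseteq> N \<and> card I = k \<and> dens N {x \<in> S. \<exists>i\<in>I. (i \<in> x) \<noteq> z i} \<le> \<delta>"
    proof (rule rough[rule_format, OF N])
      show "\<bar>dens N S - 1 / 2 ^ k\<bar> \<le> \<zeta>" using S \<epsilon> by linarith
      show "sqrt (card N) * dens N W \<le> \<zeta>" using W(2) \<epsilon> by linarith
      show "(\<Sum>i\<in>N. infl N S W i) \<le> k / 2 ^ k + \<zeta>" using D \<epsilon> by linarith
    qed
    then obtain I z where I: "I \<subseteq> N" "card I = k"
      and td: "dens N {x \<in> S. \<exists>i\<in>I. (i \<in> x) \<noteq> z i} \<le> \<delta>" by blast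
    have fI: "finite I" using I N finite_subset by auto
    define T where "T = {x \<in> S. \<exists>i\<in>I. (i \<in> x) \<noteq> z i}"
    define t where "t = dens N T"
    define m where "m = dens N S"
    define w where "w = dens N W"
    define D where "D = (\<Sum>i\<in>N. infl N S W i)"
    define b where "b = (\<lambda>x. real (card (bdirs S N x)))"
    define X where "X = avg N (\<lambda>x. of_bool (x \<in> T \<and> x \<notin> W) * b x)"
    define Y where "Y = avg N (\<lambda>x. of_bool (x \<in> S \<and> x \<notin> W \<and> x \<notin> T) * b x)"
    have TS: "T \<subseteq> S" by (auto simp: T_def)
    have XY: "D = X + Y"
      unfolding D_def X_def Y_def sum_infl[OF N order_refl] avg_add[symmetric]
      by (rule avg_cong) (use TS in \<open>auto simp: b_def\<close>)
    \<comment> \<open>A flip can leave \<open>T\<close> inside \<open>S\<close> only by correcting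
      the unique wrong coordinate.\<close>
    have exit: "\<exists>j. \<forall>i. flip i x \<in> S \<longrightarrow> flip i x \<notin> T \<longrightarrow> i = j" if xT: "x \<in> T" for x
    proof -
      obtain j where j: "j \<in> I" "(j \<in> x) \<noteq> z j" using xT by (auto simp: T_def)
      have "i = j" if "flip i x \<in> S" "flip i x \<notin> T" for i
        using that j by (auto simp: T_def flip_def split: if_splits)
      then show ?thesis by blast
    qed
    have "(real k + 3) * t \<le> avg N (cost C T W N)"
      unfolding t_def using small N td unfolding T_def[symmetric] by blast
    also have "\<dots> \<le> avg N (\<lambda>x. of_bool (x \<in> T \<and> x \<notin> W) * b x + of_bool (x \<in> T)
        + (C * sqrt (card N)) * of_bool (x \<in> W))"
    proof (rule avg_mono)
      fix x
      have "card (bdirs T N x) \<le> card N" using N by (intro card_mono) (auto simp: bdirs_def)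
      then have "C * sqrt (card (bdirs T N x)) \<le> C * sqrt (card N)"
        using C by (intro mult_left_mono) auto
      then have 1: "C * sqrt (card (bdirs T N x)) \<le> 1 + C * sqrt (card N)" by linarith
      have 2: "real (card (bdirs T N x)) \<le> b x + 1" if xT: "x \<in> T"
      proof -
        obtain j where j: "\<And>i. flip i x \<in> S \<Longrightarrow> flip i x \<notin> T \<Longrightarrow> i = j" using exit[OF xT] by blast
        then have "bdirs T N x \<subseteq> insert j (bdirs S N x)" by (auto simp: bdirs_def)
        then have "card (bdirs T N x) \<le> card (insert j (bdirs S N x))"
          using N by (intro card_mono) auto
        also have "\<dots> \<le> card (bdirs S N x) + 1" using card_insert_le_m1 N
          by (simp add: card_insert_if)
        finally show ?thesis by (simp add: b_def)
      qed
      have 3: "0 \<le> b x" by (simp add: b_def)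
      show "cost C T W N x \<le> of_bool (x \<in> T \<and> x \<notin> W) * b x + of_bool (x \<in> T)
        + (C * sqrt (card N)) * of_bool (x \<in> W)"
        using 1 2 3 C by (auto simp: cost_def)
    qed
    finally have low1: "(real k + 3) * t \<le> X + t + C * (sqrt (card N) * w)"
      unfolding avg_add avg_cmult by (simp add: X_def t_def w_def mult.assoc)
    have "real k * (m - w - t) \<le> real k * avg N (\<lambda>x. of_bool (x \<in> S \<and> x \<notin> W \<and> x \<notin> T))"
      unfolding m_def w_def t_def avg_diff[symmetric]
      by (intro mult_left_mono avg_mono) auto
    also have "\<dots> = avg N (\<lambda>x. real k * of_bool (x \<in> S \<and> x \<notin> W \<and> x \<notin> T))" by (simp add: avg_cmult)
    also have "\<dots> \<le> avg N (\<lambda>x. of_bool (x \<in> S \<and> x \<notin> W \<and> x \<notin> T) * b x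
        + (\<Sum>i\<in>I. of_bool (x \<in> S \<and> x \<notin> T \<and> flip i x \<in> T)))"
    proof (rule avg_mono)
      fix x
      have "real k \<le> b x + (\<Sum>i\<in>I. of_bool (flip i x \<in> T))" if x: "x \<in> S" "x \<notin> T"
      proof -
        \<comment> \<open>A vertex of \<open>S\<close> outside \<open>T\<close> has all coordinates
          of \<open>I\<close> right, so flipping one of them leaves the subcube.\<close>
        have "flip i x \<notin> S \<or> flip i x \<in> T" if "i \<in> I" for i
          using x that by (auto simp: T_def flip_def)
        then have "(\<Sum>i\<in>I. 1) \<le> (\<Sum>i\<in>I. of_bool (flip i x \<notin> S) + of_bool (flip i x \<in> T) :: real)"
          by (intro sum_mono) auto
        moreover have "(\<Sum>i\<in>I. of_bool (flip i x \<notin> S)) \<le> b x"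
          unfolding b_def card_bdirs[OF N] using I N by (intro sum_mono2) auto
        ultimately show ?thesis using I by (simp add: sum.distrib)
      qed
      then show "real k * of_bool (x \<in> S \<and> x \<notin> W \<and> x \<notin> T)
          \<le> of_bool (x \<in> S \<and> x \<notin> W \<and> x \<notin> T) * b x
          + (\<Sum>i\<in>I. of_bool (x \<in> S \<and> x \<notin> T \<and> flip i x \<in> T))"
        by (auto intro: sum_nonneg)
    qed
    also have "\<dots> = Y + (\<Sum>i\<in>I. avg N (\<lambda>x. of_bool (x \<in> S \<and> x \<notin> T \<and> flip i x \<in> T)))"
      unfolding avg_add avg_sum Y_def ..
    \<comment> \<open>Counting these edges from their end in \<open>T\<close> allows at most one per
      vertex, by \<open>exit\<close>.\<close>
    also have "(\<Sum>i\<in>I. avg N (\<lambda>x. of_bool (x \<in> S \<and> x \<notin> T \<and> flip i x \<in> T)))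
        = (\<Sum>i\<in>I. avg N (\<lambda>x. of_bool (flip i x \<in> S \<and> flip i x \<notin> T \<and> x \<in> T)))"
    proof (rule sum.cong)
      fix i assume "i \<in> I"
      then have "i \<in> N" using I by auto
      from avg_flip[OF N this, of "\<lambda>x. of_bool (x \<in> S \<and> x \<notin> T \<and> flip i x \<in> T)"]
      show "avg N (\<lambda>x. of_bool (x \<in> S \<and> x \<notin> T \<and> flip i x \<in> T))
        = avg N (\<lambda>x. of_bool (flip i x \<in> S \<and> flip i x \<notin> T \<and> x \<in> T))" by simp
    qed simp
    also have "\<dots> \<le> t"
      unfolding avg_sum[symmetric] t_def
    proof (rule avg_mono)
      fix x
      show "(\<Sum>i\<in>I. of_bool (flip i x \<in> S \<and> flip i x \<notin> T \<and> x \<in> T)) \<le> (of_bool (x \<in> T) :: real)"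
      proof (cases "x \<in> T")
        case True
        then obtain j where j: "\<And>i. flip i x \<in> S \<Longrightarrow> flip i x \<notin> T \<Longrightarrow> i = j" using exit by blast
        have "(\<Sum>i\<in>I. of_bool (flip i x \<in> S \<and> flip i x \<notin> T \<and> x \<in> T)) \<le> (\<Sum>i\<in>I. of_bool (i = j) :: real)"
          using j by (intro sum_mono) auto
        also have "\<dots> \<le> 1" using fI by (simp add: of_bool_def sum.delta)
        finally show ?thesis using True by simp
      qed simp
    qed
    finally have low2: "real k * (m - w - t) \<le> Y + t" by simp
    have "C * (sqrt (card N) * w) \<le> C * \<epsilon>" using W C by (intro mult_left_mono) (auto simp: w_def)
    moreover have "real k * w \<le> real k * \<epsilon>" using W by (intro mult_left_mono) (auto simp: w_def)
    moreover have "real k * (1 / 2 ^ k - \<epsilon>) \<le> real k * m"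
      using S by (intro mult_left_mono) (auto simp: m_def)
    moreover have "real k * (1 / 2 ^ k - \<epsilon>) = real k / 2 ^ k - real k * \<epsilon>"
      by (simp add: right_diff_distrib)
    moreover have "D \<le> real k / 2 ^ k + \<epsilon>" using that(6) by (simp add: D_def)
    moreover have "real k * (m - w - t) = real k * m - real k * w - real k * t"
      "(real k + 3) * t = real k * t + 3 * t"
      "(1 + 2 * real k + C) * \<epsilon> = \<epsilon> + 2 * (real k * \<epsilon>) + C * \<epsilon>"
      by (simp_all add: algebra_simps)
    ultimately have "t \<le> (1 + 2 * real k + C) * \<epsilon>"
      using low1 low2 XY by linarith
    then show ?thesis using I unfolding t_def T_def by blast
  qed
  have "0 < 1 + 2 * real k + C" using C by simp
  then show ?thesis
    by - (rule exI[of _ \<zeta>], rule conjI[OF \<zeta>], rule exI[of _ "1 + 2 * real k + C"],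
        rule conjI, assumption, intro allI impI, rule main)
qed

section \<open>Growth of the weight function\<close>

lemma adj_iff: "adj n x y \<longleftrightarrow> x \<in> cube n \<and> (\<exists>i<n. y = flip i x)"
proof
  assume a: "adj n x y"
  then have "card ((x - y) \<union> (y - x)) = 1" by (simp only: adj_def)
  then obtain i where i: "(x - y) \<union> (y - x) = {i}" by (rule card_1_singletonE)
  have m: "(j \<in> x) \<noteq> (j \<in> y) \<longleftrightarrow> j = i" for j
  proof -
    have "j \<in> (x - y) \<union> (y - x) \<longleftrightarrow> j = i" unfolding i by simp
    then show ?thesis by blast
  qed
  have "j \<in> y \<longleftrightarrow> j \<in> flip i x" for j
    using m[of j] by (auto simp: flip_def)
  then have "y = flip i x" by blast
  moreover have "i < n"
    using m[of i] a by (auto simp: adj_def cube_def)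
  ultimately show "x \<in> cube n \<and> (\<exists>i<n. y = flip i x)" using a by (auto simp: adj_def)
next
  assume "x \<in> cube n \<and> (\<exists>i<n. y = flip i x)"
  then obtain i where i: "x \<in> cube n" "i < n" "y = flip i x" by blast
  then have "(x - y) \<union> (y - x) = {i}" by (auto simp: flip_def)
  moreover have "y \<in> cube n" using i by (auto simp: flip_def cube_def)
  ultimately show "adj n x y" using i by (simp add: adj_def)
qed

text \<open>The induction closes because
  \<open>sqrt ((2 * m + 1) * (2 * m + 3)) \<le> 2 * m + 2\<close>. The root of
  \<open>2 * m + 1\<close> covers both n = 2m and n = 2m + 1 in
  \<open>binomial_le_sqrt\<close>.\<close>

lemma central_binomial_upper: "real (2 * m choose m) * sqrt (2 * real m + 1) \<le> 4 ^ m"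
proof (induction m)
  case 0
  then show ?case by simp
next
  case (Suc m)
  define b where "b = real (2 * m choose m)"
  have rec: "real (2 * Suc m choose Suc m) = 2 * (2 * real m + 1) / (real m + 1) * b"
  proof -
    define a where "a = 2 * Suc m choose Suc m"
    define c where "c = Suc (2 * m) choose m"
    have a: "Suc m * a = 2 * Suc m * c"
      using Suc_times_binomial[of m "Suc (2 * m)"] by (simp add: a_def c_def)
    have "c = Suc (2 * m) choose Suc m"
      using binomial_symmetric[of m "Suc (2 * m)"] by (simp add: c_def)
    then have c: "Suc m * c = Suc (2 * m) * (2 * m choose m)"
      using Suc_times_binomial[of m "2 * m"] by simp
    have "Suc m * (Suc m * a) = 2 * Suc m * (Suc m * c)"
      unfolding a by (simp only: mult_ac)
    then have "Suc m * (Suc m * (2 * Suc m choose Suc m)) = (2 * Suc m) * (Suc (2 * m) * (2 * m choose m))"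
      unfolding c a_def .
    then have "real (Suc m * (Suc m * (2 * Suc m choose Suc m))) = real ((2 * Suc m) * (Suc (2 * m) * (2 * m choose m)))"
      by (simp only:)
    then have "(real m + 1) * ((real m + 1) * real (2 * Suc m choose Suc m))
      = (real m + 1) * (2 * (2 * real m + 1) * b)"
      unfolding b_def of_nat_mult by (simp add: algebra_simps)
    then have "(real m + 1) * real (2 * Suc m choose Suc m) = 2 * (2 * real m + 1) * b" by simp
    then show ?thesis by (simp add: field_simps)
  qed
  have s: "sqrt (2 * real m + 1) * sqrt (2 * real (Suc m) + 1) \<le> 2 * (real m + 1)"
    unfolding real_sqrt_mult[symmetric]
    by (rule real_le_lsqrt) (auto simp: power2_eq_square algebra_simps)
  have "(2 * real m + 1) * sqrt (2 * real (Suc m) + 1)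
      = sqrt (2 * real m + 1) * (sqrt (2 * real m + 1) * sqrt (2 * real (Suc m) + 1))"
    by simp
  also have "\<dots> \<le> sqrt (2 * real m + 1) * (2 * (real m + 1))"
    using s by (intro mult_left_mono) auto
  finally have "2 * (2 * real m + 1) / (real m + 1) * sqrt (2 * real (Suc m) + 1)
      \<le> 4 * sqrt (2 * real m + 1)"
    by (simp add: field_simps)
  then have "b * (2 * (2 * real m + 1) / (real m + 1) * sqrt (2 * real (Suc m) + 1))
      \<le> b * (4 * sqrt (2 * real m + 1))"
    by (rule mult_left_mono) (simp add: b_def)
  also have "\<dots> \<le> 4 ^ Suc m" using Suc.IH by (simp add: b_def)
  finally show ?case unfolding rec by (simp add: mult_ac)
qed

lemma binomial_le_sqrt:
  assumes "1 \<le> n"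
  shows "real (n choose r) * sqrt (real n) \<le> 2 ^ n"
proof -
  define m where "m = n div 2"
  have "real (n choose r) \<le> 2 ^ (n - 2 * m) * real (2 * m choose m)"
  proof (cases "even n")
    case True
    then have "n = 2 * m" by (simp add: m_def)
    then show ?thesis using binomial_maximum[of n r] by simp
  next
    case False
    then have n: "n = Suc (2 * m)" unfolding m_def by presburger
    have "Suc (2 * m) choose r \<le> 2 * (2 * m choose m)"
    proof (cases r)
      case (Suc r')
      then show ?thesis using binomial_maximum'[of m r'] binomial_maximum'[of m r] by simp
    qed (simp add: Suc_le_eq)
    then have "real (n choose r) \<le> real (2 * (2 * m choose m))" unfolding n by (rule of_nat_mono)
    then show ?thesis using n by simp
  qed
  then have "real (n choose r) * sqrt (real n) \<le> (2 ^ (n - 2 * m) * real (2 * m choose m)) * sqrt (2 * real m + 1)"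
    by (rule mult_mono) (auto simp: m_def)
  also have "\<dots> = 2 ^ (n - 2 * m) * (real (2 * m choose m) * sqrt (2 * real m + 1))" by simp
  also have "\<dots> \<le> 2 ^ (n - 2 * m) * 4 ^ m"
    using central_binomial_upper by (rule mult_left_mono) simp
  also have "\<dots> = 2 ^ n"
  proof -
    have "(4::real) ^ m = 2 ^ (2 * m)" by (simp add: power_mult)
    then show ?thesis by (simp add: m_def flip: power_add)
  qed
  finally show ?thesis by simp
qed

text \<open>Only the outermost layer of a Hamming ball has neighbours outside, at most n each, and a
  layer has measure at most \<open>1 / sqrt n\<close>. So the integral is at most
  \<open>f n / sqrt n\<close>, while continuity keeps \<open>g\<close> above half of
  \<open>g q > 0\<close> when the ball has measure close to \<open>q\<close>.\<close>

lemma growth_from_isoperimetry: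
  fixes k :: nat and f g :: "real \<Rightarrow> real"
  assumes k_pos: "k \<ge> 1"
    and g_cont: "continuous_on {0..1} g"
    and g_val: "g (1 / 2 ^ k) = real k / 2 ^ k"
    and f_nonneg: "\<forall>x\<ge>0. f x \<ge> 0"
    and f_mono: "mono_on {0..} f"
    and f0: "f 0 = 0"
    and fk: "f (real k) = real k"
    and FK: "\<forall>n\<ge>1. \<forall>A. A \<subseteq> cube n \<longrightarrow> cube_int n (\<lambda>x. f (real (hS n A x))) \<ge> g (mu n A)"
  shows "\<exists>c>0. \<forall>n\<ge>k. c * sqrt (real n) \<le> f (real n)"
proof -
  define q where "q = 1 / (2::real) ^ k"
  have q: "0 < q" "q \<le> 1" by (auto simp: q_def)
  have gq: "g q = k * q" "0 < g q" using g_val q k_pos by (auto simp: q_def)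
  obtain d where d: "0 < d" "\<And>x. x \<in> {0..1} \<Longrightarrow> \<bar>x - q\<bar> < d \<Longrightarrow> \<bar>g x - g q\<bar> < g q / 2"
    using g_cont q gq unfolding continuous_on_iff dist_real_def
    by (metis atLeastAtMost_iff half_gt_zero less_imp_le)
  obtain n0 :: nat where n0: "(1 / d)\<^sup>2 < n0" using reals_Archimedean2 by blast
  have big: "g q / 2 * sqrt (real n) \<le> f (real n)" if n: "n0 \<le> n" "1 \<le> n" for n
  proof -
    define B where "B = (\<lambda>r. {x. x \<subseteq> {..<n} \<and> card x \<le> r})"
    have finB: "finite (B r)" for r unfolding B_def by (rule finite_subset[of _ "Pow {..<n}"]) auto
    have BS: "B (Suc r) = B r \<union> {x. x \<subseteq> {..<n} \<and> card x = Suc r}" for r by (auto simp: B_def)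
    have muB: "mu n (B r) = real (card (B r)) / 2 ^ n" for r
    proof -
      have "B r \<inter> cube n = B r" by (auto simp: B_def cube_def)
      then show ?thesis by (simp add: mu_def)
    qed
    have layer: "real (n choose r) / 2 ^ n \<le> 1 / sqrt n" for r
      using binomial_le_sqrt[of n r] n by (simp add: field_simps)
    have step: "mu n (B (Suc r)) \<le> mu n (B r) + 1 / sqrt n" for r
    proof -
      have "card (B (Suc r)) \<le> card (B r) + (n choose Suc r)"
        using card_Un_le[of "B r" "{x. x \<subseteq> {..<n} \<and> card x = Suc r}"] n_subsets[of "{..<n}" "Suc r"]
        unfolding BS by simp
      then have "real (card (B (Suc r))) \<le> real (card (B r)) + real (n choose Suc r)" by linarith
      then have "mu n (B (Suc r)) \<le> mu n (B r) + real (n choose Suc r) / 2 ^ n"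
        unfolding muB by (simp add: divide_right_mono flip: add_divide_distrib)
      then show ?thesis using layer[of "Suc r"] by linarith
    qed
    have start: "mu n (B 0) \<le> 1 / sqrt n"
    proof -
      have "B 0 = {{}}" using finite_subset[of _ "{..<n}"] by (auto simp: B_def)
      then show ?thesis using layer[of 0] muB[of 0] by simp
    qed
    have full: "mu n (B n) = 1"
    proof -
      have "B n = Pow {..<n}" using card_mono[of "{..<n}"] by (auto simp: B_def)
      then show ?thesis using muB[of n] by (simp add: card_Pow)
    qed
    \<comment> \<open>The least such radius overshoots \<open>q\<close> by at most one layer, which
      is thinner than the continuity radius \<open>d\<close> for large n.\<close>
    define r where "r = (LEAST r. q \<le> mu n (B r))"
    have r1: "q \<le> mu n (B r)" unfolding r_def
      by (rule LeastI[where P = "\<lambda>r. q \<le> mu n (B r)" and k = n]) (simp add: full q)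
    have r2: "mu n (B r) \<le> q + 1 / sqrt n"
    proof (cases r)
      case 0
      then show ?thesis using start q by simp
    next
      case (Suc s)
      then have "\<not> q \<le> mu n (B s)" unfolding r_def by (metis lessI not_less_Least)
      then show ?thesis using step[of s] Suc by simp
    qed
    have "1 / d < sqrt n"
    proof (rule real_less_rsqrt)
      show "(1 / d)\<^sup>2 < real n" using n0 n by linarith
    qed
    then have near: "1 / sqrt n < d" using d n by (simp add: field_simps)
    have mu1: "mu n (B r) \<le> 1"
    proof -
      have "card (B r) \<le> card (Pow {..<n})" by (rule card_mono) (auto simp: B_def)
      then have "real (card (B r)) \<le> 2 ^ n" by (simp add: card_Pow flip: of_nat_le_iff)
      then show ?thesis by (simp add: muB)
    qed
    have "g q / 2 \<le> g (mu n (B r))"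
    proof -
      have "\<bar>g (mu n (B r)) - g q\<bar> < g q / 2"
        using near mu1 r1 r2 q by (intro d(2)) auto
      then show ?thesis by linarith
    qed
    also have "\<dots> \<le> cube_int n (\<lambda>x. f (real (hS n (B r) x)))"
    proof -
      have "B r \<subseteq> cube n" by (auto simp: B_def cube_def)
      then show ?thesis using FK n by blast
    qed
    also have "\<dots> \<le> (\<Sum>x\<in>cube n. f n * of_bool (card x = r)) / 2 ^ n"
      unfolding cube_int_def
    proof (intro divide_right_mono sum_mono)
      fix x assume x: "x \<in> cube n"
      show "f (real (hS n (B r) x)) \<le> f n * of_bool (card x = r)"
      proof (cases "hS n (B r) x = 0")
        case True
        then show ?thesis using f0 f_nonneg by simp
      next
        case False
        then have xB: "x \<in> B r" and d0: "deg n (cube n - B r) x \<noteq> 0" by (auto simp: hS_def split: if_splits)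
        have sub: "{y \<in> cube n - B r. adj n x y} \<subseteq> (\<lambda>i. flip i x) ` {..<n}"
          by (auto simp: adj_iff)
        have "deg n (cube n - B r) x \<le> card ((\<lambda>i. flip i x) ` {..<n})"
          unfolding deg_def by (rule card_mono[OF _ sub]) simp
        also have "\<dots> \<le> n" using card_image_le[of "{..<n}" "\<lambda>i. flip i x"] by simp
        finally have "hS n (B r) x \<le> n" using xB by (simp add: hS_def)
        then have "f (hS n (B r) x) \<le> f n" using f_mono by (auto simp: mono_on_def)
        moreover have "card x = r"
        proof (rule ccontr)
          assume "card x \<noteq> r"
          then have cx: "card x < r" using xB by (auto simp: B_def)
          have fx: "finite x" using xB finite_subset by (auto simp: B_def)
          have "card (flip i x) \<le> r" for i
            using cx fx card_insert_le_m1[of r x i] card_Diff1_le[of x i]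
            by (auto simp: flip_def card_insert_if)
          then have "{y \<in> cube n - B r. adj n x y} = {}"
            by (auto simp: adj_iff B_def cube_def)
          then have "deg n (cube n - B r) x = 0" unfolding deg_def by (simp only: card.empty)
          then show False using d0 by contradiction
        qed
        ultimately show ?thesis by simp
      qed
    qed simp
    also have "(\<Sum>x\<in>cube n. f n * of_bool (card x = r)) = f n * real (n choose r)"
    proof -
      have "cube n \<inter> {x. card x = r} = {x. x \<subseteq> {..<n} \<and> card x = r}" by (auto simp: cube_def)
      moreover have "finite (cube n)" by (simp add: cube_def)
      ultimately show ?thesis by (simp add: n_subsets flip: sum_distrib_left)
    qed
    also have "f n * real (n choose r) / 2 ^ n \<le> f n * (1 / sqrt n)"
      using layer[of r] f_nonneg mult_left_mono[of "real (n choose r) / 2 ^ n" "1 / sqrt n" "f n"] by simp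
    finally show ?thesis using n by (simp add: field_simps)
  qed
  \<comment> \<open>The second entry handles n below \<open>n0\<close>, where monotonicity gives
    \<open>f n \<ge> f k \<ge> 1\<close>.\<close>
  define c where "c = min (g q / 2) (1 / (sqrt n0 + 1))"
  have c: "0 < c" using gq by (auto simp: c_def intro: add_nonneg_pos)
  have "c * sqrt n \<le> f n" if n: "k \<le> n" for n
  proof (cases "n0 \<le> n")
    case True
    have "c * sqrt n \<le> g q / 2 * sqrt n" by (intro mult_right_mono) (auto simp: c_def)
    also have "\<dots> \<le> f n" using big[OF True] n k_pos by linarith
    finally show ?thesis .
  next
    case False
    then have "sqrt n \<le> sqrt n0 + 1" by (intro add_increasing2) auto
    moreover have "c \<le> 1 / (sqrt n0 + 1)" by (simp add: c_def)
    ultimately have "c * sqrt n \<le> 1 / (sqrt n0 + 1) * (sqrt n0 + 1)"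
      by (intro mult_mono) (auto intro: add_nonneg_nonneg)
    also have "\<dots> \<le> 1" by (simp add: add_nonneg_pos)
    also have "1 \<le> f k" using fk k_pos by simp
    also have "f k \<le> f n" using f_mono n by (auto simp: mono_on_def)
    finally show ?thesis .
  qed
  then show ?thesis using c by blast
qed

section \<open>Partitions of the cube\<close>

lemma density_eq_mu: "dens {..<n} A = mu n A"
proof -
  have "Pow {..<n} \<inter> {x. x \<in> A} = A \<inter> cube n" by (auto simp: cube_def)
  then show ?thesis by (simp add: avg_def mu_def)
qed

lemma flip_inject: "flip i x = flip j x \<Longrightarrow> i = j"
  unfolding flip_def by (metis Diff_iff insertE insertI1 insert_Diff singletonD singletonI)

text \<open>This is why \<open>W\<close> is added to \<open>A\<close>: a neighbour of a vertex of
  \<open>A\<close> lies in \<open>B\<close> exactly if it lies outside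
  \<open>A \<union> W\<close>.\<close>

lemma card_nabla:
  assumes "A \<union> B \<union> W = cube n" "A \<inter> B = {}" "A \<inter> W = {}" "B \<inter> W = {}"
  shows "real (card (nabla n A B)) = 2 ^ n * (\<Sum>i\<in>{..<n}. infl {..<n} (A \<union> W) W i)"
proof -
  have A: "A \<subseteq> Pow {..<n}" using assms(1) by (auto simp: cube_def)
  then have finA: "finite A" by (rule finite_subset) simp
  have deg: "card {y \<in> B. adj n x y} = card (bdirs (A \<union> W) {..<n} x)" if x: "x \<in> A" for x
  proof -
    have xc: "x \<in> cube n" using x assms(1) by auto
    have in_cube: "flip i x \<in> cube n" if "i < n" for i
      using xc that by (auto simp: cube_def flip_def)
    have B: "flip i x \<in> B \<longleftrightarrow> flip i x \<notin> A \<union> W" if "i < n" for i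
      using in_cube[OF that] assms by blast
    have "{y \<in> B. adj n x y} = (\<lambda>i. flip i x) ` bdirs (A \<union> W) {..<n} x"
      using xc B by (auto simp: adj_iff bdirs_def)
    moreover have "inj_on (\<lambda>i. flip i x) (bdirs (A \<union> W) {..<n} x)"
      by (rule inj_onI) (rule flip_inject)
    ultimately show ?thesis by (simp add: card_image)
  qed
  have "nabla n A B = (SIGMA x:A. {y \<in> B. adj n x y})" by (auto simp: nabla_def)
  moreover have "finite {y \<in> B. adj n x y}" for x
    by (rule finite_subset[of _ "cube n"]) (use assms(1) in \<open>auto simp: cube_def\<close>)
  ultimately have "card (nabla n A B) = (\<Sum>x\<in>A. card (bdirs (A \<union> W) {..<n} x))"
    using finA deg by simp
  then have "real (card (nabla n A B)) = (\<Sum>x\<in>A. real (card (bdirs (A \<union> W) {..<n} x)))" by simp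
  also have "\<dots> = (\<Sum>x\<in>Pow {..<n}. of_bool (x \<in> A \<union> W \<and> x \<notin> W) * real (card (bdirs (A \<union> W) {..<n} x)))"
    using A assms(3) by (intro sum.mono_neutral_cong_left) auto
  also have "\<dots> = 2 ^ n * (\<Sum>i\<in>{..<n}. infl {..<n} (A \<union> W) W i)"
    by (subst sum_infl) (simp_all add: avg_def)
  finally show ?thesis .
qed

lemma card_nabla_dir:
  assumes "A \<subseteq> cube n"
  shows "real (card (nabla_dir i A)) = 2 ^ n * avg {..<n} (\<lambda>x. of_bool (x \<in> A \<and> flip i x \<notin> A))"
proof -
  have "nabla_dir i A = (\<lambda>x. (x, flip i x)) ` {x \<in> A. flip i x \<notin> A}" by (auto simp: nabla_dir_def)
  moreover have "inj_on (\<lambda>x. (x, flip i x)) {x \<in> A. flip i x \<notin> A}" by (rule inj_onI) simp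
  moreover have "Pow {..<n} \<inter> {x. x \<in> A \<and> flip i x \<notin> A} = {x \<in> A. flip i x \<notin> A}"
    using assms by (auto simp: cube_def)
  ultimately show ?thesis by (simp add: avg_def card_image)
qed

lemma density_subcube:
  assumes "finite N" "I \<subseteq> N"
  shows "dens N {x. \<forall>i\<in>I. (i \<in> x) = z i} = 1 / 2 ^ card I"
proof -
  have fin: "finite I" "finite (N - I)" "I \<inter> (N - I) = {}" using assms finite_subset by auto
  have un: "I \<union> (N - I) = N" using assms by auto
  have "dens N {x. \<forall>i\<in>I. (i \<in> x) = z i}
      = avg I (\<lambda>u. avg (N - I) (\<lambda>w. of_bool (u \<union> w \<in> {x. \<forall>i\<in>I. (i \<in> x) = z i})))"
    using avg_Un[OF fin, of "\<lambda>x. of_bool (x \<in> {x. \<forall>i\<in>I. (i \<in> x) = z i})"] un by simp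
  also have "\<dots> = avg I (\<lambda>u. avg (N - I) (\<lambda>w. of_bool (u = {i \<in> I. z i})))"
    by (intro avg_cong arg_cong[of _ _ of_bool]) auto
  also have "\<dots> = avg I (\<lambda>u. of_bool (u = {i \<in> I. z i}))" using fin by simp
  also have "\<dots> = 1 / 2 ^ card I"
  proof -
    have "Pow I \<inter> {u. u = {i \<in> I. z i}} = {{i \<in> I. z i}}" by auto
    then show ?thesis using fin by (simp add: avg_def)
  qed
  finally show ?thesis .
qed

text \<open>If \<open>x\<close> and \<open>flip i x\<close> both lie in \<open>A\<close>, one of
  them is on the wrong side of direction \<open>i\<close>, hence in the part of \<open>A\<close>
  outside the subcube. So almost all of \<open>A\<close> is boundary in each direction of
  \<open>I\<close>.\<close>

lemma subcube_approximation:
  assumes n: "A \<subseteq> cube n" "I \<subseteq> {..<n}" "card I = k"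
    and A: "(1 - \<epsilon>) / 2 ^ k \<le> mu n A" and \<epsilon>: "0 < \<epsilon>"
    and T: "dens {..<n} {x \<in> A \<union> W. \<exists>i\<in>I. (i \<in> x) \<noteq> z i} \<le> t"
  shows "\<forall>i\<in>I. real (card (nabla_dir i A)) \<ge> (1 - \<epsilon> - 2 * 2 ^ k * t) * 2 ^ n / 2 ^ k"
    and "mu n ((subcube n I z - A) \<union> (A - subcube n I z)) \<le> \<epsilon> + 2 * t"
proof -
  define N where "N = {..<n}"
  have N: "finite N" "I \<subseteq> N" using n by (auto simp: N_def)
  define T where "T = {x \<in> A. \<exists>i\<in>I. (i \<in> x) \<noteq> z i}"
  define C where "C = {x. \<forall>i\<in>I. (i \<in> x) = z i}"
  have "dens N T \<le> dens N {x \<in> A \<union> W. \<exists>i\<in>I. (i \<in> x) \<noteq> z i}"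
    by (rule avg_mono) (auto simp: T_def)
  then have Tt: "dens N T \<le> t" using T by (simp add: N_def)
  have muA: "dens N A = mu n A" by (simp add: N_def density_eq_mu)
  show "\<forall>i\<in>I. real (card (nabla_dir i A)) \<ge> (1 - \<epsilon> - 2 * 2 ^ k * t) * 2 ^ n / 2 ^ k"
  proof
    fix i assume i: "i \<in> I"
    have "dens N A \<le> avg N (\<lambda>x. of_bool (x \<in> A \<and> flip i x \<notin> A) + of_bool (x \<in> T) + of_bool (flip i x \<in> T))"
    proof (rule avg_mono)
      fix x
      have "flip i x \<in> T" if "x \<in> A" "flip i x \<in> A" "x \<notin> T"
        using that i by (auto simp: T_def flip_def)
      then show "of_bool (x \<in> A) \<le> (of_bool (x \<in> A \<and> flip i x \<notin> A) + of_bool (x \<in> T) + of_bool (flip i x \<in> T) :: real)"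
        by auto
    qed
    also have "\<dots> = avg N (\<lambda>x. of_bool (x \<in> A \<and> flip i x \<notin> A)) + 2 * dens N T"
      unfolding avg_add using avg_flip[of N i "\<lambda>x. of_bool (x \<in> T)"] N i by auto
    finally have "(1 - \<epsilon>) / 2 ^ k - 2 * t \<le> avg N (\<lambda>x. of_bool (x \<in> A \<and> flip i x \<notin> A))"
      using A Tt muA by linarith
    then have "2 ^ n * ((1 - \<epsilon>) / 2 ^ k - 2 * t) \<le> real (card (nabla_dir i A))"
      unfolding card_nabla_dir[OF n(1)] N_def by (intro mult_left_mono) auto
    moreover have "2 ^ n * ((1 - \<epsilon>) / 2 ^ k - 2 * t) = (1 - \<epsilon> - 2 * 2 ^ k * t) * 2 ^ n / 2 ^ k"
      by (simp add: field_simps)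
    ultimately show "(1 - \<epsilon> - 2 * 2 ^ k * t) * 2 ^ n / 2 ^ k \<le> real (card (nabla_dir i A))" by simp
  qed
  have "mu n ((subcube n I z - A) \<union> (A - subcube n I z))
      = dens N ((subcube n I z - A) \<union> (A - subcube n I z))"
    unfolding N_def by (rule density_eq_mu[symmetric])
  \<comment> \<open>On the cube the symmetric difference has indicator C - A + 2 (A - C), and
    \<open>T\<close> is \<open>A - C\<close>; the density of \<open>C\<close> is exactly
    \<open>1 / 2 ^ k\<close>.\<close>
  also have "\<dots> = avg N (\<lambda>x. of_bool (x \<in> C) - of_bool (x \<in> A) + 2 * of_bool (x \<in> T))"
    by (rule avg_cong) (auto simp: subcube_def C_def T_def N_def cube_def)
  also have "\<dots> = 1 / 2 ^ k - mu n A + 2 * dens N T"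
    unfolding avg_add avg_diff avg_cmult muA using density_subcube[OF N, of z] n by (simp add: C_def)
  also have "\<dots> \<le> \<epsilon> / 2 ^ k + 2 * t" using A Tt by (simp add: diff_divide_distrib)
  also have "\<epsilon> / 2 ^ k \<le> \<epsilon>" using \<epsilon> by (simp add: divide_le_eq)
  finally show "mu n ((subcube n I z - A) \<union> (A - subcube n I z)) \<le> \<epsilon> + 2 * t" by simp
qed

theorem theorem1p11:
  fixes k :: nat and f g :: "real \<Rightarrow> real"
  assumes k_pos: "k \<ge> 1"
    and g_cont: "continuous_on {0..1} g"
    and g_nonneg: "\<forall>x\<in>{0..1}. g x \<ge> 0"
    and g_val: "g (1 / 2 ^ k) = real k / 2 ^ k"
    and f_nonneg: "\<forall>x\<ge>0. f x \<ge> 0"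
    and f_mono: "mono_on {0..} f"
    and f_conc: "strictly_concave_on {0..} f"
    and f0: "f 0 = 0"
    and fk: "f (real k) = real k"
    and FK: "\<forall>n\<ge>1. \<forall>A. A \<subseteq> cube n \<longrightarrow>
               cube_int n (\<lambda>x. f (real (hS n A x))) \<ge> g (mu n A)"
  shows "\<exists>K>0. \<forall>n (\<epsilon>::real) A B W.
           k \<le> n \<longrightarrow> \<epsilon> > 0 \<longrightarrow>
           A \<union> B \<union> W = cube n \<longrightarrow> A \<inter> B = {} \<longrightarrow> A \<inter> W = {} \<longrightarrow> B \<inter> W = {} \<longrightarrow>
           (1 - \<epsilon>) / 2 ^ k \<le> mu n A \<longrightarrow> mu n A \<le> (1 + \<epsilon>) / 2 ^ k \<longrightarrow>
           mu n W \<le> \<epsilon> / f (real n) \<longrightarrow>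
           real (card (nabla n A B)) < (1 + \<epsilon>) * real k * 2 ^ n / 2 ^ k \<longrightarrow>
           (\<exists>I. I \<subseteq> {..<n} \<and> card I = k \<and>
              (\<forall>i\<in>I. real (card (nabla_dir i A)) \<ge> (1 - K * \<epsilon>) * 2 ^ n / 2 ^ k)) \<and>
           (\<exists>C. is_subcube_codim n k C \<and> mu n ((C - A) \<union> (A - C)) \<le> K * \<epsilon>)"
proof -
  obtain c where c: "0 < c" "\<And>n. k \<le> n \<Longrightarrow> c * sqrt (real n) \<le> f (real n)"
    using growth_from_isoperimetry[OF k_pos g_cont g_val f_nonneg f_mono f0 fk FK] by blast
  from linear_stability[of k] obtain \<zeta> K' where \<zeta>: "0 < \<zeta>" and K': "0 < K'"
    and stab: "\<forall>N S W \<epsilon>. finite N \<longrightarrow> \<epsilon> \<le> \<zeta> \<longrightarrow> \<bar>dens N S - 1 / 2 ^ k\<bar> \<le> \<epsilon> \<longrightarrow>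
    dens N W \<le> \<epsilon> \<longrightarrow> sqrt (card N) * dens N W \<le> \<epsilon> \<longrightarrow>
    (\<Sum>i\<in>N. infl N S W i) \<le> k / 2 ^ k + \<epsilon> \<longrightarrow>
    (\<exists>I z. I \<subseteq> N \<and> card I = k \<and> dens N {x \<in> S. \<exists>i\<in>I. (i \<in> x) \<noteq> z i} \<le> K' * \<epsilon>)"
    by (elim exE conjE) (rule that)
  \<comment> \<open>\<open>R * \<epsilon>\<close> dominates all errors at once:
    \<open>2 * \<epsilon>\<close> in the density of \<open>A \<union> W\<close>,
    \<open>k * \<epsilon>\<close> in the edge count and \<open>\<epsilon> / c\<close> in
    \<open>sqrt n * mu n W\<close>.\<close>
  define R where "R = 2 + real k + 1 / c"
  have R: "2 \<le> R" "real k \<le> R" "1 / c \<le> R" using c by (auto simp: R_def)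
  \<comment> \<open>The last summand makes \<open>K * \<epsilon>\<close> at least 1 whenever
    \<open>R * \<epsilon>\<close> exceeds \<zeta>.\<close>
  define K where "K = 1 + 2 * 2 ^ k * (K' * R) + R / \<zeta>"
  have nn: "0 \<le> 2 * 2 ^ k * (K' * R)" "0 \<le> R / \<zeta>" "0 \<le> K' * R" using K' R \<zeta> by auto
  have K0: "0 < K" using nn unfolding K_def by linarith
  show ?thesis
  proof (intro exI[of _ K] conjI[OF K0] allI impI)
    fix n \<epsilon> A B W
    assume n: "k \<le> n" and \<epsilon>: "0 < \<epsilon>" and part: "A \<union> B \<union> W = cube n" "A \<inter> B = {}" "A \<inter> W = {}" "B \<inter> W = {}"
      and A1: "(1 - \<epsilon>) / 2 ^ k \<le> mu n A" and A2: "mu n A \<le> (1 + \<epsilon>) / 2 ^ k"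
      and W: "mu n W \<le> \<epsilon> / f (real n)"
      and edges: "real (card (nabla n A B)) < (1 + \<epsilon>) * real k * 2 ^ n / 2 ^ k"
    have Ac: "A \<subseteq> cube n" using part by auto
    show "(\<exists>I. I \<subseteq> {..<n} \<and> card I = k \<and>
              (\<forall>i\<in>I. real (card (nabla_dir i A)) \<ge> (1 - K * \<epsilon>) * 2 ^ n / 2 ^ k)) \<and>
           (\<exists>C. is_subcube_codim n k C \<and> mu n ((C - A) \<union> (A - C)) \<le> K * \<epsilon>)"
    proof (cases "R * \<epsilon> \<le> \<zeta>")
      case True
      define S where "S = A \<union> W"
      have k2: "(1::real) \<le> 2 ^ k" by simp
      have fn: "1 \<le> f (real n)"
      proof -
        have "f (real k) \<le> f (real n)" using f_mono n by (auto simp: mono_on_def)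
        then show ?thesis using fk k_pos by simp
      qed
      have w0: "0 \<le> mu n W" by (simp add: mu_def)
      have "\<epsilon> / f (real n) \<le> \<epsilon>" using fn \<epsilon> by (simp add: divide_le_eq)
      then have w1: "mu n W \<le> \<epsilon>" using W by simp
      have w2: "sqrt n * mu n W \<le> 1 / c * \<epsilon>"
      proof -
        have "sqrt n * mu n W \<le> sqrt n * (\<epsilon> / f (real n))" using W by (intro mult_left_mono) auto
        also have "\<dots> = \<epsilon> * (sqrt n / f (real n))" by simp
        also have "\<dots> \<le> \<epsilon> * (1 / c)"
          using c(2)[OF n] c(1) fn \<epsilon> by (intro mult_left_mono) (auto simp: field_simps)
        finally show ?thesis by simp
      qed
      have muS: "dens {..<n} S = mu n A + mu n W"
        unfolding density_eq_mu[symmetric] avg_add[symmetric] S_def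
        by (rule avg_cong) (use part in auto)
      have e2: "\<epsilon> / 2 ^ k \<le> \<epsilon>" using \<epsilon> k2 by (simp add: divide_le_eq)
      have Re: "2 * \<epsilon> \<le> R * \<epsilon>" "real k * \<epsilon> \<le> R * \<epsilon>" "1 / c * \<epsilon> \<le> R * \<epsilon>"
        by (rule mult_right_mono, rule R, use \<epsilon> in simp)+
      have "\<exists>I z. I \<subseteq> {..<n} \<and> card I = k \<and> dens {..<n} {x \<in> S. \<exists>i\<in>I. (i \<in> x) \<noteq> z i} \<le> K' * (R * \<epsilon>)"
      proof (rule stab[rule_format, where W = W])
        show "R * \<epsilon> \<le> \<zeta>" by (rule True)
        show "\<bar>dens {..<n} S - 1 / 2 ^ k\<bar> \<le> R * \<epsilon>"
          using A1 A2 w0 w1 e2 Re(1) \<epsilon>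
          unfolding muS abs_le_iff add_divide_distrib diff_divide_distrib by linarith
        show "dens {..<n} W \<le> R * \<epsilon>" unfolding density_eq_mu using w1 Re(1) \<epsilon> by linarith
        show "sqrt (card {..<n}) * dens {..<n} W \<le> R * \<epsilon>"
          unfolding density_eq_mu using w2 Re(3) by simp
        have "2 ^ n * (\<Sum>i\<in>{..<n}. infl {..<n} S W i) \<le> 2 ^ n * ((1 + \<epsilon>) * real k / 2 ^ k)"
          using edges unfolding card_nabla[OF part] S_def by (simp add: mult_ac)
        then have "(\<Sum>i\<in>{..<n}. infl {..<n} S W i) \<le> (1 + \<epsilon>) * real k / 2 ^ k"
          by (simp only: mult_le_cancel_left_pos zero_less_power zero_less_numeral)
        also have "\<dots> = real k / 2 ^ k + real k * \<epsilon> / 2 ^ k" by (simp add: distrib_right add_divide_distrib)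
        also have "real k * \<epsilon> / 2 ^ k \<le> real k * \<epsilon> / 1"
          using \<epsilon> k2 by (intro divide_left_mono) auto
        finally show "(\<Sum>i\<in>{..<n}. infl {..<n} S W i) \<le> real k / 2 ^ k + R * \<epsilon>"
          using Re(2) by simp
      qed simp
      then obtain I z where I: "I \<subseteq> {..<n}" "card I = k"
        and t: "dens {..<n} {x \<in> A \<union> W. \<exists>i\<in>I. (i \<in> x) \<noteq> z i} \<le> K' * (R * \<epsilon>)"
        unfolding S_def by blast
      note approx = subcube_approximation[OF Ac I A1 \<epsilon> t]
      have K1: "\<epsilon> + 2 * 2 ^ k * (K' * (R * \<epsilon>)) \<le> K * \<epsilon>"
      proof -
        have "0 \<le> R / \<zeta> * \<epsilon>" using nn(2) \<epsilon> by (intro mult_nonneg_nonneg) auto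
        moreover have "K * \<epsilon> = \<epsilon> + 2 * 2 ^ k * (K' * (R * \<epsilon>)) + R / \<zeta> * \<epsilon>"
          unfolding K_def by (simp only: distrib_right mult_1 mult.assoc)
        ultimately show ?thesis by linarith
      qed
      have "1 * (2 * (K' * (R * \<epsilon>))) \<le> 2 ^ k * (2 * (K' * (R * \<epsilon>)))"
        using k2 K' R \<epsilon> by (intro mult_right_mono) auto
      then have K2: "\<epsilon> + 2 * (K' * (R * \<epsilon>)) \<le> K * \<epsilon>" using K1 by (simp add: mult_ac)
      show ?thesis
      proof (intro conjI exI)
        show "I \<subseteq> {..<n}" "card I = k" by (fact I)+
        show "\<forall>i\<in>I. real (card (nabla_dir i A)) \<ge> (1 - K * \<epsilon>) * 2 ^ n / 2 ^ k"
        proof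
          fix i assume "i \<in> I"
          have "(1 - K * \<epsilon>) * 2 ^ n / 2 ^ k \<le> (1 - \<epsilon> - 2 * 2 ^ k * (K' * (R * \<epsilon>))) * 2 ^ n / 2 ^ k"
            using K1 by (intro divide_right_mono mult_right_mono) auto
          then show "(1 - K * \<epsilon>) * 2 ^ n / 2 ^ k \<le> real (card (nabla_dir i A))"
            using approx(1) \<open>i \<in> I\<close> by (meson order_trans)
        qed
        show "is_subcube_codim n k (subcube n I z)" using I by (auto simp: is_subcube_codim_def)
        show "mu n ((subcube n I z - A) \<union> (A - subcube n I z)) \<le> K * \<epsilon>"
          using approx(2) K2 by linarith
      qed
    next
      case False
      \<comment> \<open>For such large \<epsilon> both bounds are trivial, and any k coordinates
        will do; they exist since k is at most n.\<close>
      then have "1 \<le> R / \<zeta> * \<epsilon>" using \<zeta> by (simp add: field_simps)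
      also have "\<dots> \<le> K * \<epsilon>"
      proof (rule mult_right_mono)
        show "R / \<zeta> \<le> K" using nn unfolding K_def by linarith
      qed (use \<epsilon> in simp)
      finally have K1: "1 \<le> K * \<epsilon>" .
      show ?thesis
      proof (intro conjI exI)
        show "{..<k} \<subseteq> {..<n}" "card {..<k} = k" using n by auto
        show "\<forall>i\<in>{..<k}. real (card (nabla_dir i A)) \<ge> (1 - K * \<epsilon>) * 2 ^ n / 2 ^ k"
        proof
          fix i
          have "(1 - K * \<epsilon>) * 2 ^ n / 2 ^ k \<le> 0"
            using K1 by (intro divide_nonpos_nonneg mult_nonpos_nonneg) auto
          then show "(1 - K * \<epsilon>) * 2 ^ n / 2 ^ k \<le> real (card (nabla_dir i A))" by linarith
        qed
        show "is_subcube_codim n k (subcube n {..<k} (\<lambda>_. True))"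
          unfolding is_subcube_codim_def using n
          by (intro exI[of _ "{..<k}"] exI[of _ "\<lambda>_. True"]) auto
        show "mu n ((subcube n {..<k} (\<lambda>_. True) - A) \<union> (A - subcube n {..<k} (\<lambda>_. True))) \<le> K * \<epsilon>"
          using K1 density_le_1[of "{..<n}"] unfolding density_eq_mu
          by (meson finite_lessThan order_trans)
      qed
    qed
  qed
qed

end
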